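(* Consider the $s$-stage DG-IMEX scheme described in the context, in which every implicit update is computed by the modified Richardson iteration of the context with $0<\lambda\le(1+v)^{-1}$. Assume: 1. For every $\ell=1,\dots,d$ the $M_x$-point Legendre--Gauss--Lobatto (LGL) quadrature on $K^\ell$ is exact for computing the cell average of $\mathbf U_h^{(j)}$ over $K^\ell$; the $M_\varepsilon$-point LGL quadrature on $K_\varepsilon$ is exact for computing the ($\varepsilon^2$-weighted) cell average of $\mathbf U_h^{(j)}$ over $K_\varepsilon$; the time step satisfies $$\Delta t\le \hat c\,\min_{K_\varepsilon,K^\ell}\Big\{\,W(1-v)\frac{\hat w^\varepsilon_{M_\varepsilon}\Delta\varepsilon}{(d+1)\,\varepsilon_{\rm H}\,a^\varepsilon},\ \frac{\hat w^\ell_{M_x}\Delta x^\ell}{(d+1)\,a^\ell}\Big\}$$ with $a^\varepsilon\ge|q|$, $a^\ell\ge1$ and $\hat c=\min_{i,j}1/\hat c_{ij}$; and the initial stage $\mathbf U_h^{(0)}=\mathbf U_h^{n}$ takes values in $\mathcal R$ at all points of $\widetilde S_\otimes(\mathbf K)$, for all elements $\mathbf K$. 2. At each stage, once $\mathbf U^{(i)}_{\mathbf K}\in\mathcal R$, the realizability-enforcing limiter (which preserves cell averages) is invoked to enforce $\mathbf U_h^{(i)}\in\mathcal R$ at all points of $\widetilde S_\otimes(\mathbf K)$. 3. In the $s$-stage IMEX scheme, $\mathbf u^{n+1}=\mathbf u^{(s)}$. Then $\mathbf U_{\mathbf K}^{n+1}\in\mathcal R$ (for every element $\mathbf K$).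
   Context: **Kinematics.** Units $c=1$, metric $\eta=\mathrm{diag}(-1,1,1,1)$. The three-velocity $v^i(\boldsymbol x)$ is time independent, $v=\sqrt{v_iv^i}<1$, $W=(1-v^2)^{-1/2}$, $u^\mu=W(1,v^i)$, $n^\mu=(1,0,0,0)$, $v^\mu=(0,v^i)$. For $\omega=(\vartheta,\varphi)\in\mathbb S^2$ put $\ell^{\hat\imath}=(\cos\vartheta,\sin\vartheta\cos\varphi,\sin\vartheta\sin\varphi)$ and let $\ell^\mu$ be its Lorentz boost: $\ell^0=W v_j\ell^{\hat\jmath}$, $\ell^i=\ell^{\hat\imath}+(W-1)v^i(v_j\ell^{\hat\jmath})/v^2$ ($\ell^i=\ell^{\hat\imath}$ if $v=0$), so $u_\mu\ell^\mu=0$, $\ell_\mu\ell^\mu=1$. For $\varepsilon>0$: $p^\mu=\varepsilon(u^\mu+\ell^\mu)$, $E=-n_\mu p^\mu=\varepsilon(W+v_\mu\ell^\mu)>0$, and $L^\mu$ is defined by $p^\mu=E(n^\mu+L^\mu)$, so $L^0=0$, $L_iL^i=1$. Put $q=p^\nu p^\rho\partial_\nu u_\rho/\varepsilon^2$, with $\partial_\nu u_\rho$ replaced by the given (discrete) four-velocity gradient; $a^\varepsilon(\boldsymbol x)\ge|q|$ means for all $\omega$. **Realizability.** $\mathfrak R$ is the set of integrable $f\ge0$ on $\mathbb S^2$ with $\frac1{4\pi}\int_{\mathbb S^2}f\,d\omega>0$. A pair (scalar, covector) $(\mathscr J,\mathscr H_\mu)$ is in $\mathcal R$ (realizable) if $\mathscr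 J>0$ and $\mathscr J\ge\sqrt{\mathscr H_\mu\mathscr H^\mu}$. Eulerian pairs $\mathbf U=(\mathcal E,\mathcal F_j)$ have $\mathcal F_0=0$; Lagrangian pairs $\mathbf M=(\mathcal J,\mathcal H_i)$ and "hat" pairs $\widehat{\mathbf U}=(\widehat{\mathcal E},\widehat{\mathcal F}_i)$ have $\mathcal H_0=-v^i\mathcal H_i$, $\widehat{\mathcal F}_0=-v^i\widehat{\mathcal F}_i$. **Exact closure (standing assumption).** Each realizable moment value is closed by some $f\in\mathfrak R$ such that $\mathcal J=\frac{\varepsilon}{4\pi}\int f\,d\omega$, $\mathcal H_\mu=\frac{\varepsilon}{4\pi}\int f\ell_\mu d\omega$, $\mathcal K_{\mu\nu}=\frac{\varepsilon}{4\pi}\int f\ell_\mu\ell_\nu d\omega$ and $$\mathbf U=\tfrac1{4\pi}\!\int\tfrac{E^2}{\varepsilon}f\,(1,L_j)\,d\omega,\quad \mathbf F^i=\tfrac1{4\pi}\!\int\tfrac{E^2}{\varepsilon}fL^i(1,L_j)\,d\omega,$$ $$\widetilde{\mathbf U}=\tfrac1{4\pi}\!\int Ef\,(1,L_j)\,d\omega,\quad \mathbf F^\varepsilon=-\tfrac1{4\pi}\!\int qEf\,(1,L_j)\,d\omega .$$ **Mesh and quadrature.** $\Omega_\varepsilon\times\Omega_{\boldsymbol x}\subset\mathbb R^+\times\mathbb R^d$ is divided into elements $\mathbf K=K_\varepsilon\times\mathbf K_{\boldsymbol x}$, $\mathbf K_{\boldsymbol x}=K^1\times\dots\times K^d$,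 $K_\varepsilon=(\varepsilon_{\rm L},\varepsilon_{\rm H})$, $K^\ell=(x^\ell_{\rm L},x^\ell_{\rm H})$, $\Delta\varepsilon=\varepsilon_{\rm H}-\varepsilon_{\rm L}$, $\Delta x^\ell=x^\ell_{\rm H}-x^\ell_{\rm L}$; $|K_\varepsilon|=\int_{K_\varepsilon}\varepsilon^2d\varepsilon$, $|\mathbf K_{\boldsymbol x}|=\prod_\ell\Delta x^\ell$, $|\mathbf K|=|K_\varepsilon||\mathbf K_{\boldsymbol x}|$, $\widetilde{\mathbf K}^\ell=K_\varepsilon\times\prod_{j\ne\ell}K^j$. $\mathbf U_h$ is, on each element, a tensor-product polynomial of degree $\le k$ in each of $\varepsilon,x^1,\dots,x^d$. $M_\varepsilon\ge(k+5)/2$ and $M_x\ge(k+3)/2$ LGL points (element endpoints included) are used on $K_\varepsilon$ and $K^\ell$, with weights $\hat w^\varepsilon_q$, $\hat w^\ell_q$ normalized to sum to 1. $S_\otimes(\mathbf K)$ is the tensor product of $N$-point Legendre--Gauss (LG) points in all dimensions; $\hat S_{\varepsilon,\otimes}(\mathbf K)$ (resp. $\hat S_{\ell,\otimes}(\mathbf K)$) is the same set with LG points in the $\varepsilon$ (resp. $x^\ell$) dimension replaced by the LGL points; $\widetilde S_\otimes(\mathbf K)$ is the union of all these sets. Face integrals are evaluated with the tensor LG quadrature, taken exact for the polynomials in the cell averages. Traces exterior to the domain (boundary data) are realizable. **Fluxes.** $\widehat{\mathbf F}^\ell=\frac12[\mathbf F^\ell|_{x^-}+\mathbf F^\ell|_{x^+}-a^\ell(\mathbf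 U_h|_{x^+}-\mathbf U_h|_{x^-})]$ and $\widehat{\mathbf F}^\varepsilon=\frac12[\mathbf F^\varepsilon|_{\varepsilon^-}+\mathbf F^\varepsilon|_{\varepsilon^+}-a^\varepsilon(\widetilde{\mathbf U}|_{\varepsilon^+}-\widetilde{\mathbf U}|_{\varepsilon^-})]$, where $\pm$ denote one-sided traces. **Scheme for cell averages.** $\mathbf U_{\mathbf K}=\frac1{|\mathbf K|}\int_{\mathbf K}\mathbf U_h\varepsilon^2d\varepsilon\,d\boldsymbol x$. With $\mathbf U^{(0)}=\mathbf U^n$, $c_{ij}\ge0$, $\sum_{j=0}^{i-1}c_{ij}=1$, $\hat c_{ij}\ge0$, $a_{ii}\ge0$, for $i=1,\dots,s$: $$\mathbf U^{(ij)}_{\mathbf K}=\mathbf U^{(j)}_{\mathbf K}+\hat c_{ij}\Delta t\,\mathbf T(\mathbf U_h^{(j)})_{\mathbf K},\quad \mathbf U^{(i)}_{\rm Ex}=\sum_{j=0}^{i-1}c_{ij}\mathbf U^{(ij)}_{\mathbf K},\quad \mathbf U^{(i)}_{\mathbf K}=\mathbf U^{(i)}_{\rm Ex}+a_{ii}\Delta t\,\boldsymbol{\mathcal C}(\mathbf U^{(i)}_{\mathbf K}),$$ $$\mathbf T(\mathbf U_h)_{\mathbf K}=-\tfrac1{|\mathbf K|}\int_{\mathbf K_{\boldsymbol x}}[\varepsilon^3\widehat{\mathbf F}^\varepsilon|_{\varepsilon_{\rm H}}-\varepsilon^3\widehat{\mathbf F}^\varepsilon|_{\varepsilon_{\rm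 L}}]d\boldsymbol x-\sum_{\ell=1}^d\tfrac1{|\mathbf K|}\int_{\widetilde{\mathbf K}^\ell}[\widehat{\mathbf F}^\ell|_{x^\ell_{\rm H}}-\widehat{\mathbf F}^\ell|_{x^\ell_{\rm L}}]\varepsilon^2d\tilde{\boldsymbol z}^\ell,$$ where $\tilde{\boldsymbol z}^\ell$ are the coordinates on $\widetilde{\mathbf K}^\ell$. (The other degrees of freedom of $\mathbf U_h^{(i)}$ come from testing the DG weak form with higher-degree polynomials.) $\mathbf u$ denotes the collection of all degrees of freedom. **Implicit update.** With $A\,(a,b)=(Wa+v^ib_i,\ b_i+Wv_ia)$, one has $\mathbf U=A\widehat{\mathbf U}$, and the closure relation is $\widehat{\mathbf U}(\mathbf M)=(W\mathcal J+v^i\mathcal H_i,\ W\mathcal H_j+v^i\mathcal K_{ij})$. The collision term is $\boldsymbol{\mathcal C}(\mathbf U)=A\widehat{\boldsymbol{\mathcal C}}(\mathbf M)$, $\widehat{\boldsymbol{\mathcal C}}(\mathbf M)=(\chi(\mathcal J_{\rm Eq}-\mathcal J),-\kappa\mathcal H_j)$, with $0\le\chi\le\kappa$, $\mathcal J_{\rm Eq}\ge0$. The modified Richardson iteration, with $\Delta\tau=a_{ii}\Delta t$ and $\widehat{\mathbf U}^{( * )}=A^{-1}\mathbf U^{(i)}_{\rm Ex}$, is $$\mathbf M^{[k+1]}=\mathbf M^{[k]}-\lambda\Lambda\big[\widehat{\mathbf U}(\mathbf M^{[k]})-\widehat{\mathbf U}^{( * )}-\Delta\tau\widehat{\boldsymbol{\mathcal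 C}}(\mathbf M^{[k]})\big],\qquad \mathbf M^{[0]}=\widehat{\mathbf U}^{( * )},$$ $\Lambda=\mathrm{diag}(\mu_\chi,\mu_\kappa,\mu_\kappa,\mu_\kappa)$, $\mu_\chi=(W+\lambda\Delta\tau\chi)^{-1}$, $\mu_\kappa=(W+\lambda\Delta\tau\kappa)^{-1}$. $\mathbf U^{(i)}_{\mathbf K}$ is the conserved moment $A\widehat{\mathbf U}(\mathbf M)$ of the limit $\mathbf M$ to which the iteration converges. **Limiter.** On each element it replaces $\mathbf U_h$ by a polynomial obtained by scaling towards the cell average (first $\mathcal E_h\to\theta_1\mathcal E_h+(1-\theta_1)\mathcal E_{\mathbf K}$, then $\mathbf U_h\to\theta_2\mathbf U_h+(1-\theta_2)\mathbf U_{\mathbf K}$, $\theta_1,\theta_2\in[0,1]$), leaving $\mathbf U_{\mathbf K}$ unchanged. *)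

theory Defs
  imports "HOL-Analysis.Analysis" "HOL-Computational_Algebra.Polynomial"
begin

section \<open>Kinematics\<close>

text \<open>Spacetime indices are \<open>3 option\<close>: \<open>None\<close> is the time index 0 and \<open>Some i\<close> a spatial index.
  Spatial indices are raised and lowered with the identity, so \<open>v\<^sup>i\<close> and \<open>v\<^sub>i\<close> are the same vector.\<close>

type_synonym fourvec = "real ^ (3 option)"
type_synonym angle = "real \<times> real"
type_synonym moments = "real \<times> (real ^ 3)"

definition vec4 :: "real \<Rightarrow> real ^ 3 \<Rightarrow> fourvec" where
  "vec4 t y = (\<chi> \<mu>. case \<mu> of None \<Rightarrow> t | Some i \<Rightarrow> y $ i)"

definition spat :: "fourvec \<Rightarrow> real ^ 3" where
  "spat a = (\<chi> i. a $ Some i)"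

definition eta :: "3 option \<Rightarrow> 3 option \<Rightarrow> real" where
  "eta \<mu> \<nu> = (if \<mu> = \<nu> then (if \<mu> = None then - 1 else 1) else 0)"

definition lower :: "fourvec \<Rightarrow> fourvec" where
  "lower a = (\<chi> \<mu>. \<Sum>\<nu>\<in>UNIV. eta \<mu> \<nu> * a $ \<nu>)"

text \<open>Since \<open>\<eta>\<close> is its own inverse, this also contracts two covectors.\<close>

definition mdot :: "fourvec \<Rightarrow> fourvec \<Rightarrow> real" where
  "mdot a b = (\<Sum>\<mu>\<in>UNIV. lower a $ \<mu> * b $ \<mu>)"

definition lorentz :: "real ^ 3 \<Rightarrow> real" where
  "lorentz v = 1 / sqrt (1 - (norm v)\<^sup>2)"

definition u4 :: "real ^ 3 \<Rightarrow> fourvec" where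
  "u4 v = lorentz v *\<^sub>R vec4 1 v"

definition n4 :: fourvec where
  "n4 = vec4 1 0"

definition lhat :: "angle \<Rightarrow> real ^ 3" where
  "lhat w = vector [cos (fst w), sin (fst w) * cos (snd w), sin (fst w) * sin (snd w)]"

definition l4 :: "real ^ 3 \<Rightarrow> angle \<Rightarrow> fourvec" where
  "l4 v w = vec4 (lorentz v * (v \<bullet> lhat w))
     (if v = 0 then lhat w
      else lhat w + ((lorentz v - 1) * (v \<bullet> lhat w) / (norm v)\<^sup>2) *\<^sub>R v)"

definition p4 :: "real \<Rightarrow> real ^ 3 \<Rightarrow> angle \<Rightarrow> fourvec" where
  "p4 eps v w = eps *\<^sub>R (u4 v + l4 v w)"

definition eul_energy :: "real \<Rightarrow> real ^ 3 \<Rightarrow> angle \<Rightarrow> real" where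
  "eul_energy eps v w = - mdot n4 (p4 eps v w)"

definition L4 :: "real \<Rightarrow> real ^ 3 \<Rightarrow> angle \<Rightarrow> fourvec" where
  "L4 eps v w = (1 / eul_energy eps v w) *\<^sub>R p4 eps v w - n4"

text \<open>\<open>G $ \<nu> $ \<rho>\<close> is the (discrete) four-velocity gradient \<open>\<partial>\<^sub>\<nu> u\<^sub>\<rho>\<close>.\<close>

definition qfac :: "real \<Rightarrow> real ^ 3 \<Rightarrow> real ^ (3 option) ^ (3 option) \<Rightarrow> angle \<Rightarrow> real" where
  "qfac eps v G w =
     (\<Sum>\<nu>\<in>UNIV. \<Sum>\<rho>\<in>UNIV. p4 eps v w $ \<nu> * p4 eps v w $ \<rho> * G $ \<nu> $ \<rho>) / eps\<^sup>2"


section \<open>Realizability and moments\<close>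

text \<open>The unit sphere in the coordinates \<open>(\<vartheta>, \<phi>)\<close>, with \<open>d\<omega> = sin \<vartheta> d\<vartheta> d\<phi>\<close>.\<close>

definition sphere_measure :: "angle measure" where
  "sphere_measure =
     density (restrict_space lborel ({0..pi} \<times> {0..2 * pi})) (\<lambda>w. ennreal (sin (fst w)))"

definition distributions :: "(angle \<Rightarrow> real) set" where
  "distributions = {f. integrable sphere_measure f \<and> (\<forall>w\<in>space sphere_measure. 0 \<le> f w) \<and>
     (1 / (4 * pi)) * (LINT w|sphere_measure. f w) > 0}"

definition realizable :: "real \<Rightarrow> fourvec \<Rightarrow> bool" where
  "realizable J H \<longleftrightarrow> J > 0 \<and> J \<ge> sqrt (mdot H H)"

definition eul_realizable :: "moments \<Rightarrow> bool" where
  "eul_realizable U \<longleftrightarrow> realizable (fst U) (vec4 0 (snd U))"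

definition lag_realizable :: "real ^ 3 \<Rightarrow> moments \<Rightarrow> bool" where
  "lag_realizable v M \<longleftrightarrow> realizable (fst M) (vec4 (- (v \<bullet> snd M)) (snd M))"

definition lag_J :: "real \<Rightarrow> (angle \<Rightarrow> real) \<Rightarrow> real" where
  "lag_J eps f = eps / (4 * pi) * (LINT w|sphere_measure. f w)"

definition lag_H :: "real \<Rightarrow> real ^ 3 \<Rightarrow> (angle \<Rightarrow> real) \<Rightarrow> 3 option \<Rightarrow> real" where
  "lag_H eps v f \<mu> = eps / (4 * pi) * (LINT w|sphere_measure. f w * lower (l4 v w) $ \<mu>)"

definition lag_K :: "real \<Rightarrow> real ^ 3 \<Rightarrow> (angle \<Rightarrow> real) \<Rightarrow> 3 option \<Rightarrow> 3 option \<Rightarrow> real" where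
  "lag_K eps v f \<mu> \<nu> = eps / (4 * pi) *
     (LINT w|sphere_measure. f w * lower (l4 v w) $ \<mu> * lower (l4 v w) $ \<nu>)"

text \<open>\<open>(1 / 4\<pi>) \<integral> h (1, L\<^sub>j) d\<omega>\<close>\<close>

definition eul_moment :: "real \<Rightarrow> real ^ 3 \<Rightarrow> (angle \<Rightarrow> real) \<Rightarrow> moments" where
  "eul_moment eps v h =
     (1 / (4 * pi)) *\<^sub>R (LINT w|sphere_measure. h w *\<^sub>R (1, spat (lower (L4 eps v w))))"

definition eul_U :: "real \<Rightarrow> real ^ 3 \<Rightarrow> (angle \<Rightarrow> real) \<Rightarrow> moments" where
  "eul_U eps v f = eul_moment eps v (\<lambda>w. (eul_energy eps v w)\<^sup>2 / eps * f w)"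

definition eul_F :: "real \<Rightarrow> real ^ 3 \<Rightarrow> (angle \<Rightarrow> real) \<Rightarrow> 3 \<Rightarrow> moments" where
  "eul_F eps v f i =
     eul_moment eps v (\<lambda>w. (eul_energy eps v w)\<^sup>2 / eps * f w * L4 eps v w $ Some i)"

definition eul_Utilde :: "real \<Rightarrow> real ^ 3 \<Rightarrow> (angle \<Rightarrow> real) \<Rightarrow> moments" where
  "eul_Utilde eps v f = eul_moment eps v (\<lambda>w. eul_energy eps v w * f w)"

definition eul_Feps ::
  "real \<Rightarrow> real ^ 3 \<Rightarrow> real ^ (3 option) ^ (3 option) \<Rightarrow> (angle \<Rightarrow> real) \<Rightarrow> moments" where
  "eul_Feps eps v G f = - eul_moment eps v (\<lambda>w. qfac eps v G w * eul_energy eps v w * f w)"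

text \<open>A closure assigns a distribution to the moments at energy \<open>eps\<close> and velocity \<open>v\<close>. Exactness is
  stated for one moment value at a time: values on the boundary of the realizable set are not
  moments of any integrable function, so no closure is exact at all realizable values.\<close>

type_synonym closure_map = "real \<Rightarrow> real ^ 3 \<Rightarrow> moments \<Rightarrow> angle \<Rightarrow> real"

definition eul_closed :: "closure_map \<Rightarrow> real \<Rightarrow> real ^ 3 \<Rightarrow> moments \<Rightarrow> bool" where
  "eul_closed cl eps v U \<longleftrightarrow>
     (eul_realizable U \<longrightarrow> cl eps v U \<in> distributions \<and> U = eul_U eps v (cl eps v U))"

definition lag_closed :: "closure_map \<Rightarrow> real \<Rightarrow> real ^ 3 \<Rightarrow> moments \<Rightarrow> bool" where
  "lag_closed cl eps v M \<longleftrightarrow>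
     (lag_realizable v M \<longrightarrow> cl eps v M \<in> distributions \<and> fst M = lag_J eps (cl eps v M) \<and>
       (\<forall>\<mu>. vec4 (- (v \<bullet> snd M)) (snd M) $ \<mu> = lag_H eps v (cl eps v M) \<mu>))"


section \<open>Quadrature on the reference interval\<close>

text \<open>Legendre polynomials by Bonnet's recursion.\<close>

fun legendre :: "nat \<Rightarrow> real poly" where
  "legendre 0 = 1"
| "legendre (Suc 0) = [:0, 1:]"
| "legendre (Suc (Suc n)) = smult (1 / (real n + 2))
     (smult (2 * real n + 3) ([:0, 1:] * legendre (Suc n)) - smult (real n + 1) (legendre n))"

text \<open>Nodes on \<open>[-1, 1]\<close>. The weights are the classical ones divided by 2, so that they sum to 1.\<close>

definition lg_nodes :: "nat \<Rightarrow> real set" where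
  "lg_nodes N = {t. poly (legendre N) t = 0}"

definition lg_weight :: "nat \<Rightarrow> real \<Rightarrow> real" where
  "lg_weight N t = 1 / ((1 - t\<^sup>2) * (poly (pderiv (legendre N)) t)\<^sup>2)"

definition lgl_nodes :: "nat \<Rightarrow> real set" where
  "lgl_nodes M = {- 1, 1} \<union> {t. poly (pderiv (legendre (M - 1))) t = 0}"

definition lgl_weight :: "nat \<Rightarrow> real \<Rightarrow> real" where
  "lgl_weight M t = 1 / (real M * (real M - 1) * (poly (legendre (M - 1)) t)\<^sup>2)"


section \<open>Mesh and polynomial spaces\<close>

text \<open>Phase-space points \<open>(\<epsilon>, x)\<close> are vectors indexed by \<open>'d option\<close>, \<open>None\<close> being the energy
  direction. An element is the pair of its lower and upper corners.\<close>

type_synonym 'd pt = "real ^ ('d option)"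
type_synonym 'd cell = "'d pt \<times> 'd pt"

datatype side = Lo | Hi

abbreviation lo :: "'d::finite cell \<Rightarrow> 'd pt" where "lo K \<equiv> fst K"
abbreviation hi :: "'d::finite cell \<Rightarrow> 'd pt" where "hi K \<equiv> snd K"

definition xpart :: "'d::finite pt \<Rightarrow> real ^ 'd" where
  "xpart z = (\<chi> l. z $ Some l)"

definition width :: "'d::finite cell \<Rightarrow> 'd option \<Rightarrow> real" where
  "width K \<delta> = hi K $ \<delta> - lo K $ \<delta>"

definition vol :: "'d::finite cell \<Rightarrow> real" where
  "vol K = integral {lo K $ None..hi K $ None} (\<lambda>e. e\<^sup>2) * (\<Prod>l\<in>UNIV. width K (Some l))"

text \<open>\<open>adjacent \<delta> K K'\<close>: the upper \<open>\<delta>\<close>-face of \<open>K\<close> is the lower \<open>\<delta>\<close>-face of \<open>K'\<close>.\<close>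

definition adjacent :: "'d::finite option \<Rightarrow> 'd cell \<Rightarrow> 'd cell \<Rightarrow> bool" where
  "adjacent \<delta> K K' \<longleftrightarrow> hi K $ \<delta> = lo K' $ \<delta> \<and>
     (\<forall>\<delta>'. \<delta>' \<noteq> \<delta> \<longrightarrow> lo K $ \<delta>' = lo K' $ \<delta>' \<and> hi K $ \<delta>' = hi K' $ \<delta>')"

definition neighbour :: "'d::finite option \<Rightarrow> side \<Rightarrow> 'd cell \<Rightarrow> 'd cell \<Rightarrow> bool" where
  "neighbour \<delta> sd K K' \<longleftrightarrow> (case sd of Hi \<Rightarrow> adjacent \<delta> K K' | Lo \<Rightarrow> adjacent \<delta> K' K)"

definition face :: "'d::finite cell \<Rightarrow> 'd option \<Rightarrow> side \<Rightarrow> 'd pt set" where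
  "face K \<delta> sd = {z \<in> cbox (lo K) (hi K). z $ \<delta> = (case sd of Hi \<Rightarrow> hi K | Lo \<Rightarrow> lo K) $ \<delta>}"

definition phase_space :: "real set \<Rightarrow> (real ^ 'd::finite) set \<Rightarrow> 'd pt set" where
  "phase_space \<Omega>e \<Omega>x = {z. z $ None \<in> \<Omega>e \<and> xpart z \<in> \<Omega>x}"

text \<open>Conforming mesh of boxes: every face is a face of a neighbouring element or lies on the boundary.
  The lower end of an energy element may be 0.\<close>

definition mesh :: "real set \<Rightarrow> (real ^ 'd::finite) set \<Rightarrow> 'd cell set \<Rightarrow> bool" where
  "mesh \<Omega>e \<Omega>x \<T> \<longleftrightarrow> \<Omega>e \<subseteq> {0<..} \<and>
     (\<lambda>K. cbox (lo K) (hi K)) ` \<T> division_of closure (phase_space \<Omega>e \<Omega>x) \<and>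
     (\<forall>K\<in>\<T>. 0 \<le> lo K $ None \<and> (\<forall>\<delta>. lo K $ \<delta> < hi K $ \<delta>)) \<and>
     (\<forall>K\<in>\<T>. \<forall>\<delta> sd. (\<exists>K'\<in>\<T>. neighbour \<delta> sd K K') \<or>
        face K \<delta> sd \<subseteq> frontier (closure (phase_space \<Omega>e \<Omega>x)))"

definition tensor_poly :: "nat \<Rightarrow> ('d::finite pt \<Rightarrow> moments) \<Rightarrow> bool" where
  "tensor_poly k U \<longleftrightarrow> (\<exists>c :: ('d option \<Rightarrow> nat) \<Rightarrow> moments. \<forall>z.
     U z = (\<Sum>\<alpha>\<in>{\<alpha>. \<forall>\<delta>. \<alpha> \<delta> \<le> k}. (\<Prod>\<delta>\<in>UNIV. (z $ \<delta>) ^ \<alpha> \<delta>) *\<^sub>R c \<alpha>))"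

definition cell_avg :: "'d::finite cell \<Rightarrow> ('d pt \<Rightarrow> moments) \<Rightarrow> moments" where
  "cell_avg K U = (1 / vol K) *\<^sub>R integral (cbox (lo K) (hi K)) (\<lambda>z. (z $ None)\<^sup>2 *\<^sub>R U z)"

text \<open>Affine map from the reference cube to \<open>K\<close>.\<close>

definition cell_map :: "'d::finite cell \<Rightarrow> 'd pt \<Rightarrow> 'd pt" where
  "cell_map K t = (\<chi> \<delta>. (lo K $ \<delta> + hi K $ \<delta>) / 2 + width K \<delta> / 2 * t $ \<delta>)"

definition lgl_count :: "nat \<Rightarrow> nat \<Rightarrow> 'd option \<Rightarrow> nat" where
  "lgl_count Me Mx \<delta> = (case \<delta> of None \<Rightarrow> Me | Some _ \<Rightarrow> Mx)"

definition S_lg :: "nat \<Rightarrow> 'd::finite cell \<Rightarrow> 'd pt set" where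
  "S_lg N K = cell_map K ` {t. \<forall>\<delta>. t $ \<delta> \<in> lg_nodes N}"

definition S_lgl :: "nat \<Rightarrow> nat \<Rightarrow> nat \<Rightarrow> 'd::finite option \<Rightarrow> 'd cell \<Rightarrow> 'd pt set" where
  "S_lgl N Me Mx \<delta> K = cell_map K `
     {t. t $ \<delta> \<in> lgl_nodes (lgl_count Me Mx \<delta>) \<and> (\<forall>\<delta>'. \<delta>' \<noteq> \<delta> \<longrightarrow> t $ \<delta>' \<in> lg_nodes N)}"

definition S_all :: "nat \<Rightarrow> nat \<Rightarrow> nat \<Rightarrow> 'd::finite cell \<Rightarrow> 'd pt set" where
  "S_all N Me Mx K = S_lg N K \<union> (\<Union>\<delta>. S_lgl N Me Mx \<delta> K)"

text \<open>Exactness, along the coordinate lines of \<open>K\<close> in direction \<open>\<delta>\<close>, of a one-dimensional rule for the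
  cell average of \<open>U\<close>; the energy direction carries the weight \<open>\<epsilon>\<^sup>2\<close>.\<close>

definition line_weight :: "'d option \<Rightarrow> real \<Rightarrow> real" where
  "line_weight \<delta> y = (case \<delta> of None \<Rightarrow> y\<^sup>2 | Some _ \<Rightarrow> 1)"

definition subst_coord :: "'d::finite pt \<Rightarrow> 'd option \<Rightarrow> real \<Rightarrow> 'd pt" where
  "subst_coord z \<delta> y = (\<chi> \<delta>'. if \<delta>' = \<delta> then y else z $ \<delta>')"

definition rule_exact ::
  "real set \<Rightarrow> (real \<Rightarrow> real) \<Rightarrow> 'd::finite cell \<Rightarrow> 'd option \<Rightarrow> ('d pt \<Rightarrow> moments) \<Rightarrow> bool" where
  "rule_exact nodes weight K \<delta> U \<longleftrightarrow> (\<forall>z\<in>cbox (lo K) (hi K).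
     integral {lo K $ \<delta>..hi K $ \<delta>} (\<lambda>y. line_weight \<delta> y *\<^sub>R U (subst_coord z \<delta> y)) =
     width K \<delta> *\<^sub>R (\<Sum>t\<in>nodes.
       let y = (lo K $ \<delta> + hi K $ \<delta>) / 2 + width K \<delta> / 2 * t
       in (weight t * line_weight \<delta> y) *\<^sub>R U (subst_coord z \<delta> y)))"


section \<open>Numerical fluxes and transport operator\<close>

definition face_ref_nodes :: "nat \<Rightarrow> 'd::finite option \<Rightarrow> side \<Rightarrow> 'd pt set" where
  "face_ref_nodes N \<delta> sd = {t. t $ \<delta> = (case sd of Hi \<Rightarrow> 1 | Lo \<Rightarrow> - 1) \<and>
     (\<forall>\<delta>'. \<delta>' \<noteq> \<delta> \<longrightarrow> t $ \<delta>' \<in> lg_nodes N)}"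

text \<open>Tensor Legendre--Gauss quadrature of the integral of \<open>g\<close> over a face of \<open>K\<close>.\<close>

definition face_quad ::
  "nat \<Rightarrow> 'd::finite cell \<Rightarrow> 'd option \<Rightarrow> side \<Rightarrow> ('d pt \<Rightarrow> moments) \<Rightarrow> moments" where
  "face_quad N K \<delta> sd g = (\<Sum>t\<in>face_ref_nodes N \<delta> sd.
     (\<Prod>\<delta>'\<in>UNIV - {\<delta>}. width K \<delta>' * lg_weight N (t $ \<delta>')) *\<^sub>R g (cell_map K t))"

text \<open>Exterior trace: the neighbour's polynomial, or the data \<open>B\<close> on boundary faces.\<close>

definition ext_trace ::
  "'d::finite cell set \<Rightarrow> ('d cell \<Rightarrow> 'd option \<Rightarrow> side \<Rightarrow> 'd pt \<Rightarrow> moments) \<Rightarrow>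
   ('d cell \<Rightarrow> 'd pt \<Rightarrow> moments) \<Rightarrow> 'd cell \<Rightarrow> 'd option \<Rightarrow> side \<Rightarrow> 'd pt \<Rightarrow> moments" where
  "ext_trace \<T> B U K \<delta> sd z =
     (if \<exists>K'\<in>\<T>. neighbour \<delta> sd K K'
      then U (SOME K'. K' \<in> \<T> \<and> neighbour \<delta> sd K K') z
      else B K \<delta> sd z)"

definition trace_minus ::
  "'d::finite cell set \<Rightarrow> ('d cell \<Rightarrow> 'd option \<Rightarrow> side \<Rightarrow> 'd pt \<Rightarrow> moments) \<Rightarrow>
   ('d cell \<Rightarrow> 'd pt \<Rightarrow> moments) \<Rightarrow> 'd cell \<Rightarrow> 'd option \<Rightarrow> side \<Rightarrow> 'd pt \<Rightarrow> moments" where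
  "trace_minus \<T> B U K \<delta> sd z = (case sd of Hi \<Rightarrow> U K z | Lo \<Rightarrow> ext_trace \<T> B U K \<delta> sd z)"

definition trace_plus ::
  "'d::finite cell set \<Rightarrow> ('d cell \<Rightarrow> 'd option \<Rightarrow> side \<Rightarrow> 'd pt \<Rightarrow> moments) \<Rightarrow>
   ('d cell \<Rightarrow> 'd pt \<Rightarrow> moments) \<Rightarrow> 'd cell \<Rightarrow> 'd option \<Rightarrow> side \<Rightarrow> 'd pt \<Rightarrow> moments" where
  "trace_plus \<T> B U K \<delta> sd z = (case sd of Hi \<Rightarrow> ext_trace \<T> B U K \<delta> sd z | Lo \<Rightarrow> U K z)"

text \<open>Data of the transport problem. \<open>comp_of l\<close> is the component of three-vectors that belongs to the
  \<open>l\<close>-th of the \<open>d \<le> 3\<close> resolved spatial directions.\<close>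

record 'd transport =
  comp_of :: "'d \<Rightarrow> 3"
  vel :: "real ^ 'd \<Rightarrow> real ^ 3"
  ugrad :: "real ^ 'd \<Rightarrow> real ^ (3 option) ^ (3 option)"
  a_eps :: "real ^ 'd \<Rightarrow> real"
  a_dir :: "'d \<Rightarrow> real"
  eul_cl :: closure_map

definition num_flux_x :: "'d::finite transport \<Rightarrow> 'd \<Rightarrow> 'd pt \<Rightarrow> moments \<Rightarrow> moments \<Rightarrow> moments" where
  "num_flux_x P l z Um Up =
     (let e = z $ None; v = vel P (xpart z);
          F = (\<lambda>U. eul_F e v (eul_cl P e v U) (comp_of P l))
      in (1 / 2) *\<^sub>R (F Um + F Up - a_dir P l *\<^sub>R (Up - Um)))"

definition num_flux_eps :: "'d::finite transport \<Rightarrow> 'd pt \<Rightarrow> moments \<Rightarrow> moments \<Rightarrow> moments" where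
  "num_flux_eps P z Um Up =
     (let e = z $ None; x = xpart z; v = vel P x;
          F = (\<lambda>U. eul_Feps e v (ugrad P x) (eul_cl P e v U));
          Ut = (\<lambda>U. eul_Utilde e v (eul_cl P e v U))
      in (1 / 2) *\<^sub>R (F Um + F Up - a_eps P x *\<^sub>R (Ut Up - Ut Um)))"

definition transport_op ::
  "'d::finite transport \<Rightarrow> nat \<Rightarrow> 'd cell set \<Rightarrow>
   ('d cell \<Rightarrow> 'd option \<Rightarrow> side \<Rightarrow> 'd pt \<Rightarrow> moments) \<Rightarrow>
   ('d cell \<Rightarrow> 'd pt \<Rightarrow> moments) \<Rightarrow> 'd cell \<Rightarrow> moments" where
  "transport_op P N \<T> B U K =
     (let Ie = (\<lambda>sd. face_quad N K None sd (\<lambda>z. (z $ None) ^ 3 *\<^sub>R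
                 num_flux_eps P z (trace_minus \<T> B U K None sd z) (trace_plus \<T> B U K None sd z)));
          Ix = (\<lambda>l sd. face_quad N K (Some l) sd (\<lambda>z. (z $ None)\<^sup>2 *\<^sub>R
                 num_flux_x P l z (trace_minus \<T> B U K (Some l) sd z)
                   (trace_plus \<T> B U K (Some l) sd z)))
      in - ((1 / vol K) *\<^sub>R (Ie Hi - Ie Lo)) - (\<Sum>l\<in>UNIV. (1 / vol K) *\<^sub>R (Ix l Hi - Ix l Lo)))"

text \<open>The stage values \<open>U\<^sub>E\<^sub>x\<close>; \<open>c\<close> and \<open>ch\<close> are the coefficients c(i,j) and c-hat(i,j), and
  \<open>U j\<close>, \<open>B j\<close> the stage-\<open>j\<close> solution and boundary data.\<close>

definition U_expl ::
  "'d::finite transport \<Rightarrow> nat \<Rightarrow> 'd cell set \<Rightarrow>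
   (nat \<Rightarrow> 'd cell \<Rightarrow> 'd option \<Rightarrow> side \<Rightarrow> 'd pt \<Rightarrow> moments) \<Rightarrow>
   (nat \<Rightarrow> nat \<Rightarrow> real) \<Rightarrow> (nat \<Rightarrow> nat \<Rightarrow> real) \<Rightarrow> real \<Rightarrow>
   (nat \<Rightarrow> 'd cell \<Rightarrow> 'd pt \<Rightarrow> moments) \<Rightarrow> nat \<Rightarrow> 'd cell \<Rightarrow> moments" where
  "U_expl P N \<T> B c ch dt U i K = (\<Sum>j<i. c i j *\<^sub>R
     (cell_avg K (U j K) + (ch i j * dt) *\<^sub>R transport_op P N \<T> (B j) (U j) K))"


section \<open>Implicit update\<close>

text \<open>Data of the collision solve on one element: velocity, energy, opacities, equilibrium density,
  damping parameter and closure.\<close>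

record collision =
  c_vel :: "real ^ 3"
  c_eps :: real
  chi :: real
  kappa :: real
  J_eq :: real
  lam :: real
  lag_cl :: closure_map

definition hat_to_cons :: "real ^ 3 \<Rightarrow> moments \<Rightarrow> moments" where
  "hat_to_cons v = (\<lambda>(a, b). (lorentz v * a + v \<bullet> b, b + (lorentz v * a) *\<^sub>R v))"

definition U_hat :: "collision \<Rightarrow> moments \<Rightarrow> moments" where
  "U_hat Q M = (let v = c_vel Q; f = lag_cl Q (c_eps Q) v M in
     (lorentz v * fst M + v \<bullet> snd M,
      lorentz v *\<^sub>R snd M + (\<chi> j. \<Sum>i\<in>UNIV. v $ i * lag_K (c_eps Q) v f (Some i) (Some j))))"

definition C_hat :: "collision \<Rightarrow> moments \<Rightarrow> moments" where
  "C_hat Q M = (chi Q * (J_eq Q - fst M), - (kappa Q *\<^sub>R snd M))"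

definition Lambda :: "collision \<Rightarrow> real \<Rightarrow> moments \<Rightarrow> moments" where
  "Lambda Q dtau R =
     ((1 / (lorentz (c_vel Q) + lam Q * dtau * chi Q)) * fst R,
      (1 / (lorentz (c_vel Q) + lam Q * dtau * kappa Q)) *\<^sub>R snd R)"

text \<open>\<open>richardson Q dtau Uhs k\<close> is \<open>M\<^sup>[\<^sup>k\<^sup>]\<close> for the right-hand side \<open>Uhs\<close>.\<close>

primrec richardson :: "collision \<Rightarrow> real \<Rightarrow> moments \<Rightarrow> nat \<Rightarrow> moments" where
  "richardson Q dtau Uhs 0 = Uhs"
| "richardson Q dtau Uhs (Suc k) =
     (let M = richardson Q dtau Uhs k
      in M - lam Q *\<^sub>R Lambda Q dtau (U_hat Q M - Uhs - dtau *\<^sub>R C_hat Q M))"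

text \<open>\<open>U\<close> is the result of the implicit update of \<open>UEx\<close>, \<open>M\<close> being the limit of the iteration.\<close>

definition implicit_update :: "collision \<Rightarrow> real \<Rightarrow> moments \<Rightarrow> moments \<Rightarrow> moments \<Rightarrow> bool" where
  "implicit_update Q dtau UEx M U \<longleftrightarrow>
     (let A = hat_to_cons (c_vel Q); it = richardson Q dtau (inv A UEx) in
      it \<longlonglongrightarrow> M \<and> U = A (U_hat Q M) \<and> U = UEx + dtau *\<^sub>R A (C_hat Q M))"

text \<open>Exactness of the closure at the iterates and their limit.\<close>

definition collision_closed :: "collision \<Rightarrow> real \<Rightarrow> moments \<Rightarrow> moments \<Rightarrow> bool" where
  "collision_closed Q dtau UEx M \<longleftrightarrow>
     (\<forall>M'\<in>insert M (range (richardson Q dtau (inv (hat_to_cons (c_vel Q)) UEx))).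
        lag_closed (lag_cl Q) (c_eps Q) (c_vel Q) M')"


section \<open>Limiter\<close>

definition limited ::
  "real \<Rightarrow> real \<Rightarrow> 'd::finite cell \<Rightarrow> ('d pt \<Rightarrow> moments) \<Rightarrow> 'd pt \<Rightarrow> moments" where
  "limited \<theta>1 \<theta>2 K U z =
     \<theta>2 *\<^sub>R (\<theta>1 * fst (U z) + (1 - \<theta>1) * fst (cell_avg K U), snd (U z)) +
     (1 - \<theta>2) *\<^sub>R cell_avg K U"

end

theory Submission
  imports Defs
begin

text \<open>
Realizable moments form a convex cone \<open>\<bar>F\<bar> \<le> E\<close>, and every moment with a nonnegative weight lies in
it. In an explicit stage the cell average is split into \<open>d + 1\<close> equal shares. Evaluating one share per
direction with the Lobatto rule in that direction and the Gauss rule in the others exposes the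
values at the two faces, and \<open>a U \<plusminus> F\<close> is a moment with nonnegative weight since the wave speeds
dominate \<open>L\<^sup>i\<close> and \<open>q\<close>; the time step bound is what makes the face values absorb the numerical fluxes,
using \<open>E / \<epsilon> \<ge> W (1 - v)\<close> in the energy direction. In the implicit solve each iterate is again a
nonnegative combination, because \<open>\<lambda> E / \<epsilon> \<le> \<lambda> W (1 + v) \<le> W\<close>, and the cone is closed.
\<close>

subsection \<open>Legendre polynomials and quadrature nodes\<close>

text \<open>Strict positivity of the energy component shapes the proof. Cone membership survives
  zero coefficients and limits, positivity does not, so the two are tracked apart. Positivity is
  gained in the energy direction, where at least three Lobatto points leave an interior one; in
  space there may be only the two end points. The Legendre facts serve this and the signs of the
  weights: Gauss nodes are simple roots inside \<open>(-1, 1)\<close>, and the derivative has a root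
  there with positive Lobatto weight. Exactness of the rules is given along single coordinate lines,
  so the tensor rule for the cell average is assembled one coordinate at a time. An energy cell may
  start at 0, where no exact closure is assumed; there the factor \<epsilon>^3 removes the flux.
  Lagrangian realizability bounds an indefinite square; passing to comoving components turns it into
  a Euclidean norm, from which convexity and closedness are plain.\<close>

lemma poly_legendre_Suc_Suc:
  "(real n + 2) * poly (legendre (Suc (Suc n))) t =
     (2 * real n + 3) * t * poly (legendre (Suc n)) t - (real n + 1) * poly (legendre n) t"
  by (simp add: field_simps)

lemma poly_pderiv_legendre_Suc_Suc:
  "(real n + 2) * poly (pderiv (legendre (Suc (Suc n)))) t =
     (2 * real n + 3) * (poly (legendre (Suc n)) t + t * poly (pderiv (legendre (Suc n))) t)
     - (real n + 1) * poly (pderiv (legendre n)) t"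
  by (simp add: pderiv_smult pderiv_diff pderiv_mult pderiv_pCons field_simps)

declare legendre.simps(3) [simp del]

text \<open>The two derivative recurrences need a joint induction. Differentiating Bonnet's
  recursion and eliminating the lowest derivative by the second identity gives the first at the next
  index; the second at that index then follows from it, the old identities and Bonnet's
  recursion.\<close>

lemma pderiv_legendre_Suc:
  "poly (pderiv (legendre (Suc n))) t =
     t * poly (pderiv (legendre n)) t + (real n + 1) * poly (legendre n) t"
  and mult_pderiv_legendre_Suc:
  "t * poly (pderiv (legendre (Suc n))) t =
     poly (pderiv (legendre n)) t + (real n + 1) * poly (legendre (Suc n)) t"
proof (induction n)
  case 0
  show "poly (pderiv (legendre (Suc 0))) t =
     t * poly (pderiv (legendre 0)) t + (real 0 + 1) * poly (legendre 0) t"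
    and "t * poly (pderiv (legendre (Suc 0))) t =
     poly (pderiv (legendre 0)) t + (real 0 + 1) * poly (legendre (Suc 0)) t"
    by (simp_all add: pderiv_pCons)
next
  case (Suc n)
  define p0 p1 p2 d0 d1 d2 where defs: "p0 = poly (legendre n) t" "p1 = poly (legendre (Suc n)) t"
    "p2 = poly (legendre (Suc (Suc n))) t" "d0 = poly (pderiv (legendre n)) t"
    "d1 = poly (pderiv (legendre (Suc n))) t" "d2 = poly (pderiv (legendre (Suc (Suc n)))) t"
  have A: "d1 = t * d0 + (real n + 1) * p0" and B: "t * d1 = d0 + (real n + 1) * p1"
    using Suc by (simp_all add: defs)
  have R: "(real n + 2) * p2 = (2 * real n + 3) * t * p1 - (real n + 1) * p0"
    using poly_legendre_Suc_Suc[of n t] by (simp add: defs)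
  have "(real n + 2) * d2 = (2 * real n + 3) * (p1 + t * d1) - (real n + 1) * d0"
    using poly_pderiv_legendre_Suc_Suc[of n t] by (simp add: defs)
  also have "\<dots> = (2 * real n + 3) * (p1 + t * d1) - (real n + 1) * (t * d1 - (real n + 1) * p1)"
    using B by simp
  also have "\<dots> = (real n + 2) * (t * d1 + (real n + 2) * p1)"
    by (simp add: algebra_simps)
  finally have A': "d2 = t * d1 + (real n + 2) * p1"
    by simp
  have "t * (t * d1) = t * d0 + (real n + 1) * t * p1"
    using B by (simp add: algebra_simps)
  then have "t * d2 = d1 + (real n + 2) * p2"
    unfolding A' R using A by (simp add: algebra_simps)
  then show "poly (pderiv (legendre (Suc (Suc n)))) t =
      t * poly (pderiv (legendre (Suc n))) t + (real (Suc n) + 1) * poly (legendre (Suc n)) t"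
    and "t * poly (pderiv (legendre (Suc (Suc n)))) t =
      poly (pderiv (legendre (Suc n))) t + (real (Suc n) + 1) * poly (legendre (Suc (Suc n))) t"
    using A' by (simp_all add: defs algebra_simps)
qed

text \<open>Exhibits a Legendre polynomial as the derivative of a difference that vanishes at both
  ends, which is the form Rolle's theorem needs.\<close>

lemma legendre_pderiv_diff:
  "(2 * real n + 3) * poly (legendre (Suc n)) t =
     poly (pderiv (legendre (Suc (Suc n)))) t - poly (pderiv (legendre n)) t"
  using pderiv_legendre_Suc[of "Suc n" t] mult_pderiv_legendre_Suc[of t n]
  by (simp add: algebra_simps)

text \<open>Ties a common zero of a Legendre polynomial and its derivative to a zero of its
  predecessor, the descent used for simplicity of the roots.\<close>

lemma legendre_pderiv_weighted:
  "(1 - t\<^sup>2) * poly (pderiv (legendre (Suc n))) t =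
     (real n + 1) * (poly (legendre n) t - t * poly (legendre (Suc n)) t)"
proof -
  have "t * (t * poly (pderiv (legendre (Suc n))) t) =
      t * poly (pderiv (legendre n)) t + (real n + 1) * (t * poly (legendre (Suc n)) t)"
    unfolding mult_pderiv_legendre_Suc by (simp add: algebra_simps)
  then show ?thesis
    using pderiv_legendre_Suc[of n t] by (simp add: power2_eq_square algebra_simps)
qed

text \<open>Eliminating \<open>t * poly (legendre (Suc n)) t\<close> by Bonnet's recursion leaves a
  plain difference, whose antiderivative is known from \<open>legendre_pderiv_diff\<close>.\<close>

lemma legendre_pderiv_weighted_diff:
  "(2 * real n + 3) * ((1 - t\<^sup>2) * poly (pderiv (legendre (Suc n))) t) =
     (real n + 1) * (real n + 2) * (poly (legendre n) t - poly (legendre (Suc (Suc n))) t)"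
proof -
  have "(2 * real n + 3) * (poly (legendre n) t - t * poly (legendre (Suc n)) t) =
      (real n + 2) * (poly (legendre n) t - poly (legendre (Suc (Suc n))) t)"
    using poly_legendre_Suc_Suc[of n t] by (simp add: algebra_simps)
  then show ?thesis
    unfolding legendre_pderiv_weighted by (metis mult.assoc mult.left_commute)
qed

lemma poly_legendre_minus: "poly (legendre n) (- t) = (- 1) ^ n * poly (legendre n) t"
proof (induction n rule: legendre.induct)
  case (3 n)
  have "(real n + 2) * poly (legendre (Suc (Suc n))) (- t) =
      (- 1) ^ n * ((2 * real n + 3) * t * poly (legendre (Suc n)) t - (real n + 1) * poly (legendre n) t)"
    unfolding poly_legendre_Suc_Suc[of n "- t"] 3 by (simp add: algebra_simps)
  also have "\<dots> = (real n + 2) * ((- 1) ^ Suc (Suc n) * poly (legendre (Suc (Suc n))) t)"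
    unfolding poly_legendre_Suc_Suc[of n t, symmetric] by simp
  finally have "(real n + 2) * poly (legendre (Suc (Suc n))) (- t) =
      (real n + 2) * ((- 1) ^ Suc (Suc n) * poly (legendre (Suc (Suc n))) t)" .
  moreover have "real n + 2 \<noteq> 0" by linarith
  ultimately show ?case by (metis mult_left_cancel)
qed auto

lemma poly_legendre_1 [simp]: "poly (legendre n) 1 = 1"
proof (induction n rule: legendre.induct)
  case (3 n)
  have "(real n + 2) * poly (legendre (Suc (Suc n))) 1 = (real n + 2) * 1"
    using poly_legendre_Suc_Suc[of n 1] 3 by simp
  moreover have "real n + 2 \<noteq> 0" by linarith
  ultimately show ?case by (metis mult_left_cancel)
qed auto

lemma poly_legendre_minus_1 [simp]: "poly (legendre n) (- 1) = (- 1) ^ n"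
  using poly_legendre_minus[of n 1] by simp

lemma poly_legendre_ge_1:
  assumes "1 \<le> t"
  shows "1 \<le> poly (legendre n) t"
proof -
  \<comment> \<open>The growth in \<open>n\<close> is added to the induction because Bonnet's
    recursion has a negative term: it bounds \<open>p0\<close> by \<open>p1\<close> and leaves
    \<open>(2 n + 3) - (n + 1) = n + 2\<close> copies of \<open>p1\<close>.\<close>
  have "1 \<le> poly (legendre n) t \<and> poly (legendre n) t \<le> poly (legendre (Suc n)) t"
  proof (induction n)
    case 0
    then show ?case using assms by simp
  next
    case (Suc n)
    define p0 p1 p2 where defs: "p0 = poly (legendre n) t" "p1 = poly (legendre (Suc n)) t"
      "p2 = poly (legendre (Suc (Suc n))) t"
    have h: "1 \<le> p0" "p0 \<le> p1" using Suc by (simp_all add: defs)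
    have "(2 * real n + 3) * p1 \<le> (2 * real n + 3) * (t * p1)"
      using h assms by (intro mult_left_mono) auto
    moreover have "(real n + 1) * p0 \<le> (real n + 1) * p1"
      using h by (intro mult_left_mono) auto
    moreover have "(real n + 2) * p2 = (2 * real n + 3) * (t * p1) - (real n + 1) * p0"
      using poly_legendre_Suc_Suc[of n t] by (simp add: defs)
    ultimately have "(real n + 2) * p1 \<le> (real n + 2) * p2"
      by (simp add: algebra_simps)
    then show ?case using h by (simp add: defs)
  qed
  then show ?thesis ..
qed

lemma legendre_root_less_1:
  assumes "poly (legendre n) t = 0"
  shows "\<bar>t\<bar> < 1"
proof (rule ccontr)
  assume "\<not> \<bar>t\<bar> < 1"
  then have "1 \<le> poly (legendre n) \<bar>t\<bar>"
    by (intro poly_legendre_ge_1) simp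
  with assms poly_legendre_minus[of n t] show False
    by (simp add: abs_if split: if_splits)
qed

lemma legendre_nz [simp]: "legendre n \<noteq> 0"
proof
  assume "legendre n = 0"
  with poly_legendre_1[of n] show False by simp
qed

text \<open>At \<open>t = 1\<close> the recurrence adds \<open>n + 1\<close> to the previous
  derivative. The result makes the set of Lobatto nodes finite.\<close>

lemma pderiv_legendre_nz: "pderiv (legendre (Suc n)) \<noteq> 0"
proof -
  have nonneg: "0 \<le> poly (pderiv (legendre m)) 1" for m
    by (induction m) (simp_all add: pderiv_legendre_Suc)
  have "0 < poly (pderiv (legendre (Suc n))) 1"
    using nonneg[of n] by (simp add: pderiv_legendre_Suc)
  then show ?thesis by auto
qed

text \<open>A double root descends: the weighted identity makes it a root of the preceding Legendre
  polynomial, and the second recurrence makes it a double root there. The descent ends at the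
  constant 1.\<close>

lemma legendre_root_simple:
  assumes "poly (legendre n) t = 0"
  shows "poly (pderiv (legendre n)) t \<noteq> 0"
  using assms
proof (induction n)
  case (Suc n)
  have "\<bar>t\<bar> < 1" using Suc.prems by (rule legendre_root_less_1)
  show ?case
  proof
    assume d: "poly (pderiv (legendre (Suc n))) t = 0"
    then have "poly (legendre n) t = 0"
      using legendre_pderiv_weighted[of t n] Suc.prems by simp
    moreover from this have "poly (pderiv (legendre n)) t = 0"
      using mult_pderiv_legendre_Suc[of t n] d Suc.prems by simp
    ultimately show False using Suc.IH by blast
  qed
qed simp

lemma poly_root_pderiv:
  fixes p :: "real poly"
  assumes "poly p (- 1) = poly p 1"
  obtains t where "- 1 < t" "t < 1" "poly (pderiv p) t = 0"
proof -
  have "\<exists>z::real. z > -1 \<and> z < 1 \<and> poly p 1 - poly p (- 1) = (1 - (- 1)) * poly (pderiv p) z"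
    by (rule poly_MVT) simp
  with assms that show thesis by auto
qed

text \<open>Rolle's theorem for the difference of the two neighbours of
  \<open>legendre (Suc n)\<close>: their indices have equal parity, so they agree at both
  ends.\<close>

lemma legendre_root_exists:
  obtains t where "- 1 < t" "t < 1" "poly (legendre (Suc n)) t = 0"
proof -
  obtain t where "- 1 < t" "t < 1" "poly (pderiv (legendre (Suc (Suc n)) - legendre n)) t = 0"
    by (rule poly_root_pderiv[of "legendre (Suc (Suc n)) - legendre n"]) auto
  then show thesis
    using that[of t] legendre_pderiv_diff[of n t] by (simp add: pderiv_diff)
qed

lemma pderiv_legendre_root_exists:
  obtains t where "- 1 < t" "t < 1" "poly (pderiv (legendre (Suc (Suc n)))) t = 0"
proof -
  \<comment> \<open>Rolle's theorem for the Legendre polynomial itself fails in odd degree, where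
    its end values are -1 and 1. Instead \<open>p\<close> is an antiderivative of
    \<open>legendre (Suc n) - legendre (Suc (Suc (Suc n)))\<close>, a multiple of
    \<open>1 - t^2\<close> times the derivative in question, and \<open>p\<close> vanishes at both
    ends.\<close>
  define p where "p = smult (1 / (2 * real n + 3)) (legendre (Suc (Suc n)) - legendre n)
     - smult (1 / (2 * real n + 7)) (legendre (Suc (Suc (Suc (Suc n)))) - legendre (Suc (Suc n)))"
  obtain t where t: "- 1 < t" "t < 1" "poly (pderiv p) t = 0"
    by (rule poly_root_pderiv[of p]) (auto simp: p_def)
  have "poly (pderiv p) t = 1 / (2 * real n + 3) *
        (poly (pderiv (legendre (Suc (Suc n)))) t - poly (pderiv (legendre n)) t)
      - 1 / (2 * real n + 7) * (poly (pderiv (legendre (Suc (Suc (Suc (Suc n)))))) t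
        - poly (pderiv (legendre (Suc (Suc n)))) t)"
    by (simp add: p_def pderiv_diff pderiv_smult)
  also have "\<dots> = 1 / (2 * real n + 3) * ((2 * real n + 3) * poly (legendre (Suc n)) t)
      - 1 / (2 * real n + 7) * ((2 * real n + 7) * poly (legendre (Suc (Suc (Suc n)))) t)"
    using legendre_pderiv_diff[of n t] legendre_pderiv_diff[of "Suc (Suc n)" t] by (simp add: add.commute)
  also have "\<dots> = poly (legendre (Suc n)) t - poly (legendre (Suc (Suc (Suc n)))) t"
    by (simp add: add_nonneg_eq_0_iff)
  finally have "poly (pderiv p) t = poly (legendre (Suc n)) t - poly (legendre (Suc (Suc (Suc n)))) t" .
  then have "(1 - t\<^sup>2) * poly (pderiv (legendre (Suc (Suc n)))) t = 0"
    using legendre_pderiv_weighted_diff[of "Suc n" t] t by (auto simp del: mult_eq_0_iff)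
  moreover have "t\<^sup>2 < 1" using t by (simp add: abs_square_less_1)
  ultimately show thesis using that[of t] t by simp
qed

section \<open>Gauss and Lobatto nodes and the signs of their weights\<close>

lemma finite_lg_nodes: "finite (lg_nodes N)"
  by (simp add: lg_nodes_def poly_roots_finite)

lemma lg_nodes_bounds: "t \<in> lg_nodes N \<Longrightarrow> - 1 < t \<and> t < 1"
  using legendre_root_less_1[of N t] by (auto simp: lg_nodes_def)

lemma lg_nodes_nonempty: "1 \<le> N \<Longrightarrow> lg_nodes N \<noteq> {}"
  using legendre_root_exists[of "N - 1"] by (auto simp: lg_nodes_def)

lemma lg_weight_pos: "t \<in> lg_nodes N \<Longrightarrow> 0 < lg_weight N t"
  using legendre_root_less_1[of N t] legendre_root_simple[of N t]
  by (simp add: lg_nodes_def lg_weight_def abs_square_less_1)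

lemma finite_lgl_nodes: "2 \<le> M \<Longrightarrow> finite (lgl_nodes M)"
  using pderiv_legendre_nz[of "M - 2"] by (simp add: lgl_nodes_def poly_roots_finite Suc_diff_Suc numeral_2_eq_2)

text \<open>For \<open>M = 0\<close> and \<open>M = 1\<close> the denominator is 0, and so is the
  weight by the convention for division; otherwise no factor is negative.\<close>

lemma lgl_weight_nonneg: "0 \<le> lgl_weight M t"
  by (cases M) (simp_all add: lgl_weight_def)

lemma lgl_weight_minus_1: "lgl_weight M (- 1) = lgl_weight M 1"
  by (simp add: lgl_weight_def power_mult[symmetric] mult.commute[of _ 2] power_mult)

text \<open>The derivative of the Legendre polynomial vanishes at the node, so the polynomial itself
  does not, its roots being simple; hence the weight is positive.\<close>

lemma lgl_interior_node:
  assumes "3 \<le> M"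
  obtains t where "t \<in> lgl_nodes M" "- 1 < t" "t < 1" "0 < lgl_weight M t"
proof -
  define n where "n = M - 3"
  have n: "M - 1 = Suc (Suc n)" "M = Suc (Suc (Suc n))" using assms by (simp_all add: n_def)
  obtain t where t: "- 1 < t" "t < 1" "poly (pderiv (legendre (Suc (Suc n)))) t = 0"
    by (rule pderiv_legendre_root_exists)
  then have "poly (legendre (Suc (Suc n))) t \<noteq> 0"
    using legendre_root_simple by blast
  with t that[of t] show thesis
    by (auto simp: lgl_nodes_def lgl_weight_def n)
qed

section \<open>Four-vectors and the cone of Eulerian moments\<close>

lemma sum_UNIV_option:
  fixes f :: "'a::finite option \<Rightarrow> 'b::comm_monoid_add"
  shows "(\<Sum>x\<in>UNIV. f x) = f None + (\<Sum>x\<in>UNIV. f (Some x))"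
  by (simp add: UNIV_option_conv sum.reindex)

lemma prod_UNIV_option:
  fixes f :: "'a::finite option \<Rightarrow> 'b::comm_monoid_mult"
  shows "(\<Prod>x\<in>UNIV. f x) = f None * (\<Prod>x\<in>UNIV. f (Some x))"
  by (simp add: UNIV_option_conv prod.reindex)

lemma vec4_nth [simp]: "vec4 t y $ None = t" "vec4 t y $ Some i = y $ i"
  by (simp_all add: vec4_def)

lemma vec4_eqI: "a $ None = t \<Longrightarrow> spat a = y \<Longrightarrow> a = vec4 t y"
  by (auto simp: vec_eq_iff spat_def vec4_def split: option.split)

lemma spat_vec4 [simp]: "spat (vec4 t y) = y"
  by (simp add: spat_def vec_eq_iff)

lemma spat_linear [simp]:
  "spat (a + b) = spat a + spat b" "spat (a - b) = spat a - spat b" "spat (c *\<^sub>R a) = c *\<^sub>R spat a"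
  by (simp_all add: spat_def vec_eq_iff)

lemma lower_nth [simp]: "lower a $ None = - (a $ None)" "lower a $ Some i = a $ Some i"
  by (simp_all add: lower_def sum_UNIV_option eta_def if_distrib[where f = "\<lambda>x. x * _"] cong: if_cong)

lemma spat_lower [simp]: "spat (lower a) = spat a"
  by (simp add: spat_def)

lemma mdot_eq: "mdot a b = spat a \<bullet> spat b - a $ None * b $ None"
  by (simp add: mdot_def sum_UNIV_option inner_vec_def spat_def)

lemma eul_realizable_iff: "eul_realizable U \<longleftrightarrow> 0 < fst U \<and> norm (snd U) \<le> fst U"
  by (simp add: eul_realizable_def realizable_def mdot_eq flip: power2_norm_eq_inner)

text \<open>Unlike the realizable set this cone contains 0, so combinations with vanishing
  coefficients stay inside; positivity of the energy component is added by
  \<open>eul_realizable_cone\<close>.\<close>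

definition moment_cone :: "moments set" where
  "moment_cone = {U. norm (snd U) \<le> fst U}"

lemma eul_realizable_cone: "eul_realizable U \<longleftrightarrow> U \<in> moment_cone \<and> 0 < fst U"
  by (auto simp: eul_realizable_iff moment_cone_def)

lemma moment_cone_fst: "U \<in> moment_cone \<Longrightarrow> 0 \<le> fst U"
  unfolding moment_cone_def using norm_ge_zero order_trans by blast

lemma moment_cone_0 [simp]: "0 \<in> moment_cone"
  by (simp add: moment_cone_def)

lemma moment_cone_add: "U \<in> moment_cone \<Longrightarrow> V \<in> moment_cone \<Longrightarrow> U + V \<in> moment_cone"
  by (auto simp: moment_cone_def intro: norm_triangle_mono)

lemma moment_cone_scaleR: "0 \<le> c \<Longrightarrow> U \<in> moment_cone \<Longrightarrow> c *\<^sub>R U \<in> moment_cone"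
  by (simp add: moment_cone_def mult_left_mono)

lemma moment_cone_sum: "(\<And>x. x \<in> A \<Longrightarrow> U x \<in> moment_cone) \<Longrightarrow> sum U A \<in> moment_cone"
  by (induction A rule: infinite_finite_induct) (auto intro: moment_cone_add)


subsection \<open>Kinematics\<close>

lemma lorentz_pos: "norm v < 1 \<Longrightarrow> 0 < lorentz v"
  by (simp add: lorentz_def abs_square_less_1)

lemma lorentz_sq: "norm v < 1 \<Longrightarrow> (lorentz v)\<^sup>2 * (1 - (norm v)\<^sup>2) = 1"
  using abs_square_less_1[of "norm v"] by (simp add: lorentz_def power_divide)

lemma lorentz_sq_norm: "norm v < 1 \<Longrightarrow> (lorentz v)\<^sup>2 * (norm v)\<^sup>2 = (lorentz v)\<^sup>2 - 1"
  using lorentz_sq[of v] by (simp add: algebra_simps)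

text \<open>A combination of fixed axes with scalar coefficients is a form to which the continuity
  rules apply.\<close>

lemma lhat_eq: "lhat w = cos (fst w) *\<^sub>R axis 1 1 + (sin (fst w) * cos (snd w)) *\<^sub>R axis 2 1
    + (sin (fst w) * sin (snd w)) *\<^sub>R axis 3 1"
  by (simp add: lhat_def vec_eq_iff forall_3 vector_3 axis_def)

lemma norm_lhat [simp]: "norm (lhat w) = 1"
proof -
  have "(norm (lhat w))\<^sup>2 =
      (cos (fst w))\<^sup>2 + (sin (fst w) * cos (snd w))\<^sup>2 + (sin (fst w) * sin (snd w))\<^sup>2"
    unfolding power2_norm_eq_inner lhat_def inner_vec_def sum_3 vector_3
    by (simp only: power2_eq_square inner_real_def)
  also have "\<dots> = (cos (fst w))\<^sup>2 + (sin (fst w))\<^sup>2 * ((cos (snd w))\<^sup>2 + (sin (snd w))\<^sup>2)"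
    by (simp only: power_mult_distrib distrib_left add.assoc)
  also have "\<dots> = 1" by simp
  finally show ?thesis using norm_ge_zero[of "lhat w"] by (simp add: power2_eq_1_iff)
qed

lemma abs_inner_lhat: "\<bar>v \<bullet> lhat w\<bar> \<le> norm v"
  using Cauchy_Schwarz_ineq2[of v "lhat w"] by simp

lemma continuous_lhat [continuous_intros]: "continuous_on A lhat"
  unfolding lhat_eq[abs_def] by (intro continuous_intros)

lemma l4_None [simp]: "l4 v w $ None = lorentz v * (v \<bullet> lhat w)"
  by (simp add: l4_def)

text \<open>At \<open>v = 0\<close> the correction is a multiple of the zero vector, so one formula
  covers both cases.\<close>

lemma spat_l4: "spat (l4 v w) = lhat w + ((lorentz v - 1) * (v \<bullet> lhat w) / (norm v)\<^sup>2) *\<^sub>R v"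
  by (simp add: l4_def)

lemma continuous_spat_l4 [continuous_intros]: "continuous_on A (\<lambda>w. spat (l4 v w))"
proof -
  have eq: "(\<lambda>w. spat (l4 v w)) =
      (\<lambda>w. lhat w + (((lorentz v - 1) / (norm v)\<^sup>2) * (v \<bullet> lhat w)) *\<^sub>R v)"
    by (simp add: spat_l4 fun_eq_iff)
  show ?thesis unfolding eq by (intro continuous_intros)
qed

text \<open>This is the orthogonality u_\<mu> l^\<mu> = 0: the boost stretches the component along
  \<open>v\<close> by the Lorentz factor.\<close>

lemma inner_spat_l4: "v \<bullet> spat (l4 v w) = lorentz v * (v \<bullet> lhat w)"
  by (cases "v = 0") (simp_all add: spat_l4 inner_add_right flip: power2_norm_eq_inner,
      simp add: algebra_simps)

text \<open>This is l_\<mu> l^\<mu> = 1, the boost being an isometry of the Minkowski form.\<close>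

lemma norm_spat_l4:
  assumes "norm v < 1"
  shows "(norm (spat (l4 v w)))\<^sup>2 = 1 + (lorentz v * (v \<bullet> lhat w))\<^sup>2"
proof (cases "v = 0")
  case True
  then show ?thesis by (simp add: spat_l4)
next
  case False
  define W c n where "W = lorentz v" and "c = v \<bullet> lhat w" and "n = (norm v)\<^sup>2"
  have n: "n \<noteq> 0" using False by (simp add: n_def)
  have W: "W\<^sup>2 * n = W\<^sup>2 - 1" using lorentz_sq_norm[OF assms] by (simp add: W_def n_def)
  have "(norm (lhat w + b *\<^sub>R v))\<^sup>2 = 1 + 2 * b * c + b\<^sup>2 * n" for b
  proof -
    have "lhat w \<bullet> lhat w = 1" by (simp flip: power2_norm_eq_inner)
    then show ?thesis
      unfolding power2_norm_eq_inner c_def n_def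
      by (simp add: inner_add_left inner_add_right inner_commute[of "lhat w" v] algebra_simps power2_eq_square)
  qed
  then have "(norm (spat (l4 v w)))\<^sup>2 = 1 + 2 * ((W - 1) * c / n) * c + ((W - 1) * c / n)\<^sup>2 * n"
    by (simp add: spat_l4 W_def c_def n_def)
  also have "((W - 1) * c / n)\<^sup>2 * n = ((W - 1) * c / n) * ((W - 1) * c)"
    using n by (simp add: power2_eq_square)
  \<comment> \<open>The cross term and the square combine through
    \<open>(W - 1) * (2 + (W - 1)) = W^2 - 1\<close>, which equals \<open>W^2 * n\<close>.\<close>
  also have "1 + 2 * ((W - 1) * c / n) * c + ((W - 1) * c / n) * ((W - 1) * c) =
      1 + c\<^sup>2 * ((W\<^sup>2 - 1) / n)"
    by (simp add: power2_eq_square algebra_simps add_divide_distrib diff_divide_distrib)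
  also have "(W\<^sup>2 - 1) / n = W\<^sup>2"
    using W n by (metis nonzero_mult_div_cancel_right)
  finally show ?thesis by (simp add: W_def c_def power_mult_distrib mult.commute)
qed

text \<open>The ratio \<open>E / \<epsilon>\<close> of the Eulerian to the comoving energy.\<close>

definition doppler :: "real ^ 3 \<Rightarrow> angle \<Rightarrow> real" where
  "doppler v w = lorentz v * (1 + v \<bullet> lhat w)"

lemma continuous_doppler [continuous_intros]: "continuous_on A (doppler v)"
  unfolding doppler_def[abs_def] by (intro continuous_intros)

lemma doppler_lower: "norm v < 1 \<Longrightarrow> lorentz v * (1 - norm v) \<le> doppler v w"
  using abs_inner_lhat[of v w] lorentz_pos[of v] by (auto simp: doppler_def)

lemma doppler_upper: "norm v < 1 \<Longrightarrow> doppler v w \<le> lorentz v * (1 + norm v)"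
  using abs_inner_lhat[of v w] lorentz_pos[of v] by (auto simp: doppler_def)

lemma doppler_pos: "norm v < 1 \<Longrightarrow> 0 < doppler v w"
  using abs_inner_lhat[of v w] lorentz_pos[of v] by (auto simp: doppler_def)

lemma doppler_eq: "doppler v w = lorentz v + v \<bullet> spat (l4 v w)"
  by (simp add: doppler_def inner_spat_l4 algebra_simps)

lemma u4_nth [simp]: "u4 v $ None = lorentz v" "spat (u4 v) = lorentz v *\<^sub>R v"
  by (simp_all add: u4_def)

lemma eul_energy_eq: "eul_energy eps v w = eps * doppler v w"
  by (simp add: eul_energy_def mdot_eq n4_def p4_def doppler_def algebra_simps)

text \<open>The spatial part of \<open>L4\<close>, in which the energy has cancelled.\<close>

definition eul_dir :: "real ^ 3 \<Rightarrow> angle \<Rightarrow> real ^ 3" where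
  "eul_dir v w = (1 / doppler v w) *\<^sub>R (lorentz v *\<^sub>R v + spat (l4 v w))"

lemma L4_eq:
  assumes "norm v < 1" "0 < eps"
  shows "L4 eps v w = vec4 0 (eul_dir v w)"
proof (rule vec4_eqI)
  have "eps * doppler v w \<noteq> 0" using assms doppler_pos[of v w] by simp
  then show "L4 eps v w $ None = 0"
    by (simp add: L4_def eul_energy_eq p4_def n4_def doppler_eq inner_spat_l4)
  show "spat (L4 eps v w) = eul_dir v w"
    using assms by (simp add: L4_def eul_energy_eq p4_def n4_def eul_dir_def)
qed

text \<open>The four-momentum is null.\<close>

lemma norm_eul_dir:
  assumes "norm v < 1"
  shows "norm (eul_dir v w) = 1"
proof -
  define W c where "W = lorentz v" and "c = v \<bullet> lhat w"
  have "(norm (W *\<^sub>R v + spat (l4 v w)))\<^sup>2 =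
      W\<^sup>2 * (norm v)\<^sup>2 + 2 * W * (v \<bullet> spat (l4 v w)) + (norm (spat (l4 v w)))\<^sup>2"
    unfolding power2_norm_eq_inner
    by (simp add: inner_add_left inner_add_right inner_commute algebra_simps power2_eq_square)
  also have "\<dots> = (W\<^sup>2 - 1) + 2 * W * (W * c) + (1 + (W * c)\<^sup>2)"
    using lorentz_sq_norm[OF assms] by (simp add: norm_spat_l4[OF assms] inner_spat_l4 W_def c_def)
  also have "\<dots> = (doppler v w)\<^sup>2"
    by (simp add: doppler_def W_def c_def power2_eq_square algebra_simps)
  finally have "norm (W *\<^sub>R v + spat (l4 v w)) = doppler v w"
    using doppler_pos[OF assms, of w] by (simp add: power2_eq_iff_nonneg)
  then show ?thesis using doppler_pos[OF assms, of w] by (simp add: eul_dir_def W_def)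
qed

lemma continuous_eul_dir [continuous_intros]: "norm v < 1 \<Longrightarrow> continuous_on A (eul_dir v)"
  unfolding eul_dir_def[abs_def]
  by (intro continuous_intros) (metis doppler_pos less_irrefl)

lemma qfac_eq:
  assumes "0 < eps"
  shows "qfac eps v G w = (\<Sum>\<nu>\<in>UNIV. \<Sum>\<rho>\<in>UNIV. (u4 v + l4 v w) $ \<nu> * (u4 v + l4 v w) $ \<rho> * G $ \<nu> $ \<rho>)"
  using assms by (simp add: qfac_def p4_def sum_divide_distrib power2_eq_square mult.assoc)

lemma continuous_l4_nth: "continuous_on A (\<lambda>w. l4 v w $ \<mu>)"
proof (cases \<mu>)
  case None
  then show ?thesis by (auto intro!: continuous_intros)
next
  case (Some i)
  have "continuous_on A (\<lambda>w. spat (l4 v w) $ i)"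
    by (intro continuous_on_component continuous_spat_l4)
  with Some show ?thesis by (simp add: spat_def)
qed

lemma continuous_qfac:
  assumes "0 < eps"
  shows "continuous_on A (qfac eps v G)"
  unfolding qfac_eq[OF assms, abs_def] vector_add_component
  by (intro continuous_intros continuous_l4_nth)


subsection \<open>Angular moments\<close>

lemma space_sphere_measure: "space sphere_measure = {0..pi} \<times> {0..2 * pi}"
  by (simp add: sphere_measure_def space_restrict_space)

lemma measurable_sphere_continuous:
  fixes g :: "angle \<Rightarrow> 'b::topological_space"
  assumes "continuous_on UNIV g"
  shows "g \<in> borel_measurable sphere_measure"
proof -
  have "g \<in> borel_measurable (restrict_space lborel ({0..pi} \<times> {0..2 * pi}))"
    using borel_measurable_continuous_onI[OF assms] by (intro measurable_restrict_space1) simp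
  then show ?thesis by (simp add: sphere_measure_def)
qed

text \<open>A continuous weight is bounded on the compact coordinate rectangle, so a multiple of
  \<open>f\<close> dominates.\<close>

lemma integrable_sphere_scaleR:
  fixes g :: "angle \<Rightarrow> 'b::{banach, second_countable_topology}"
  assumes f: "integrable sphere_measure f" and g: "continuous_on UNIV g"
  shows "integrable sphere_measure (\<lambda>w. f w *\<^sub>R g w)"
proof -
  have "compact (g ` ({0..pi} \<times> {0..2 * pi}))"
    by (intro compact_continuous_image continuous_on_subset[OF g] compact_Times) auto
  then have "bounded (g ` ({0..pi} \<times> {0..2 * pi}))" by (rule compact_imp_bounded)
  then obtain C where "\<forall>x\<in>g ` ({0..pi} \<times> {0..2 * pi}). norm x \<le> C"
    unfolding bounded_iff ..
  then have C: "norm (g w) \<le> C" if "w \<in> {0..pi} \<times> {0..2 * pi}" for w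
    using that by (simp only: ball_simps)
  show ?thesis
  proof (rule Bochner_Integration.integrable_bound)
    show "integrable sphere_measure (\<lambda>w. C * f w)" using f by simp
    show "(\<lambda>w. f w *\<^sub>R g w) \<in> borel_measurable sphere_measure"
      by (intro borel_measurable_scaleR measurable_sphere_continuous[OF g] borel_measurable_integrable f)
    show "AE w in sphere_measure. norm (f w *\<^sub>R g w) \<le> norm (C * f w)"
    proof (rule AE_I2)
      fix w assume "w \<in> space sphere_measure"
      then have "norm (g w) \<le> C" by (intro C) (simp add: space_sphere_measure)
      then have "\<bar>f w\<bar> * norm (g w) \<le> \<bar>f w\<bar> * \<bar>C\<bar>"
        by (intro mult_left_mono) auto
      then show "norm (f w *\<^sub>R g w) \<le> norm (C * f w)"
        by (simp add: abs_mult mult.commute)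
    qed
  qed
qed

lemma distributions_integrable: "f \<in> distributions \<Longrightarrow> integrable sphere_measure f"
  by (simp add: distributions_def)

lemma distributions_nonneg: "f \<in> distributions \<Longrightarrow> w \<in> space sphere_measure \<Longrightarrow> 0 \<le> f w"
  by (simp add: distributions_def)

lemma distributions_pos: "f \<in> distributions \<Longrightarrow> 0 < (LINT w|sphere_measure. f w)"
  using pi_gt_zero by (auto simp: distributions_def zero_less_divide_iff)

text \<open>The integrand is split by role: sign arguments concern the scalar weight
  \<open>g\<close>, while linear maps of the result act on \<open>\<psi>\<close>. Eulerian and
  Lagrangian moments differ only in \<open>\<psi>\<close>.\<close>

definition ang_integral :: "(angle \<Rightarrow> 'b) \<Rightarrow> (angle \<Rightarrow> real) \<Rightarrow> (angle \<Rightarrow> real)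
    \<Rightarrow> 'b::{banach, second_countable_topology}" where
  "ang_integral \<psi> f g = (LINT w|sphere_measure. (f w * g w) *\<^sub>R \<psi> w)"

lemma ang_integrable:
  fixes \<psi> :: "angle \<Rightarrow> 'b::{banach, second_countable_topology}"
  assumes "f \<in> distributions" "continuous_on UNIV g" "continuous_on UNIV \<psi>"
  shows "integrable sphere_measure (\<lambda>w. (f w * g w) *\<^sub>R \<psi> w)"
  using integrable_sphere_scaleR[OF distributions_integrable[OF assms(1)], of "\<lambda>w. g w *\<^sub>R \<psi> w"]
  by (simp add: continuous_on_scaleR assms)

lemma ang_integral_lincomb:
  assumes "f \<in> distributions" "continuous_on UNIV g" "continuous_on UNIV h" "continuous_on UNIV \<psi>"
  shows "ang_integral \<psi> f (\<lambda>w. a * g w + b * h w) =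
    a *\<^sub>R ang_integral \<psi> f g + b *\<^sub>R ang_integral \<psi> f h"
proof -
  have "a *\<^sub>R ang_integral \<psi> f g + b *\<^sub>R ang_integral \<psi> f h =
      (LINT w|sphere_measure. a *\<^sub>R (f w * g w) *\<^sub>R \<psi> w + b *\<^sub>R (f w * h w) *\<^sub>R \<psi> w)"
    unfolding ang_integral_def
    by (simp only: integral_scaleR_right Bochner_Integration.integral_add integrable_scaleR_right
        ang_integrable[OF assms(1,2,4)] ang_integrable[OF assms(1,3,4)])
  then show ?thesis
    by (simp add: ang_integral_def algebra_simps scaleR_left_distrib)
qed

lemma ang_integral_linear:
  assumes "bounded_linear T" "f \<in> distributions" "continuous_on UNIV g" "continuous_on UNIV \<psi>"
  shows "T (ang_integral \<psi> f g) = ang_integral (\<lambda>w. T (\<psi> w)) f g"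
proof -
  interpret T: bounded_linear T by fact
  show ?thesis
    using integral_bounded_linear[OF assms(1) ang_integrable[OF assms(2-4)]]
    by (simp add: ang_integral_def T.scaleR)
qed

text \<open>The triangle inequality for integrals. Unit directions make its right side the scalar
  moment, which is how both moment cones arise.\<close>

lemma norm_ang_integral_le:
  assumes f: "f \<in> distributions" and g: "continuous_on UNIV g" "\<And>w. 0 \<le> g w"
    and "\<And>w. norm (\<psi> w) = 1"
  shows "norm (ang_integral \<psi> f g) \<le> ang_integral (\<lambda>w. 1) f g"
proof -
  have "norm (ang_integral \<psi> f g) \<le> (LINT w|sphere_measure. norm ((f w * g w) *\<^sub>R \<psi> w))"
    unfolding ang_integral_def by (rule integral_norm_bound)
  also have "\<dots> = ang_integral (\<lambda>w. 1) f g"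
    unfolding ang_integral_def
    using distributions_nonneg[OF f] g(2) assms(4) by (intro Bochner_Integration.integral_cong) auto
  finally show ?thesis .
qed

lemma ang_integral_ge:
  assumes f: "f \<in> distributions" and g: "continuous_on UNIV g" "\<And>w. m \<le> g w"
  shows "m * (LINT w|sphere_measure. f w) \<le> ang_integral (\<lambda>w. 1) f g"
proof -
  have "(LINT w|sphere_measure. m * f w) \<le> (LINT w|sphere_measure. (f w * g w) *\<^sub>R 1)"
  proof (rule integral_mono)
    show "integrable sphere_measure (\<lambda>w. m * f w)"
      by (intro integrable_mult_right distributions_integrable f)
    show "integrable sphere_measure (\<lambda>w. (f w * g w) *\<^sub>R (1 :: real))"
      by (intro ang_integrable f g continuous_on_const)
    fix w assume "w \<in> space sphere_measure"
    then have "m * f w \<le> g w * f w" by (intro mult_right_mono g(2) distributions_nonneg[OF f])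
    then show "m * f w \<le> (f w * g w) *\<^sub>R 1" by (simp add: mult.commute)
  qed
  then show ?thesis by (simp add: ang_integral_def)
qed

lemma eul_moment_eq:
  assumes "norm v < 1" "0 < eps"
  shows "eul_moment eps v (\<lambda>w. f w * g w) =
    (1 / (4 * pi)) *\<^sub>R ang_integral (\<lambda>w. (1, eul_dir v w)) f g"
  using assms by (simp add: eul_moment_def L4_eq ang_integral_def)

lemma continuous_moment_dir: "norm v < 1 \<Longrightarrow> continuous_on A (\<lambda>w. (1 :: real, eul_dir v w))"
  by (intro continuous_intros)

lemma eul_moment_lincomb:
  assumes "norm v < 1" "0 < eps" "f \<in> distributions" "continuous_on UNIV g" "continuous_on UNIV h"
  shows "a *\<^sub>R eul_moment eps v (\<lambda>w. f w * g w) + b *\<^sub>R eul_moment eps v (\<lambda>w. f w * h w) =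
    eul_moment eps v (\<lambda>w. f w * (a * g w + b * h w))"
  unfolding eul_moment_eq[OF assms(1,2)]
    ang_integral_lincomb[OF assms(3-5) continuous_moment_dir[OF assms(1)]]
  by (simp add: algebra_simps)

lemma eul_moment_cone:
  assumes "norm v < 1" "0 < eps" "f \<in> distributions" "continuous_on UNIV g" "\<And>w. 0 \<le> g w"
  shows "eul_moment eps v (\<lambda>w. f w * g w) \<in> moment_cone"
proof -
  note lin = ang_integral_linear[OF _ assms(3,4) continuous_moment_dir[OF assms(1)]]
  have "ang_integral (\<lambda>w. (1, eul_dir v w)) f g \<in> moment_cone"
    using norm_ang_integral_le[OF assms(3-5), of "eul_dir v"] norm_eul_dir[OF assms(1)]
    by (simp add: moment_cone_def lin[OF bounded_linear_fst] lin[OF bounded_linear_snd])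
  then show ?thesis
    unfolding eul_moment_eq[OF assms(1,2)] by (intro moment_cone_scaleR) simp
qed

section \<open>Signs of the Eulerian flux combinations\<close>

lemma eul_U_eq: "eps \<noteq> 0 \<Longrightarrow> eul_U eps v f = eul_moment eps v (\<lambda>w. f w * (eps * (doppler v w)\<^sup>2))"
  by (simp add: eul_U_def eul_energy_eq power2_eq_square algebra_simps)

lemma eul_F_eq:
  assumes "norm v < 1" "0 < eps"
  shows "eul_F eps v f i = eul_moment eps v (\<lambda>w. f w * (eps * (doppler v w)\<^sup>2 * eul_dir v w $ i))"
  using assms by (simp add: eul_F_def eul_energy_eq L4_eq power2_eq_square algebra_simps)

lemma eul_Utilde_eq: "eul_Utilde eps v f = eul_moment eps v (\<lambda>w. f w * (eps * doppler v w))"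
  by (simp add: eul_Utilde_def eul_energy_eq algebra_simps)

lemma eul_Feps_eq:
  "eul_Feps eps v G f = - eul_moment eps v (\<lambda>w. f w * (qfac eps v G w * (eps * doppler v w)))"
  by (simp add: eul_Feps_def eul_energy_eq algebra_simps)

text \<open>The combined weight is \<epsilon> D^2 (a + \<sigma> L^i) with D the Doppler factor, and
  |L^i| is at most the norm 1 of the direction. The sign \<open>\<sigma>\<close> serves both sides
  of a face.\<close>

lemma eul_flux_cone:
  assumes v: "norm v < 1" and e: "0 < eps" and f: "f \<in> distributions" and a: "1 \<le> a"
    and \<sigma>: "\<bar>\<sigma>\<bar> = 1"
  shows "a *\<^sub>R eul_U eps v f + \<sigma> *\<^sub>R eul_F eps v f i \<in> moment_cone"
proof -
  have "a *\<^sub>R eul_U eps v f + \<sigma> *\<^sub>R eul_F eps v f i =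
    eul_moment eps v (\<lambda>w. f w * (a * (eps * (doppler v w)\<^sup>2) + \<sigma> * (eps * (doppler v w)\<^sup>2 * eul_dir v w $ i)))"
    unfolding eul_F_eq[OF v e] eul_U_eq[OF less_imp_neq[OF e, symmetric]]
    using v by (intro eul_moment_lincomb e f) (auto intro!: continuous_intros)
  also have "\<dots> \<in> moment_cone"
  proof (rule eul_moment_cone[OF v e f])
    fix w
    have "\<bar>eul_dir v w $ i\<bar> \<le> 1" using component_le_norm_cart[of "eul_dir v w" i] norm_eul_dir[OF v] by simp
    then have "0 \<le> a + \<sigma> * eul_dir v w $ i" using a \<sigma> by (auto simp: abs_if split: if_splits)
    then have "0 \<le> eps * (doppler v w)\<^sup>2 * (a + \<sigma> * eul_dir v w $ i)" using e by simp
    then show "0 \<le> a * (eps * (doppler v w)\<^sup>2) + \<sigma> * (eps * (doppler v w)\<^sup>2 * eul_dir v w $ i)"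
      by (simp add: algebra_simps)
  qed (auto intro!: continuous_intros v)
  finally show ?thesis .
qed

text \<open>The combined weight is \<epsilon> D (a - \<sigma> q), with D the Doppler factor.\<close>

lemma eul_eps_flux_cone:
  assumes v: "norm v < 1" and e: "0 < eps" and f: "f \<in> distributions"
    and a: "\<And>w. \<bar>qfac eps v G w\<bar> \<le> a" and \<sigma>: "\<bar>\<sigma>\<bar> = 1"
  shows "a *\<^sub>R eul_Utilde eps v f + \<sigma> *\<^sub>R eul_Feps eps v G f \<in> moment_cone"
proof -
  have "a *\<^sub>R eul_Utilde eps v f + \<sigma> *\<^sub>R eul_Feps eps v G f =
      a *\<^sub>R eul_moment eps v (\<lambda>w. f w * (eps * doppler v w))
      + (- \<sigma>) *\<^sub>R eul_moment eps v (\<lambda>w. f w * (qfac eps v G w * (eps * doppler v w)))"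
    unfolding eul_Feps_eq eul_Utilde_eq by simp
  also have "\<dots> = eul_moment eps v (\<lambda>w. f w * (a * (eps * doppler v w)
      + (- \<sigma>) * (qfac eps v G w * (eps * doppler v w))))"
    by (intro eul_moment_lincomb v e f) (auto intro!: continuous_intros continuous_qfac e)
  also have "\<dots> \<in> moment_cone"
  proof (rule eul_moment_cone[OF v e f])
    fix w
    have "0 \<le> a - \<sigma> * qfac eps v G w" using a[of w] \<sigma> by (auto simp: abs_if split: if_splits)
    then have "0 \<le> eps * doppler v w * (a - \<sigma> * qfac eps v G w)"
      using e doppler_pos[OF v, of w] by simp
    then show "0 \<le> a * (eps * doppler v w) + (- \<sigma>) * (qfac eps v G w * (eps * doppler v w))"
      by (simp add: algebra_simps)
  qed (auto intro!: continuous_intros continuous_qfac e)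
  finally show ?thesis .
qed

text \<open>\<open>eul_U\<close> carries one Doppler factor D more than \<open>eul_Utilde\<close>,
  so the combined weight is \<epsilon> D (b D - c). The lower bound W (1 - |v|) of D is the origin
  of that factor in the time step restriction.\<close>

lemma eul_U_Utilde_cone:
  assumes v: "norm v < 1" and e: "0 < eps" and f: "f \<in> distributions"
    and bc: "0 \<le> b" "c \<le> b * (lorentz v * (1 - norm v))"
  shows "b *\<^sub>R eul_U eps v f - c *\<^sub>R eul_Utilde eps v f \<in> moment_cone"
proof -
  have "b *\<^sub>R eul_U eps v f - c *\<^sub>R eul_Utilde eps v f =
      b *\<^sub>R eul_moment eps v (\<lambda>w. f w * (eps * (doppler v w)\<^sup>2))
      + (- c) *\<^sub>R eul_moment eps v (\<lambda>w. f w * (eps * doppler v w))"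
    using e by (simp add: eul_U_eq eul_Utilde_eq)
  also have "\<dots> = eul_moment eps v (\<lambda>w. f w * (b * (eps * (doppler v w)\<^sup>2) + (- c) * (eps * doppler v w)))"
    by (intro eul_moment_lincomb v e f) (auto intro!: continuous_intros)
  also have "\<dots> \<in> moment_cone"
  proof (rule eul_moment_cone[OF v e f])
    fix w
    have "c \<le> b * doppler v w"
      using bc doppler_lower[OF v, of w] by (meson mult_left_mono order_trans)
    then have "0 \<le> eps * doppler v w * (b * doppler v w - c)"
      using e doppler_pos[OF v, of w] by simp
    then show "0 \<le> b * (eps * (doppler v w)\<^sup>2) + (- c) * (eps * doppler v w)"
      by (simp add: algebra_simps power2_eq_square)
  qed (auto intro!: continuous_intros)
  finally show ?thesis .
qed

subsection \<open>The implicit update\<close>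

text \<open>The spatial part, in the comoving frame, of a covector orthogonal to the four-velocity.\<close>

definition unboost :: "real ^ 3 \<Rightarrow> real ^ 3 \<Rightarrow> real ^ 3" where
  "unboost v b = b - ((1 - 1 / lorentz v) / (norm v)\<^sup>2 * (v \<bullet> b)) *\<^sub>R v"

lemma bounded_linear_unboost: "bounded_linear (unboost v)"
  unfolding linear_conv_bounded_linear[symmetric]
  by (rule linearI) (simp_all add: unboost_def inner_add_right distrib_left scaleR_add_left
      scaleR_diff_right mult.left_commute)

lemma inner_unboost:
  assumes "norm v < 1"
  shows "v \<bullet> b = lorentz v * (v \<bullet> unboost v b)"
proof (cases "v = 0")
  case False
  then have "v \<bullet> unboost v b = v \<bullet> b - (1 - 1 / lorentz v) * (v \<bullet> b)"
    by (simp add: unboost_def inner_diff_right flip: power2_norm_eq_inner)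
  then show ?thesis using lorentz_pos[OF assms] by (simp add: field_simps)
qed simp

text \<open>For a covector with time component \<open>- (v \<bullet> b)\<close> the right side is
  its Minkowski square. Lagrangian realizability thereby bounds the Euclidean norm of a linear
  image, so that the triangle inequality is available.\<close>

lemma norm_unboost:
  assumes "norm v < 1"
  shows "(norm (unboost v b))\<^sup>2 = (norm b)\<^sup>2 - (v \<bullet> b)\<^sup>2"
proof (cases "v = 0")
  case True
  then show ?thesis by (simp add: unboost_def)
next
  case False
  define W c n m where "W = lorentz v" and "c = v \<bullet> b" and "n = (norm v)\<^sup>2" and "m = (1 - 1 / W) / n"
  have n: "n \<noteq> 0" using False by (simp add: n_def)
  have "W > 0" using lorentz_pos[OF assms] by (simp add: W_def)
  have W: "W\<^sup>2 * (1 - n) = 1" using lorentz_sq[OF assms] by (simp add: W_def n_def)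
  then have "1 - n = 1 / W\<^sup>2" using \<open>W > 0\<close> by (simp add: field_simps)
  then have nW: "(1 / W) * (1 / W) = 1 - n" by (simp add: power2_eq_square)
  have mn: "m * n = 1 - 1 / W" using n by (simp add: m_def)
  have sq: "(norm (b - k *\<^sub>R v))\<^sup>2 = (norm b)\<^sup>2 - 2 * k * c + k\<^sup>2 * n" for k
    unfolding power2_norm_eq_inner c_def n_def
    by (simp add: inner_diff_left inner_diff_right inner_commute[of b v] algebra_simps power2_eq_square)
  have "unboost v b = b - (m * c) *\<^sub>R v"
    by (simp add: unboost_def m_def c_def n_def W_def)
  then have "(norm (unboost v b))\<^sup>2 = (norm b)\<^sup>2 - 2 * m * c\<^sup>2 + m * (m * n) * c\<^sup>2"
    using sq[of "m * c"] by (simp add: power2_eq_square mult.commute mult.left_commute)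
  also have "\<dots> = (norm b)\<^sup>2 - m * (1 + 1 / W) * c\<^sup>2"
    unfolding mn by (simp add: algebra_simps)
  \<comment> \<open>The factors \<open>1 - 1 / W\<close> and \<open>1 + 1 / W\<close> multiply to
    \<open>1 - 1 / W^2 = n\<close>, which cancels the denominator of \<open>m\<close>.\<close>
  also have "m * (1 + 1 / W) = (1 - (1 / W) * (1 / W)) / n"
    by (simp add: m_def algebra_simps diff_divide_distrib add_divide_distrib)
  also have "\<dots> = 1" unfolding nW using n by simp
  finally show ?thesis by (simp add: c_def)
qed

lemma unboost_l4:
  assumes "norm v < 1"
  shows "unboost v (spat (l4 v w)) = lhat w"
proof -
  have W: "(1 - 1 / lorentz v) * lorentz v = lorentz v - 1"
    using lorentz_pos[OF assms] by (simp add: field_simps)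
  have "a / n * (b * c) = a * b * c / n" for a b c n :: real
    by simp
  from this[of "1 - 1 / lorentz v" "(norm v)\<^sup>2" "lorentz v" "v \<bullet> lhat w", unfolded W]
  have "(1 - 1 / lorentz v) / (norm v)\<^sup>2 * (lorentz v * (v \<bullet> lhat w)) =
      (lorentz v - 1) * (v \<bullet> lhat w) / (norm v)\<^sup>2" .
  then show ?thesis by (simp only: unboost_def inner_spat_l4) (simp add: spat_l4)
qed

section \<open>Lagrangian moments and their cone\<close>

definition lag_cone :: "real ^ 3 \<Rightarrow> moments set" where
  "lag_cone v = {M. norm (unboost v (snd M)) \<le> fst M}"

lemma lag_realizable_iff:
  assumes "norm v < 1"
  shows "lag_realizable v M \<longleftrightarrow> M \<in> lag_cone v \<and> 0 < fst M"
proof -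
  have "mdot (vec4 (- (v \<bullet> snd M)) (snd M)) (vec4 (- (v \<bullet> snd M)) (snd M)) =
      (norm (unboost v (snd M)))\<^sup>2"
    using norm_unboost[OF assms, of "snd M"]
    by (simp add: mdot_eq power2_eq_square dot_square_norm)
  then show ?thesis by (auto simp: lag_realizable_def realizable_def lag_cone_def)
qed

lemma lag_cone_add: "M \<in> lag_cone v \<Longrightarrow> N \<in> lag_cone v \<Longrightarrow> M + N \<in> lag_cone v"
  by (auto simp: lag_cone_def linear_add[OF bounded_linear.linear[OF bounded_linear_unboost]]
      intro: norm_triangle_mono)

text \<open>Damping the flux more than the energy density keeps the cone condition. The two
  components of the preconditioner scale differently, so invariance under common scaling does not
  suffice.\<close>

lemma lag_cone_scale:
  assumes "M \<in> lag_cone v" "0 \<le> c" "c \<le> d"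
  shows "(d * fst M, c *\<^sub>R snd M) \<in> lag_cone v"
proof -
  have "c * norm (unboost v (snd M)) \<le> d * fst M"
    using assms by (intro mult_mono) (auto simp: lag_cone_def intro: order_trans[OF norm_ge_zero])
  then show ?thesis
    using assms(2) by (simp add: lag_cone_def linear_scale[OF bounded_linear.linear[OF bounded_linear_unboost]])
qed

lemma lag_cone_scaleR: "M \<in> lag_cone v \<Longrightarrow> 0 \<le> c \<Longrightarrow> c *\<^sub>R M \<in> lag_cone v"
  using lag_cone_scale[of M v c c] by (simp add: scaleR_prod_def)

lemma lag_cone_fst: "0 \<le> J \<Longrightarrow> (J, 0) \<in> lag_cone v"
  by (simp add: lag_cone_def linear_0[OF bounded_linear.linear[OF bounded_linear_unboost]])

lemma closed_lag_cone: "closed (lag_cone v)"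
  unfolding lag_cone_def
  by (intro closed_Collect_le continuous_intros bounded_linear.continuous_on[OF bounded_linear_unboost])

definition lag_moment :: "real \<Rightarrow> real ^ 3 \<Rightarrow> (angle \<Rightarrow> real) \<Rightarrow> (angle \<Rightarrow> real) \<Rightarrow> moments" where
  "lag_moment eps v f g = (eps / (4 * pi)) *\<^sub>R ang_integral (\<lambda>w. (1, spat (l4 v w))) f g"

lemma continuous_lag_dir: "continuous_on A (\<lambda>w. (1 :: real, spat (l4 v w)))"
  by (intro continuous_intros)

lemma lag_moment_lincomb:
  assumes "f \<in> distributions" "continuous_on UNIV g" "continuous_on UNIV h"
  shows "lag_moment eps v f (\<lambda>w. a * g w + b * h w) =
    a *\<^sub>R lag_moment eps v f g + b *\<^sub>R lag_moment eps v f h"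
  unfolding lag_moment_def ang_integral_lincomb[OF assms continuous_lag_dir]
  by (simp add: algebra_simps)

lemma fst_lag_moment:
  assumes "f \<in> distributions" "continuous_on UNIV g"
  shows "fst (lag_moment eps v f g) = eps / (4 * pi) * (LINT w|sphere_measure. f w * g w)"
  using ang_integral_linear[OF bounded_linear_fst assms continuous_lag_dir[of UNIV v]]
  by (simp add: lag_moment_def ang_integral_def)

lemma snd_lag_moment:
  assumes "f \<in> distributions" "continuous_on UNIV g"
  shows "snd (lag_moment eps v f g) $ i =
    eps / (4 * pi) * (LINT w|sphere_measure. f w * g w * l4 v w $ Some i)"
proof -
  have "bounded_linear (\<lambda>M :: moments. snd M $ i)"
    by (intro bounded_linear_compose[OF bounded_linear_vec_nth bounded_linear_snd])
  from ang_integral_linear[OF this assms continuous_lag_dir[of UNIV v]] show ?thesis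
    by (simp add: lag_moment_def ang_integral_def spat_def)
qed

text \<open>\<open>unboost\<close> moves under the integral and turns the boosted direction into the
  unit vector \<open>lhat w\<close>.\<close>

lemma lag_moment_cone:
  assumes v: "norm v < 1" and e: "0 < eps"
    and fg: "f \<in> distributions" "continuous_on UNIV g" "\<And>w. 0 \<le> g w"
  shows "lag_moment eps v f g \<in> lag_cone v"
proof -
  note lin = ang_integral_linear[OF _ fg(1,2) continuous_lag_dir[of UNIV v]]
  have B: "bounded_linear (\<lambda>M :: moments. unboost v (snd M))"
    by (intro bounded_linear_compose[OF bounded_linear_unboost bounded_linear_snd])
  have "norm (unboost v (snd (ang_integral (\<lambda>w. (1 :: real, spat (l4 v w))) f g))) =
      norm (ang_integral lhat f g)"
    using lin[OF B] by (simp add: unboost_l4[OF v])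
  also have "\<dots> \<le> ang_integral (\<lambda>w. 1) f g"
    by (intro norm_ang_integral_le fg) simp
  also have "\<dots> = fst (ang_integral (\<lambda>w. (1 :: real, spat (l4 v w))) f g)"
    using lin[OF bounded_linear_fst] by simp
  finally have "ang_integral (\<lambda>w. (1, spat (l4 v w))) f g \<in> lag_cone v"
    by (simp add: lag_cone_def)
  then show ?thesis
    unfolding lag_moment_def using e by (intro lag_cone_scaleR) auto
qed

text \<open>The uniform bound \<open>m\<close> transfers positivity from the integral of
  \<open>f\<close> to the weighted one.\<close>

lemma lag_moment_realizable:
  assumes v: "norm v < 1" and e: "0 < eps"
    and fg: "f \<in> distributions" "continuous_on UNIV g" "\<And>w. m \<le> g w" and m: "0 < m"
  shows "lag_realizable v (lag_moment eps v f g)"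
proof -
  have "0 < m * (LINT w|sphere_measure. f w)"
    using distributions_pos[OF fg(1)] m by simp
  also have "\<dots> \<le> (LINT w|sphere_measure. f w * g w)"
    using ang_integral_ge[OF fg] by (simp add: ang_integral_def)
  finally have "0 < fst (lag_moment eps v f g)"
    using e pi_gt_zero by (simp add: fst_lag_moment[OF fg(1,2)])
  moreover have "0 \<le> g w" for w using fg(3)[of w] m by linarith
  then have "lag_moment eps v f g \<in> lag_cone v"
    by (intro lag_moment_cone[OF v e fg(1,2)])
  ultimately show ?thesis by (simp add: lag_realizable_iff[OF v])
qed

lemma lag_closed_eq:
  assumes "lag_closed cl eps v M" "lag_realizable v M"
  shows "cl eps v M \<in> distributions" "M = lag_moment eps v (cl eps v M) (\<lambda>w. 1)"
proof -
  show f: "cl eps v M \<in> distributions"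
    using assms by (simp add: lag_closed_def)
  have J: "fst M = lag_J eps (cl eps v M)"
    and H: "\<And>\<mu>. vec4 (- (v \<bullet> snd M)) (snd M) $ \<mu> = lag_H eps v (cl eps v M) \<mu>"
    using assms by (auto simp: lag_closed_def)
  have "snd M $ i = snd (lag_moment eps v (cl eps v M) (\<lambda>w. 1)) $ i" for i
    using H[of "Some i"] by (simp add: snd_lag_moment[OF f] lag_H_def)
  with J show "M = lag_moment eps v (cl eps v M) (\<lambda>w. 1)"
    by (auto intro!: prod_eqI simp: vec_eq_iff fst_lag_moment[OF f] lag_J_def)
qed

text \<open>Both components integrate \<open>f\<close> against
  \<open>W + v \<bullet> spat (l4 v w)\<close>, which is the Doppler factor by
  \<open>doppler_eq\<close>. A combination of \<open>M\<close> and \<open>U_hat Q M\<close> is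
  therefore a single moment, whose sign can be read off its weight.\<close>

lemma U_hat_eq:
  assumes "lag_closed (lag_cl Q) (c_eps Q) (c_vel Q) M" "lag_realizable (c_vel Q) M"
  defines "f \<equiv> lag_cl Q (c_eps Q) (c_vel Q) M"
  shows "U_hat Q M = lag_moment (c_eps Q) (c_vel Q) f (doppler (c_vel Q))"
proof -
  define v eps W where "v = c_vel Q" and "eps = c_eps Q" and "W = lorentz v"
  have f: "f \<in> distributions" and M: "M = lag_moment eps v f (\<lambda>w. 1)"
    using lag_closed_eq[OF assms(1,2)] by (simp_all add: f_def v_def eps_def)
  define S where "S = lag_moment eps v f (\<lambda>w. v \<bullet> spat (l4 v w))"
  have cont: "continuous_on UNIV (\<lambda>w. v \<bullet> spat (l4 v w))" "continuous_on UNIV (\<lambda>w :: angle. 1 :: real)"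
    by (intro continuous_intros)+
  have D: "lag_moment eps v f (doppler v) = W *\<^sub>R M + S"
    using lag_moment_lincomb[OF f cont(2,1), of eps v W 1]
    by (simp add: W_def M[symmetric] S_def flip: doppler_eq)
  have "v \<bullet> snd M = fst S"
  proof -
    have "bounded_linear (\<lambda>M :: moments. v \<bullet> snd M)"
      by (intro bounded_linear_compose[OF bounded_linear_inner_right bounded_linear_snd])
    from ang_integral_linear[OF this f cont(2) continuous_lag_dir[of UNIV v]] show ?thesis
      unfolding S_def fst_lag_moment[OF f cont(1)]
      by (subst M) (simp add: lag_moment_def ang_integral_def)
  qed
  moreover have "(\<Sum>i\<in>UNIV. v $ i * lag_K eps v f (Some i) (Some j)) = snd S $ j" for j
  proof -
    have lj: "continuous_on UNIV (\<lambda>w. l4 v w $ Some j)" by (rule continuous_l4_nth)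
    note lin = ang_integral_linear[OF _ f lj continuous_spat_l4[of UNIV v]]
    have K: "lag_K eps v f (Some i) (Some j) =
        eps / (4 * pi) * (ang_integral (\<lambda>w. spat (l4 v w)) f (\<lambda>w. l4 v w $ Some j) $ i)" for i
      using lin[OF bounded_linear_vec_nth[of i]]
      by (simp add: lag_K_def ang_integral_def spat_def mult.commute mult.left_commute)
    have "(\<Sum>i\<in>UNIV. v $ i * lag_K eps v f (Some i) (Some j)) =
        eps / (4 * pi) * (v \<bullet> ang_integral (\<lambda>w. spat (l4 v w)) f (\<lambda>w. l4 v w $ Some j))"
      unfolding K by (simp add: inner_vec_def sum_distrib_left mult.left_commute)
    also have "\<dots> = eps / (4 * pi) * (LINT w|sphere_measure. f w * (v \<bullet> spat (l4 v w)) * l4 v w $ Some j)"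
      using lin[OF bounded_linear_inner_right[of v]]
      by (simp add: ang_integral_def mult.commute mult.left_commute)
    finally show ?thesis by (simp add: S_def snd_lag_moment[OF f cont(1)])
  qed
  moreover have "lag_cl Q eps v M = f" by (simp add: f_def v_def eps_def)
  ultimately show ?thesis
    unfolding v_def[symmetric] eps_def[symmetric] D
    by (auto simp: U_hat_def Let_def vec_eq_iff W_def v_def[symmetric]
        eps_def[symmetric] intro!: prod_eqI)
qed

section \<open>Passage between hat and conserved moments\<close>

lemma fst_hat_to_cons: "fst (hat_to_cons v M) = lorentz v * fst M + v \<bullet> snd M"
  and snd_hat_to_cons: "snd (hat_to_cons v M) = snd M + (lorentz v * fst M) *\<^sub>R v"
  by (simp_all add: hat_to_cons_def split: prod.splits)

text \<open>\<open>hat_to_cons\<close> preserves the Minkowski square of \<open>a u\<^sup>\<mu> + b\<^sup>\<mu>\<close>.\<close>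

lemma hat_to_cons_square:
  assumes "norm v < 1"
  shows "(fst (hat_to_cons v M))\<^sup>2 - (norm (snd (hat_to_cons v M)))\<^sup>2 =
    (fst M)\<^sup>2 - (norm (unboost v (snd M)))\<^sup>2"
proof -
  define W a b where "W = lorentz v" and "a = fst M" and "b = snd M"
  have "(norm (b + (W * a) *\<^sub>R v))\<^sup>2 = (norm b)\<^sup>2 + 2 * (W * a) * (v \<bullet> b) + a\<^sup>2 * (W\<^sup>2 * (norm v)\<^sup>2)"
    unfolding power2_norm_eq_inner
    by (simp add: inner_add_left inner_add_right inner_commute[of b v] algebra_simps power2_eq_square)
  then have "(norm (b + (W * a) *\<^sub>R v))\<^sup>2 = (norm b)\<^sup>2 + 2 * (W * a) * (v \<bullet> b) + a\<^sup>2 * (W\<^sup>2 - 1)"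
    using lorentz_sq_norm[OF assms] by (simp add: W_def)
  then show ?thesis
    unfolding norm_unboost[OF assms] fst_hat_to_cons snd_hat_to_cons
      W_def[symmetric] a_def[symmetric] b_def[symmetric]
    by (simp add: power2_eq_square algebra_simps)
qed

text \<open>\<open>inv\<close> is a choice function, so a preimage is exhibited first. Subtracting
  \<open>v \<bullet> snd\<close> from \<open>fst\<close> cancels \<open>v \<bullet> b\<close> and
  leaves \<open>W * (1 - |v|^2) * a\<close>; this yields the witness and also fixes the first
  component of every preimage.\<close>

lemma hat_to_cons_inverse:
  assumes "norm v < 1"
  shows "hat_to_cons v (inv (hat_to_cons v) U) = U"
    and "fst (inv (hat_to_cons v) U) = lorentz v * (fst U - v \<bullet> snd U)"
proof -
  define W a where "W = lorentz v" and "a = W * (fst U - v \<bullet> snd U)"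
  have W: "W * (W * (1 - (norm v)\<^sup>2)) = 1"
    using lorentz_sq[OF assms] by (simp add: W_def power2_eq_square)
  have "W * (1 - (norm v)\<^sup>2) * a = W * (W * (1 - (norm v)\<^sup>2)) * (fst U - v \<bullet> snd U)"
    by (simp only: a_def mult.assoc mult.left_commute)
  then have first: "fst U - v \<bullet> snd U = W * (1 - (norm v)\<^sup>2) * a" using W by simp
  have "hat_to_cons v (a, snd U - (W * a) *\<^sub>R v) = U"
    using first by (intro prod_eqI)
      (simp_all add: fst_hat_to_cons snd_hat_to_cons W_def[symmetric] inner_diff_right algebra_simps
        dot_square_norm)
  then have "U \<in> range (hat_to_cons v)" by (metis rangeI)
  then show A: "hat_to_cons v (inv (hat_to_cons v) U) = U" by (rule f_inv_into_f)
  define M where "M = inv (hat_to_cons v) U"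
  have "fst (hat_to_cons v M) - v \<bullet> snd (hat_to_cons v M) = W * (1 - (norm v)\<^sup>2) * fst M"
    by (simp add: fst_hat_to_cons snd_hat_to_cons W_def inner_add_right algebra_simps dot_square_norm)
  then have "W * (fst U - v \<bullet> snd U) = W * (W * (1 - (norm v)\<^sup>2)) * fst M"
    using A unfolding M_def[symmetric] by (simp only: mult.assoc)
  then show "fst (inv (hat_to_cons v) U) = lorentz v * (fst U - v \<bullet> snd U)"
    using W unfolding M_def[symmetric] W_def[symmetric] by simp
qed

text \<open>Equality of the Minkowski squares decides the cone condition only once the sign of the
  energy is known; the sign comes from the Cauchy-Schwarz inequality and |v| < 1.\<close>

lemma lag_realizable_inverse:
  assumes v: "norm v < 1" and U: "eul_realizable U"
  shows "lag_realizable v (inv (hat_to_cons v) U)"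
proof -
  define M where "M = inv (hat_to_cons v) U"
  have U': "0 < fst U" "norm (snd U) \<le> fst U" using U by (auto simp: eul_realizable_iff)
  have "v \<bullet> snd U \<le> norm v * norm (snd U)" by (rule norm_cauchy_schwarz)
  also have "\<dots> \<le> norm v * fst U" using U' by (simp add: mult_left_mono)
  also have "\<dots> < fst U" using U' v by simp
  finally have a: "0 < fst M"
    using lorentz_pos[OF v] by (simp add: M_def hat_to_cons_inverse(2)[OF v])
  have "(norm (snd U))\<^sup>2 \<le> (fst U)\<^sup>2" using U' by (intro power_mono) auto
  then have "(norm (unboost v (snd M)))\<^sup>2 \<le> (fst M)\<^sup>2"
    using hat_to_cons_square[OF v, of M] unfolding M_def hat_to_cons_inverse(1)[OF v] by linarith
  then have "norm (unboost v (snd M)) \<le> fst M" by (rule power2_le_imp_le[OF _ less_imp_le[OF a]])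
  then show ?thesis using a by (simp add: lag_realizable_iff[OF v] lag_cone_def M_def)
qed

lemma eul_realizable_hat:
  assumes v: "norm v < 1" and M: "lag_realizable v M"
  shows "eul_realizable (hat_to_cons v M)"
proof -
  have M': "0 < fst M" "norm (unboost v (snd M)) \<le> fst M"
    using M by (auto simp: lag_realizable_iff[OF v] lag_cone_def)
  have "\<bar>v \<bullet> unboost v (snd M)\<bar> \<le> norm v * norm (unboost v (snd M))" by (rule Cauchy_Schwarz_ineq2)
  also have "\<dots> \<le> norm v * fst M" using M' by (simp add: mult_left_mono)
  also have "\<dots> < fst M" using M' v by simp
  finally have "0 < lorentz v * (fst M + v \<bullet> unboost v (snd M))"
    using lorentz_pos[OF v] by simp
  then have E: "0 < fst (hat_to_cons v M)"
    unfolding fst_hat_to_cons inner_unboost[OF v, of "snd M"] by (simp add: algebra_simps)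
  have "(norm (unboost v (snd M)))\<^sup>2 \<le> (fst M)\<^sup>2" using M' by (intro power_mono) auto
  then have "(norm (snd (hat_to_cons v M)))\<^sup>2 \<le> (fst (hat_to_cons v M))\<^sup>2"
    using hat_to_cons_square[OF v, of M] by linarith
  then have "norm (snd (hat_to_cons v M)) \<le> fst (hat_to_cons v M)"
    by (rule power2_le_imp_le[OF _ less_imp_le[OF E]])
  with E show ?thesis by (simp add: eul_realizable_iff)
qed

lemma linear_hat_to_cons: "linear (hat_to_cons v)"
  by (rule linearI; rule prod_eqI)
    (simp_all add: fst_hat_to_cons snd_hat_to_cons inner_add_right algebra_simps)

text \<open>The new iterate is a nonnegative combination of the moments with the nonnegative weight
  \<open>W - \<lambda> E / \<epsilon>\<close>, of the explicit data and of the equilibrium; since \<open>\<chi> \<le> \<kappa>\<close>, the preconditioner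
  damps the flux at least as much as the density.\<close>

lemma richardson_step_realizable:
  fixes Q dtau M Us
  defines "v \<equiv> c_vel Q"
  assumes v: "norm v < 1" and e: "0 < c_eps Q"
    and coll: "0 \<le> chi Q" "chi Q \<le> kappa Q" "0 \<le> J_eq Q"
    and lam: "0 < lam Q" "lam Q \<le> 1 / (1 + norm v)" and dtau: "0 \<le> dtau"
    and M: "lag_realizable v M" "lag_closed (lag_cl Q) (c_eps Q) v M"
    and Us: "lag_realizable v Us"
  shows "lag_realizable v (M - lam Q *\<^sub>R Lambda Q dtau (U_hat Q M - Us - dtau *\<^sub>R C_hat Q M))"
proof -
  define W l x k where "W = lorentz v" and "l = lam Q" and "x = l * dtau * chi Q"
    and "k = l * dtau * kappa Q"
  have W: "0 < W" using lorentz_pos[OF v] by (simp add: W_def)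
  have xk: "0 \<le> x" "x \<le> k" using coll lam dtau by (auto simp: x_def k_def l_def mult_left_mono)
  define f where "f = lag_cl Q (c_eps Q) v M"
  have f: "f \<in> distributions" and Mf: "M = lag_moment (c_eps Q) v f (\<lambda>w. 1)"
    using lag_closed_eq[OF M(2,1)] by (simp_all add: f_def)
  define G where "G = W *\<^sub>R M - l *\<^sub>R U_hat Q M"
  have U_hat: "U_hat Q M = lag_moment (c_eps Q) v f (doppler v)"
    using U_hat_eq[OF M(2,1)[unfolded v_def]] by (simp add: f_def v_def)
  have "G = lag_moment (c_eps Q) v f (\<lambda>w. W * 1 + (- l) * doppler v w)"
    unfolding G_def U_hat
    by (subst lag_moment_lincomb[OF f]) (auto intro!: continuous_intros simp flip: Mf)
  also have "\<dots> \<in> lag_cone v"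
  proof (rule lag_moment_cone[OF v e f])
    fix w
    have "l * doppler v w \<le> 1 / (1 + norm v) * (W * (1 + norm v))"
      using lam doppler_upper[OF v, of w] doppler_pos[OF v, of w]
      by (intro mult_mono) (auto simp: l_def W_def)
    also have "\<dots> = W" by (simp add: add_nonneg_eq_0_iff)
    finally show "0 \<le> W * 1 + (- l) * doppler v w" by simp
  qed (intro continuous_intros)
  finally have G: "G \<in> lag_cone v" .
  \<comment> \<open>The new iterate with its denominators cleared. The terms \<open>x M\<close> and
    \<open>k M\<close> of the denominators cancel the absorption, and emission leaves
    \<open>x * J_eq Q\<close> in the energy component only.\<close>
  define R where "R = G + (l *\<^sub>R Us + (x * J_eq Q, 0))"
  have Us': "Us \<in> lag_cone v" "0 < fst Us" using Us by (auto simp: lag_realizable_iff[OF v])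
  have R: "R \<in> lag_cone v"
    unfolding R_def using lam xk coll
    by (intro lag_cone_add G lag_cone_scaleR Us' lag_cone_fst) (auto simp: l_def)
  have "0 \<le> fst G" using G by (auto simp: lag_cone_def intro: order_trans[OF norm_ge_zero])
  then have R_pos: "0 < fst R"
    using lam xk coll Us'(2) by (simp add: R_def l_def add_nonneg_pos add_pos_nonneg)
  have step: "M - l *\<^sub>R Lambda Q dtau (U_hat Q M - Us - dtau *\<^sub>R C_hat Q M) =
      (1 / (W + x) * fst R, (1 / (W + k)) *\<^sub>R snd R)"
  proof (rule prod_eqI)
    have "W + x \<noteq> 0" "W + k \<noteq> 0" using W xk by auto
    then have M1: "fst M = (1 / (W + x)) * ((W + x) * fst M)"
      and M2: "snd M = (1 / (W + k)) *\<^sub>R (W + k) *\<^sub>R snd M" by auto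
    have "fst (M - l *\<^sub>R Lambda Q dtau (U_hat Q M - Us - dtau *\<^sub>R C_hat Q M)) =
        (1 / (W + x)) * ((W + x) * fst M)
        - (1 / (W + x)) * (l * fst (U_hat Q M - Us - dtau *\<^sub>R C_hat Q M))"
      using M1 by (simp add: Lambda_def W_def v_def x_def l_def)
    also have "\<dots> = 1 / (W + x) * fst R"
      unfolding right_diff_distrib[symmetric]
      by (rule arg_cong[where f = "\<lambda>y. 1 / (W + x) * y"])
        (simp add: R_def G_def C_hat_def x_def algebra_simps)
    finally show "fst (M - l *\<^sub>R Lambda Q dtau (U_hat Q M - Us - dtau *\<^sub>R C_hat Q M)) =
        fst (1 / (W + x) * fst R, (1 / (W + k)) *\<^sub>R snd R)" by simp
    have "snd (M - l *\<^sub>R Lambda Q dtau (U_hat Q M - Us - dtau *\<^sub>R C_hat Q M)) =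
        (1 / (W + k)) *\<^sub>R ((W + k) *\<^sub>R snd M)
        - (1 / (W + k)) *\<^sub>R (l *\<^sub>R snd (U_hat Q M - Us - dtau *\<^sub>R C_hat Q M))"
      using M2 by (simp add: Lambda_def W_def v_def k_def l_def)
    also have "\<dots> = (1 / (W + k)) *\<^sub>R snd R"
      unfolding scaleR_right_diff_distrib[symmetric]
      by (rule arg_cong[where f = "\<lambda>y. (1 / (W + k)) *\<^sub>R y"])
        (simp add: R_def G_def C_hat_def k_def algebra_simps)
    finally show "snd (M - l *\<^sub>R Lambda Q dtau (U_hat Q M - Us - dtau *\<^sub>R C_hat Q M)) =
        snd (1 / (W + x) * fst R, (1 / (W + k)) *\<^sub>R snd R)" by simp
  qed
  have "(1 / (W + x) * fst R, (1 / (W + k)) *\<^sub>R snd R) \<in> lag_cone v"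
    using W xk by (intro lag_cone_scale R) (auto intro: frac_le)
  then show ?thesis
    unfolding l_def[symmetric] step using R_pos W xk by (simp add: lag_realizable_iff[OF v])
qed

text \<open>The limit may leave the open set of realizable moments only at the tip \<open>M = 0\<close> of the cone.
  There the collision term is a pure source, so the conserved moments are realizable nonetheless.\<close>

lemma implicit_update_realizable:
  assumes v: "norm (c_vel Q) < 1" and e: "0 < c_eps Q"
    and coll: "0 \<le> chi Q" "chi Q \<le> kappa Q" "0 \<le> J_eq Q"
    and lam: "0 < lam Q" "lam Q \<le> 1 / (1 + norm (c_vel Q))" and dtau: "0 \<le> dtau"
    and upd: "implicit_update Q dtau UEx M U" and closed: "collision_closed Q dtau UEx M"
    and UEx: "eul_realizable UEx"
  shows "eul_realizable U"
proof -
  define v A Us where "v = c_vel Q" and "A = hat_to_cons v" and "Us = inv A UEx"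
  have lim: "richardson Q dtau Us \<longlonglongrightarrow> M" and U1: "U = A (U_hat Q M)"
    and U2: "U = UEx + dtau *\<^sub>R A (C_hat Q M)"
    using upd by (auto simp: implicit_update_def Let_def A_def v_def Us_def)
  have cl: "lag_closed (lag_cl Q) (c_eps Q) v M"
    "\<And>n. lag_closed (lag_cl Q) (c_eps Q) v (richardson Q dtau Us n)"
    using closed by (auto simp: collision_closed_def A_def v_def Us_def)
  have v': "norm v < 1" using v by (simp add: v_def)
  have Us: "lag_realizable v Us" unfolding Us_def A_def by (intro lag_realizable_inverse v' UEx)
  have it: "lag_realizable v (richardson Q dtau Us n)" for n
  proof (induction n)
    case (Suc n)
    then show ?case
      using richardson_step_realizable[OF v e coll lam dtau, of "richardson Q dtau Us n" Us] cl(2) Us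
      by (simp add: v_def Let_def)
  qed (simp add: Us)
  then have "richardson Q dtau Us n \<in> lag_cone v" for n by (simp add: lag_realizable_iff[OF v'])
  then have M: "M \<in> lag_cone v"
    using closed_sequentially[OF closed_lag_cone _ lim] by blast
  show ?thesis
  proof (cases "lag_realizable v M")
    case True
    define f where "f = lag_cl Q (c_eps Q) v M"
    have f: "f \<in> distributions" using lag_closed_eq[OF cl(1) True] by (simp add: f_def)
    have "U_hat Q M = lag_moment (c_eps Q) v f (doppler v)"
      using U_hat_eq[OF cl(1)[unfolded v_def] True[unfolded v_def]] by (simp add: f_def v_def)
    also have "lag_realizable v \<dots>"
      using v' lorentz_pos[OF v']
      by (intro lag_moment_realizable[OF v' e f _ doppler_lower[OF v']] continuous_intros) auto
    finally show ?thesis unfolding U1 A_def by (intro eul_realizable_hat v')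
  next
    case False
    then have "fst M \<le> 0" "norm (unboost v (snd M)) \<le> fst M"
      using M by (auto simp: lag_realizable_iff[OF v'] lag_cone_def)
    moreover from this have "fst M = 0"
      using norm_ge_zero[of "unboost v (snd M)"] by linarith
    ultimately have "fst M = 0" "unboost v (snd M) = 0" by simp_all
    \<comment> \<open>\<open>unboost\<close> is injective: if it vanishes, so does the component
      along \<open>v\<close>, and then \<open>norm_unboost\<close> makes the whole norm 0.\<close>
    then have "fst M = 0" "snd M = 0"
      using inner_unboost[OF v', of "snd M"] norm_unboost[OF v', of "snd M"] by auto
    then have C: "C_hat Q M = (chi Q * J_eq Q, 0)" by (simp add: C_hat_def)
    \<comment> \<open>Here the balance \<open>U2\<close> is used: closure exactness says nothing at
      \<open>M = 0\<close>, hence nothing about \<open>U_hat Q M\<close>.\<close>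
    have "U = A (Us + dtau *\<^sub>R (chi Q * J_eq Q, 0))"
      unfolding U2 C by (simp add: A_def Us_def linear_add[OF linear_hat_to_cons]
          hat_to_cons_inverse(1)[OF v'] flip: linear_scale[OF linear_hat_to_cons])
    moreover have "lag_realizable v (Us + dtau *\<^sub>R (chi Q * J_eq Q, 0))"
      using Us coll dtau
      by (auto simp: lag_realizable_iff[OF v'] add_pos_nonneg intro!: lag_cone_add lag_cone_scaleR lag_cone_fst)
    ultimately show ?thesis unfolding A_def by (simp add: eul_realizable_hat[OF v'])
  qed
qed

subsection \<open>Tensor-product quadrature of the cell average\<close>

text \<open>\<open>lborel\<close> is the image of the product of one-dimensional measures over
  \<open>Basis\<close> under the coordinate map, so the rule for integrals over product measures
  applies.\<close>

lemma lborel_integral_prod: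
  fixes h :: "'a::euclidean_space \<Rightarrow> real \<Rightarrow> real"
  assumes h: "\<And>b. b \<in> Basis \<Longrightarrow> integrable lborel (h b)"
  shows "(LINT x|lborel. (\<Prod>b\<in>Basis. h b (x \<bullet> b))) = (\<Prod>b\<in>Basis. LINT y|lborel. h b y)"
proof -
  interpret product_sigma_finite "\<lambda>_ :: 'a. lborel :: real measure" by standard
  have [measurable]: "h b \<in> borel_measurable borel" if "b \<in> Basis" for b
    using borel_measurable_integrable[OF h[OF that]] by simp
  have "(LINT x|lborel. (\<Prod>b\<in>Basis. h b (x \<bullet> b))) =
      (LINT f|(\<Pi>\<^sub>M b\<in>Basis. lborel). (\<Prod>b\<in>Basis. h b ((\<Sum>b\<in>Basis. f b *\<^sub>R b) \<bullet> b)))"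
    by (subst lborel_eq) (subst integral_distr; simp)
  also have "\<dots> = (LINT f|(\<Pi>\<^sub>M b\<in>Basis. lborel). (\<Prod>b\<in>Basis. h b (f b)))"
    by simp
  also have "\<dots> = (\<Prod>b\<in>Basis. LINT y|lborel. h b y)"
    by (rule product_integral_prod) (auto intro: h)
  finally show ?thesis .
qed

lemma lborel_integral_prod_cart:
  fixes h :: "'n::finite \<Rightarrow> real \<Rightarrow> real"
  assumes "\<And>i. integrable lborel (h i)"
  shows "(LINT z|lborel. (\<Prod>i\<in>UNIV. h i (z $ i))) = (\<Prod>i\<in>UNIV. LINT y|lborel. h i y)"
proof -
  define ax :: "'n \<Rightarrow> real ^ 'n" where "ax i = axis i 1" for i
  define j where "j = inv ax"
  have inj: "inj ax" by (auto simp: inj_on_def ax_def axis_eq_axis)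
  have j: "j (ax i) = i" for i by (simp add: j_def inj)
  have Basis: "(Basis :: (real ^ 'n) set) = range ax" by (auto simp: Basis_vec_def ax_def)
  have "(LINT z|lborel. (\<Prod>b\<in>Basis. h (j b) (z \<bullet> b))) = (\<Prod>b\<in>Basis. LINT y|lborel. h (j b) y)"
    by (rule lborel_integral_prod) (rule assms)
  then show ?thesis
    unfolding Basis by (simp add: prod.reindex[OF inj] j) (simp add: ax_def inner_axis)
qed

text \<open>The indicator of a box is itself a product of interval indicators, so the Lebesgue
  integral factors; the outer steps convert from and to the gauge integral.\<close>

lemma integral_cbox_prod:
  fixes f :: "'n::finite \<Rightarrow> real \<Rightarrow> real" and a b :: "real ^ 'n"
  assumes f: "\<And>i. continuous_on UNIV (f i)"
  shows "integral (cbox a b) (\<lambda>z. \<Prod>i\<in>UNIV. f i (z $ i)) = (\<Prod>i\<in>UNIV. integral {a $ i..b $ i} (f i))"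
proof -
  have "set_integrable lborel (cbox a b) (\<lambda>z. \<Prod>i\<in>UNIV. f i (z $ i))"
    unfolding set_integrable_def
    by (rule borel_integrable_compact)
      (auto intro!: continuous_on_prod continuous_on_compose2[OF f] continuous_on_component continuous_on_id)
  then have "integral (cbox a b) (\<lambda>z. \<Prod>i\<in>UNIV. f i (z $ i)) =
      (LINT z|lborel. indicator (cbox a b) z *\<^sub>R (\<Prod>i\<in>UNIV. f i (z $ i)))"
    by (simp add: set_borel_integral_eq_integral(2)[symmetric] set_lebesgue_integral_def)
  also have "\<dots> = (LINT z|lborel. (\<Prod>i\<in>UNIV. indicator {a $ i..b $ i} (z $ i) *\<^sub>R f i (z $ i)))"
  proof (rule arg_cong[where f = "lebesgue_integral lborel"], rule ext)
    fix z :: "real ^ 'n"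
    have "indicator (cbox a b) z = (\<Prod>i\<in>UNIV. indicator {a $ i..b $ i} (z $ i) :: real)"
      by (auto simp: indicator_def mem_box_cart)
    then show "indicator (cbox a b) z *\<^sub>R (\<Prod>i\<in>UNIV. f i (z $ i)) =
        (\<Prod>i\<in>UNIV. indicator {a $ i..b $ i} (z $ i) *\<^sub>R f i (z $ i))"
      by (simp add: prod.distrib)
  qed
  also have "\<dots> = (\<Prod>i\<in>UNIV. LINT y|lborel. indicator {a $ i..b $ i} y *\<^sub>R f i y)"
    by (intro lborel_integral_prod_cart borel_integrable_compact continuous_on_subset[OF f]
        compact_Icc subset_UNIV)
  also have "\<dots> = (\<Prod>i\<in>UNIV. integral {a $ i..b $ i} (f i))"
  proof (rule prod.cong[OF refl])
    fix i
    have "set_integrable lborel {a $ i..b $ i} (f i)"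
      unfolding set_integrable_def
      by (intro borel_integrable_compact continuous_on_subset[OF f] compact_Icc subset_UNIV)
    then show "(LINT y|lborel. indicator {a $ i..b $ i} y *\<^sub>R f i y) = integral {a $ i..b $ i} (f i)"
      by (simp add: set_borel_integral_eq_integral(2)[symmetric] set_lebesgue_integral_def)
  qed
  finally show ?thesis .
qed

section \<open>Polynomials on a cell, integrated one coordinate at a time\<close>

lemma continuous_line_weight: "continuous_on A (line_weight \<delta>)"
  unfolding line_weight_def by (cases \<delta>) (auto intro!: continuous_intros)

lemma prod_line_weight: "(\<Prod>\<delta>\<in>UNIV. line_weight \<delta> (z $ \<delta>)) = (z $ None)\<^sup>2"
  by (simp add: prod_UNIV_option line_weight_def)

lemma finite_exponents: "finite {\<alpha> :: 'a::finite \<Rightarrow> nat. \<forall>\<delta>. \<alpha> \<delta> \<le> k}"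
proof -
  have "{\<alpha> :: 'a \<Rightarrow> nat. \<forall>\<delta>. \<alpha> \<delta> \<le> k} = (\<Pi>\<^sub>E \<delta>\<in>UNIV. {..k})"
    by (auto simp: PiE_def Pi_def)
  then show ?thesis by (simp add: finite_PiE)
qed

lemma continuous_tensor_poly:
  assumes "tensor_poly k U"
  shows "continuous_on A U"
proof -
  obtain c where "U = (\<lambda>z. \<Sum>\<alpha>\<in>{\<alpha>. \<forall>\<delta>. \<alpha> \<delta> \<le> k}. (\<Prod>\<delta>\<in>UNIV. (z $ \<delta>) ^ \<alpha> \<delta>) *\<^sub>R c \<alpha>)"
    using assms by (auto simp: tensor_poly_def fun_eq_iff)
  then show ?thesis by (auto intro!: continuous_intros)
qed

lemma subst_coord_nth: "subst_coord z \<delta> y $ \<delta>' = (if \<delta>' = \<delta> then y else z $ \<delta>')"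
  by (simp add: subst_coord_def)

lemma continuous_subst_coord: "continuous_on A (subst_coord z \<delta>)"
  unfolding subst_coord_def[abs_def]
proof (intro continuous_on_vec_lambda)
  show "continuous_on A (\<lambda>y. if \<delta>' = \<delta> then y else z $ \<delta>')" for \<delta>'
    by (cases "\<delta>' = \<delta>") (auto intro!: continuous_intros)
qed

lemma cell_map_nth: "cell_map K t $ \<delta> = (lo K $ \<delta> + hi K $ \<delta>) / 2 + width K \<delta> / 2 * t $ \<delta>"
  by (simp add: cell_map_def)

text \<open>With the coefficients as parameters, integrals over some of the coordinates can be
  written termwise. Order of integration then concerns only finite products of numbers.\<close>

locale cell_poly =
  fixes K :: "'d::finite cell" and k :: nat and U :: "'d pt \<Rightarrow> moments" and c :: "('d option \<Rightarrow> nat) \<Rightarrow> moments"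
  assumes U_eq: "\<And>z. U z = (\<Sum>\<alpha>\<in>{\<alpha>. \<forall>\<delta>. \<alpha> \<delta> \<le> k}. (\<Prod>\<delta>\<in>UNIV. (z $ \<delta>) ^ \<alpha> \<delta>) *\<^sub>R c \<alpha>)"
    and cell: "\<And>\<delta>. lo K $ \<delta> < hi K $ \<delta>"
begin

lemma tensor_poly_U: "tensor_poly k U"
  unfolding tensor_poly_def using U_eq by blast

definition line_moment :: "'d option \<Rightarrow> nat \<Rightarrow> real" where
  "line_moment \<delta> n = integral {lo K $ \<delta>..hi K $ \<delta>} (\<lambda>y. line_weight \<delta> y * y ^ n)"

text \<open>The weighted integral over the coordinates in \<open>D\<close>.\<close>

definition partial_integral :: "'d option set \<Rightarrow> 'd pt \<Rightarrow> moments" where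
  "partial_integral D z = (\<Sum>\<alpha>\<in>{\<alpha>. \<forall>\<delta>. \<alpha> \<delta> \<le> k}.
     ((\<Prod>\<delta>\<in>D. line_moment \<delta> (\<alpha> \<delta>)) * (\<Prod>\<delta>\<in>- D. (z $ \<delta>) ^ \<alpha> \<delta>)) *\<^sub>R c \<alpha>)"

lemma partial_integral_empty: "partial_integral {} z = U z"
  by (simp add: partial_integral_def U_eq)

lemma partial_integral_UNIV:
  "integral (cbox (lo K) (hi K)) (\<lambda>z. (z $ None)\<^sup>2 *\<^sub>R U z) = partial_integral UNIV z"
proof -
  have "integral (cbox (lo K) (hi K)) (\<lambda>z. (z $ None)\<^sup>2 *\<^sub>R U z) =
      integral (cbox (lo K) (hi K)) (\<lambda>z. \<Sum>\<alpha>\<in>{\<alpha>. \<forall>\<delta>. \<alpha> \<delta> \<le> k}.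
        (\<Prod>\<delta>\<in>UNIV. line_weight \<delta> (z $ \<delta>) * (z $ \<delta>) ^ \<alpha> \<delta>) *\<^sub>R c \<alpha>)"
    by (simp add: U_eq scaleR_sum_right prod.distrib prod_line_weight)
  also have "\<dots> = (\<Sum>\<alpha>\<in>{\<alpha>. \<forall>\<delta>. \<alpha> \<delta> \<le> k}. (\<Prod>\<delta>\<in>UNIV. line_moment \<delta> (\<alpha> \<delta>)) *\<^sub>R c \<alpha>)"
  proof (intro integral_unique has_integral_sum finite_exponents has_integral_scaleR_left)
    fix \<alpha> :: "'d option \<Rightarrow> nat"
    have cont: "continuous_on UNIV (\<lambda>y. line_weight \<delta> y * y ^ \<alpha> \<delta>)" for \<delta>
      by (intro continuous_intros continuous_line_weight)
    have "(\<lambda>z. \<Prod>\<delta>\<in>UNIV. line_weight \<delta> (z $ \<delta>) * (z $ \<delta>) ^ \<alpha> \<delta>) integrable_on cbox (lo K) (hi K)"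
      by (intro integrable_continuous continuous_on_prod continuous_on_compose2[OF cont]
          continuous_on_component continuous_on_id subset_UNIV)
    from integrable_integral[OF this]
    show "((\<lambda>z. \<Prod>\<delta>\<in>UNIV. line_weight \<delta> (z $ \<delta>) * (z $ \<delta>) ^ \<alpha> \<delta>) has_integral
        (\<Prod>\<delta>\<in>UNIV. line_moment \<delta> (\<alpha> \<delta>))) (cbox (lo K) (hi K))"
      unfolding line_moment_def integral_cbox_prod[OF cont] .
  qed
  finally show ?thesis by (simp add: partial_integral_def)
qed

lemma partial_integral_insert:
  assumes "\<delta> \<notin> D"
  shows "partial_integral (insert \<delta> D) z =
    integral {lo K $ \<delta>..hi K $ \<delta>} (\<lambda>y. line_weight \<delta> y *\<^sub>R partial_integral D (subst_coord z \<delta> y))"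
proof -
  have D: "- D = insert \<delta> (- insert \<delta> D)" using assms by auto
  have "(\<Prod>\<delta>'\<in>- D. (subst_coord z \<delta> y $ \<delta>') ^ \<alpha> \<delta>') =
      y ^ \<alpha> \<delta> * (\<Prod>\<delta>'\<in>- insert \<delta> D. (z $ \<delta>') ^ \<alpha> \<delta>')" for y \<alpha>
  proof -
    have "(\<Prod>\<delta>'\<in>- D. (subst_coord z \<delta> y $ \<delta>') ^ \<alpha> \<delta>') =
        (subst_coord z \<delta> y $ \<delta>) ^ \<alpha> \<delta> * (\<Prod>\<delta>'\<in>- insert \<delta> D. (subst_coord z \<delta> y $ \<delta>') ^ \<alpha> \<delta>')"
      by (subst D, subst prod.insert) auto
    also have "(\<Prod>\<delta>'\<in>- insert \<delta> D. (subst_coord z \<delta> y $ \<delta>') ^ \<alpha> \<delta>') =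
        (\<Prod>\<delta>'\<in>- insert \<delta> D. (z $ \<delta>') ^ \<alpha> \<delta>')"
      by (intro prod.cong refl) (auto simp: subst_coord_nth)
    finally show ?thesis by (simp add: subst_coord_nth)
  qed
  then have eq: "(\<lambda>y. line_weight \<delta> y *\<^sub>R partial_integral D (subst_coord z \<delta> y)) =
      (\<lambda>y. \<Sum>\<alpha>\<in>{\<alpha>. \<forall>\<delta>. \<alpha> \<delta> \<le> k}. (line_weight \<delta> y * y ^ \<alpha> \<delta>) *\<^sub>R
        ((\<Prod>\<delta>\<in>D. line_moment \<delta> (\<alpha> \<delta>)) * (\<Prod>\<delta>'\<in>- insert \<delta> D. (z $ \<delta>') ^ \<alpha> \<delta>')) *\<^sub>R c \<alpha>)"
    by (simp add: partial_integral_def scaleR_sum_right mult.assoc mult.left_commute)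
  have "integral {lo K $ \<delta>..hi K $ \<delta>} (\<lambda>y. line_weight \<delta> y *\<^sub>R partial_integral D (subst_coord z \<delta> y)) =
      (\<Sum>\<alpha>\<in>{\<alpha>. \<forall>\<delta>. \<alpha> \<delta> \<le> k}. line_moment \<delta> (\<alpha> \<delta>) *\<^sub>R
        ((\<Prod>\<delta>\<in>D. line_moment \<delta> (\<alpha> \<delta>)) * (\<Prod>\<delta>'\<in>- insert \<delta> D. (z $ \<delta>') ^ \<alpha> \<delta>')) *\<^sub>R c \<alpha>)"
    unfolding eq
    by (intro integral_unique has_integral_sum finite_exponents has_integral_scaleR_left)
      (auto simp: line_moment_def intro!: integrable_integral integrable_continuous_real
        continuous_intros continuous_line_weight)
  then show ?thesis
    using assms by (simp add: partial_integral_def mult.assoc)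
qed

text \<open>Coordinates outside \<open>D\<close> get the dummy value 1. For
  \<open>D = UNIV - {\<delta>}\<close> this yields exactly the reference nodes of the upper
  \<open>\<delta>\<close>-face, over which the face integrals are summed.\<close>

definition partial_nodes :: "nat \<Rightarrow> 'd option set \<Rightarrow> 'd pt set" where
  "partial_nodes N D = {t. \<forall>\<delta>. if \<delta> \<in> D then t $ \<delta> \<in> lg_nodes N else t $ \<delta> = 1}"

definition node_point :: "'d option set \<Rightarrow> 'd pt \<Rightarrow> 'd pt \<Rightarrow> 'd pt" where
  "node_point D t z = (\<chi> \<delta>. if \<delta> \<in> D then cell_map K t $ \<delta> else z $ \<delta>)"

definition node_weight :: "nat \<Rightarrow> 'd option set \<Rightarrow> 'd pt \<Rightarrow> real" where
  "node_weight N D t =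
     (\<Prod>\<delta>\<in>D. width K \<delta> * lg_weight N (t $ \<delta>) * line_weight \<delta> (cell_map K t $ \<delta>))"

lemma cell_map_bounds:
  assumes "- 1 \<le> t $ \<delta>" "t $ \<delta> \<le> 1"
  shows "lo K $ \<delta> \<le> cell_map K t $ \<delta>" "cell_map K t $ \<delta> \<le> hi K $ \<delta>"
proof -
  have w: "0 \<le> width K \<delta>" using cell[of \<delta>] by (simp add: width_def)
  define p where "p = width K \<delta> * t $ \<delta>"
  have "- width K \<delta> \<le> p" "p \<le> width K \<delta>"
    using mult_left_mono[OF assms(1) w] mult_left_mono[OF assms(2) w] by (simp_all add: p_def)
  moreover have "cell_map K t $ \<delta> = (lo K $ \<delta> + hi K $ \<delta>) / 2 + p / 2"
    by (simp add: cell_map_nth p_def)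
  moreover have "width K \<delta> = hi K $ \<delta> - lo K $ \<delta>" by (simp add: width_def)
  ultimately have "lo K $ \<delta> \<le> cell_map K t $ \<delta> \<and> cell_map K t $ \<delta> \<le> hi K $ \<delta>"
    by (simp add: field_simps)
  then show "lo K $ \<delta> \<le> cell_map K t $ \<delta>" "cell_map K t $ \<delta> \<le> hi K $ \<delta>" by auto
qed

lemma node_point_in_cell:
  assumes "t \<in> partial_nodes N D" "z \<in> cbox (lo K) (hi K)"
  shows "node_point D t z \<in> cbox (lo K) (hi K)"
  unfolding mem_box_cart
proof
  fix \<delta>
  show "lo K $ \<delta> \<le> node_point D t z $ \<delta> \<and> node_point D t z $ \<delta> \<le> hi K $ \<delta>"
  proof (cases "\<delta> \<in> D")
    case True
    then have "t $ \<delta> \<in> lg_nodes N" using assms(1) by (auto simp: partial_nodes_def split: if_splits)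
    from lg_nodes_bounds[OF this] True show ?thesis
      using cell_map_bounds[of t \<delta>] by (simp add: node_point_def)
  next
    case False
    then show ?thesis using assms(2) by (simp add: node_point_def mem_box_cart)
  qed
qed

text \<open>The rule in the new direction is arbitrary: Gauss rules drive the induction over
  coordinates, and a Lobatto rule closes it in the last one. Exactness holds on lines through points
  of the cell, so the nodes are kept there by \<open>node_point_in_cell\<close>.\<close>

lemma quadrature_step:
  assumes \<delta>: "\<delta> \<notin> D" and z: "z \<in> cbox (lo K) (hi K)"
    and rule: "rule_exact S w K \<delta> U"
    and IH: "\<And>z. z \<in> cbox (lo K) (hi K) \<Longrightarrow> partial_integral D z =
      (\<Sum>t\<in>partial_nodes N D. node_weight N D t *\<^sub>R U (node_point D t z))"
  shows "partial_integral (insert \<delta> D) z = (\<Sum>t\<in>partial_nodes N D. node_weight N D t *\<^sub>R width K \<delta> *\<^sub>R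
    (\<Sum>s\<in>S. (w s * line_weight \<delta> (cell_map K (subst_coord t \<delta> s) $ \<delta>)) *\<^sub>R
      U (node_point (insert \<delta> D) (subst_coord t \<delta> s) z)))"
proof -
  have np: "node_point D t (subst_coord z \<delta> y) = subst_coord (node_point D t z) \<delta> y" for t y
    using \<delta> by (auto simp: vec_eq_iff node_point_def subst_coord_nth)
  have np': "subst_coord (node_point D t z) \<delta> ((lo K $ \<delta> + hi K $ \<delta>) / 2 + width K \<delta> / 2 * s) =
      node_point (insert \<delta> D) (subst_coord t \<delta> s) z" for t s
    using \<delta> by (auto simp: vec_eq_iff node_point_def subst_coord_nth cell_map_nth)
  have "partial_integral (insert \<delta> D) z = integral {lo K $ \<delta>..hi K $ \<delta>}
      (\<lambda>y. line_weight \<delta> y *\<^sub>R partial_integral D (subst_coord z \<delta> y))"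
    by (rule partial_integral_insert[OF \<delta>])
  also have "\<dots> = integral {lo K $ \<delta>..hi K $ \<delta>} (\<lambda>y. \<Sum>t\<in>partial_nodes N D. node_weight N D t *\<^sub>R
      (line_weight \<delta> y *\<^sub>R U (subst_coord (node_point D t z) \<delta> y)))"
  proof (rule integral_cong)
    fix y assume "y \<in> {lo K $ \<delta>..hi K $ \<delta>}"
    then have "subst_coord z \<delta> y \<in> cbox (lo K) (hi K)"
      using z by (auto simp: mem_box_cart subst_coord_nth)
    from IH[OF this] show "line_weight \<delta> y *\<^sub>R partial_integral D (subst_coord z \<delta> y) =
        (\<Sum>t\<in>partial_nodes N D. node_weight N D t *\<^sub>R
          (line_weight \<delta> y *\<^sub>R U (subst_coord (node_point D t z) \<delta> y)))"
      by (simp add: np scaleR_sum_right mult.commute)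
  qed
  also have "\<dots> = (\<Sum>t\<in>partial_nodes N D. node_weight N D t *\<^sub>R
      integral {lo K $ \<delta>..hi K $ \<delta>} (\<lambda>y. line_weight \<delta> y *\<^sub>R U (subst_coord (node_point D t z) \<delta> y)))"
  proof (cases "finite (partial_nodes N D)")
    case True
    show ?thesis
      by (intro integral_unique has_integral_sum[OF True] has_integral_cmul integrable_integral
          integrable_continuous_real continuous_on_scaleR continuous_line_weight
          continuous_on_compose2[OF continuous_tensor_poly[OF tensor_poly_U, of UNIV]] continuous_subst_coord
          subset_UNIV)
  qed simp
  also have "\<dots> = (\<Sum>t\<in>partial_nodes N D. node_weight N D t *\<^sub>R width K \<delta> *\<^sub>R
    (\<Sum>s\<in>S. (w s * line_weight \<delta> (cell_map K (subst_coord t \<delta> s) $ \<delta>)) *\<^sub>R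
      U (node_point (insert \<delta> D) (subst_coord t \<delta> s) z)))"
  proof (rule sum.cong[OF refl])
    fix t assume "t \<in> partial_nodes N D"
    note rule[unfolded rule_exact_def Let_def, rule_format, OF node_point_in_cell[OF this z]]
    then show "node_weight N D t *\<^sub>R integral {lo K $ \<delta>..hi K $ \<delta>}
        (\<lambda>y. line_weight \<delta> y *\<^sub>R U (subst_coord (node_point D t z) \<delta> y)) =
      node_weight N D t *\<^sub>R width K \<delta> *\<^sub>R
      (\<Sum>s\<in>S. (w s * line_weight \<delta> (cell_map K (subst_coord t \<delta> s) $ \<delta>)) *\<^sub>R
        U (node_point (insert \<delta> D) (subst_coord t \<delta> s) z))"
      by (simp only: np' cell_map_nth subst_coord_nth simp_thms if_True)
  qed
  finally show ?thesis .
qed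

lemma partial_nodes_insert:
  assumes "\<delta> \<notin> D"
  shows "bij_betw (\<lambda>(t, s). subst_coord t \<delta> s) (partial_nodes N D \<times> lg_nodes N) (partial_nodes N (insert \<delta> D))"
proof (rule bij_betw_byWitness[where f' = "\<lambda>t. (subst_coord t \<delta> 1, t $ \<delta>)"])
  show "\<forall>a\<in>partial_nodes N D \<times> lg_nodes N.
      (\<lambda>t. (subst_coord t \<delta> 1, t $ \<delta>)) ((\<lambda>(t, s). subst_coord t \<delta> s) a) = a"
  proof (clarify, intro conjI)
    fix t s assume t: "t \<in> partial_nodes N D"
    have "t $ \<delta> = 1" using t assms by (auto simp: partial_nodes_def split: if_splits)
    then show "subst_coord (subst_coord t \<delta> s) \<delta> 1 = t"
      by (simp add: vec_eq_iff subst_coord_nth)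
    show "subst_coord t \<delta> s $ \<delta> = s" by (simp add: subst_coord_nth)
  qed
qed (use assms in \<open>auto simp: vec_eq_iff partial_nodes_def subst_coord_nth split: if_splits\<close>)

lemma partial_quadrature:
  assumes "\<And>\<delta>. rule_exact (lg_nodes N) (lg_weight N) K \<delta> U" and "z \<in> cbox (lo K) (hi K)"
  shows "partial_integral D z = (\<Sum>t\<in>partial_nodes N D. node_weight N D t *\<^sub>R U (node_point D t z))"
  using finite[of D] assms(2)
proof (induction D arbitrary: z rule: finite_induct)
  case empty
  have "partial_nodes N {} = {1}" by (auto simp: partial_nodes_def vec_eq_iff)
  then show ?case by (simp add: partial_integral_empty node_weight_def node_point_def)
next
  case (insert \<delta> D)
  have W: "node_weight N D t * width K \<delta> * (lg_weight N s * line_weight \<delta> (cell_map K (subst_coord t \<delta> s) $ \<delta>)) =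
      node_weight N (insert \<delta> D) (subst_coord t \<delta> s)" for t s
  proof -
    have "node_weight N (insert \<delta> D) (subst_coord t \<delta> s) =
        width K \<delta> * lg_weight N s * line_weight \<delta> (cell_map K (subst_coord t \<delta> s) $ \<delta>) *
        (\<Prod>\<delta>'\<in>D. width K \<delta>' * lg_weight N (subst_coord t \<delta> s $ \<delta>') *
          line_weight \<delta>' (cell_map K (subst_coord t \<delta> s) $ \<delta>'))"
      unfolding node_weight_def using insert.hyps by (simp add: subst_coord_nth)
    also have "(\<Prod>\<delta>'\<in>D. width K \<delta>' * lg_weight N (subst_coord t \<delta> s $ \<delta>') *
          line_weight \<delta>' (cell_map K (subst_coord t \<delta> s) $ \<delta>')) = node_weight N D t"
      unfolding node_weight_def using insert.hyps
      by (intro prod.cong refl) (auto simp: subst_coord_nth cell_map_nth)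
    finally show ?thesis by (simp only: mult.commute mult.left_commute mult.assoc)
  qed
  have "partial_integral (insert \<delta> D) z = (\<Sum>t\<in>partial_nodes N D. node_weight N D t *\<^sub>R width K \<delta> *\<^sub>R
    (\<Sum>s\<in>lg_nodes N. (lg_weight N s * line_weight \<delta> (cell_map K (subst_coord t \<delta> s) $ \<delta>)) *\<^sub>R
      U (node_point (insert \<delta> D) (subst_coord t \<delta> s) z)))"
    by (rule quadrature_step[OF insert.hyps(2) insert.prems assms(1) insert.IH])
  also have "\<dots> = (\<Sum>t\<in>partial_nodes N D. \<Sum>s\<in>lg_nodes N.
      node_weight N (insert \<delta> D) (subst_coord t \<delta> s) *\<^sub>R
      U (node_point (insert \<delta> D) (subst_coord t \<delta> s) z))"
    by (simp add: scaleR_sum_right W[symmetric] mult.assoc)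
  also have "\<dots> = (\<Sum>t\<in>partial_nodes N (insert \<delta> D).
      node_weight N (insert \<delta> D) t *\<^sub>R U (node_point (insert \<delta> D) t z))"
    unfolding sum.cartesian_product sum.reindex_bij_betw[OF partial_nodes_insert[OF insert.hyps(2)], symmetric]
    by (simp add: case_prod_unfold)
  finally show ?case .
qed

lemma integral_quadrature:
  assumes lg: "\<And>\<delta>. rule_exact (lg_nodes N) (lg_weight N) K \<delta> U" and rule: "rule_exact S w K \<delta> U"
  shows "integral (cbox (lo K) (hi K)) (\<lambda>z. (z $ None)\<^sup>2 *\<^sub>R U z) =
    (\<Sum>t\<in>face_ref_nodes N \<delta> Hi.
      (\<Prod>\<delta>'\<in>UNIV - {\<delta>}. width K \<delta>' * lg_weight N (t $ \<delta>') * line_weight \<delta>' (cell_map K t $ \<delta>')) *\<^sub>R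
      width K \<delta> *\<^sub>R (\<Sum>s\<in>S. (w s * line_weight \<delta> (cell_map K (subst_coord t \<delta> s) $ \<delta>)) *\<^sub>R
        U (cell_map K (subst_coord t \<delta> s))))"
proof -
  \<comment> \<open>Any point of the cell may serve as base point, since in the end no coordinate is
    left free.\<close>
  have z: "lo K \<in> cbox (lo K) (hi K)" using cell by (auto simp: mem_box_cart less_imp_le)
  have UN: "insert \<delta> (UNIV - {\<delta>}) = UNIV" by auto
  have nodes: "partial_nodes N (UNIV - {\<delta>}) = face_ref_nodes N \<delta> Hi"
    by (auto simp: partial_nodes_def face_ref_nodes_def split: if_splits)
  have pt: "node_point UNIV t z = cell_map K t" for t z
    by (simp add: node_point_def vec_eq_iff)
  have \<delta>: "\<delta> \<notin> UNIV - {\<delta>}" by simp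
  show ?thesis
    using quadrature_step[OF \<delta> z rule partial_quadrature[OF lg]]
    unfolding UN nodes pt node_weight_def partial_integral_UNIV[of "lo K"] .
qed

end

section \<open>Cell volumes and the limiter\<close>

lemma vol_eq:
  assumes "\<And>\<delta>. lo K $ \<delta> < hi K $ \<delta>"
  shows "integral (cbox (lo K) (hi K)) (\<lambda>z. (z $ None)\<^sup>2) = vol K"
proof -
  have "integral (cbox (lo K) (hi K)) (\<lambda>z. \<Prod>\<delta>\<in>UNIV. line_weight \<delta> (z $ \<delta>)) =
      (\<Prod>\<delta>\<in>UNIV. integral {lo K $ \<delta>..hi K $ \<delta>} (line_weight \<delta>))"
    by (rule integral_cbox_prod) (rule continuous_line_weight)
  also have "\<dots> = vol K"
    using less_imp_le[OF assms]
    by (simp add: prod_UNIV_option vol_def line_weight_def[abs_def] width_def)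
  finally show ?thesis by (simp add: prod_line_weight)
qed

lemma vol_pos:
  assumes "\<And>\<delta>. lo K $ \<delta> < hi K $ \<delta>" "0 \<le> lo K $ None"
  shows "0 < vol K"
proof -
  define a b where "a = lo K $ None" and "b = hi K $ None"
  have ab: "0 \<le> a" "a < b" using assms by (simp_all add: a_def b_def)
  have "((\<lambda>e. e\<^sup>2) has_integral b ^ 3 / 3 - a ^ 3 / 3) {a..b}"
    using ab by (intro fundamental_theorem_of_calculus)
      (auto intro!: derivative_eq_intros simp flip: has_real_derivative_iff_has_vector_derivative)
  then have "integral {a..b} (\<lambda>e. e\<^sup>2) = b ^ 3 / 3 - a ^ 3 / 3" by (rule integral_unique)
  moreover have "a ^ 3 < b ^ 3" using ab by (intro power_strict_mono) auto
  moreover have "0 < width K (Some l)" for l using assms(1)[of "Some l"] by (simp add: width_def)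
  then have "0 < (\<Prod>l\<in>UNIV. width K (Some l))" by (intro prod_pos) auto
  ultimately show ?thesis by (simp add: vol_def a_def b_def)
qed

text \<open>The linear part of the limiter. What remains is a constant depending on the cell average
  alone, so the limiter is affine in the point values.\<close>

definition limiter_part :: "real \<Rightarrow> real \<Rightarrow> moments \<Rightarrow> moments" where
  "limiter_part \<theta>1 \<theta>2 U = (\<theta>2 * \<theta>1 * fst U, \<theta>2 *\<^sub>R snd U)"

lemma bounded_linear_limiter_part: "bounded_linear (limiter_part \<theta>1 \<theta>2)"
  unfolding linear_conv_bounded_linear[symmetric] limiter_part_def[abs_def]
  by (rule linearI) (simp_all add: algebra_simps)

lemma limited_eq: "limited \<theta>1 \<theta>2 K U z =
    limiter_part \<theta>1 \<theta>2 (U z) + (cell_avg K U - limiter_part \<theta>1 \<theta>2 (cell_avg K U))"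
  by (rule prod_eqI) (simp_all add: limited_def limiter_part_def algebra_simps)

lemma tensor_poly_limited:
  fixes U :: "'d::finite pt \<Rightarrow> moments"
  assumes "tensor_poly k U"
  shows "tensor_poly k (limited \<theta>1 \<theta>2 K U)"
proof -
  obtain c where U: "\<And>z. U z = (\<Sum>\<alpha>\<in>{\<alpha>. \<forall>\<delta>. \<alpha> \<delta> \<le> k}. (\<Prod>\<delta>\<in>UNIV. (z $ \<delta>) ^ \<alpha> \<delta>) *\<^sub>R c \<alpha>)"
    using assms by (auto simp: tensor_poly_def)
  define d where "d = cell_avg K U - limiter_part \<theta>1 \<theta>2 (cell_avg K U)"
  \<comment> \<open>The constant part goes into the coefficient of the monomial with all exponents
    0.\<close>
  define c' where "c' \<alpha> = limiter_part \<theta>1 \<theta>2 (c \<alpha>) + (if \<alpha> = (\<lambda>_. 0) then d else 0)" for \<alpha>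
  interpret L: bounded_linear "limiter_part \<theta>1 \<theta>2" by (rule bounded_linear_limiter_part)
  have "limited \<theta>1 \<theta>2 K U z = (\<Sum>\<alpha>\<in>{\<alpha>. \<forall>\<delta>. \<alpha> \<delta> \<le> k}. (\<Prod>\<delta>\<in>UNIV. (z $ \<delta>) ^ \<alpha> \<delta>) *\<^sub>R c' \<alpha>)" for z
  proof -
    have "(\<Sum>\<alpha>\<in>{\<alpha>. \<forall>\<delta> :: 'd option. \<alpha> \<delta> \<le> k}. (\<Prod>\<delta>\<in>UNIV. (z $ \<delta>) ^ \<alpha> \<delta>) *\<^sub>R (if \<alpha> = (\<lambda>_. 0) then d else 0)) =
        (\<Sum>\<alpha>\<in>{\<alpha>. \<forall>\<delta> :: 'd option. \<alpha> \<delta> \<le> k}. if \<alpha> = (\<lambda>_. 0) then d else 0)"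
      by (intro sum.cong refl) auto
    also have "\<dots> = d" by (simp add: finite_exponents)
    finally show ?thesis
      by (simp add: c'_def scaleR_add_right sum.distrib limited_eq U L.sum L.scaleR flip: d_def)
  qed
  then show ?thesis unfolding tensor_poly_def by blast
qed

text \<open>Averaging commutes with affine maps, and this affine map fixes the average itself.
  Positivity of \<open>vol K\<close> allows the normalization.\<close>

lemma cell_avg_limited:
  assumes U: "tensor_poly k U" and K: "\<And>\<delta>. lo K $ \<delta> < hi K $ \<delta>" "0 \<le> lo K $ None"
  shows "cell_avg K (limited \<theta>1 \<theta>2 K U) = cell_avg K U"
proof -
  interpret L: bounded_linear "limiter_part \<theta>1 \<theta>2" by (rule bounded_linear_limiter_part)
  define I where "I = integral (cbox (lo K) (hi K)) (\<lambda>z. (z $ None)\<^sup>2 *\<^sub>R U z)"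
  define d where "d = cell_avg K U - limiter_part \<theta>1 \<theta>2 (cell_avg K U)"
  have avg: "cell_avg K U = (1 / vol K) *\<^sub>R I" by (simp add: cell_avg_def I_def)
  have int: "(\<lambda>z. (z $ None)\<^sup>2 *\<^sub>R U z) integrable_on cbox (lo K) (hi K)"
    by (intro integrable_continuous continuous_intros continuous_tensor_poly[OF U])
  have 1: "((\<lambda>z. limiter_part \<theta>1 \<theta>2 ((z $ None)\<^sup>2 *\<^sub>R U z)) has_integral limiter_part \<theta>1 \<theta>2 I) (cbox (lo K) (hi K))"
    using has_integral_linear[OF integrable_integral[OF int] bounded_linear_limiter_part, of \<theta>1 \<theta>2]
    by (simp add: I_def o_def)
  have 2: "((\<lambda>z. (z $ None)\<^sup>2 *\<^sub>R d) has_integral vol K *\<^sub>R d) (cbox (lo K) (hi K))"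
    unfolding vol_eq[OF K(1), symmetric]
    by (intro has_integral_scaleR_left integrable_integral integrable_continuous continuous_intros)
  have "((\<lambda>z. (z $ None)\<^sup>2 *\<^sub>R limited \<theta>1 \<theta>2 K U z) has_integral
      limiter_part \<theta>1 \<theta>2 I + vol K *\<^sub>R d) (cbox (lo K) (hi K))"
    using has_integral_add[OF 1 2] by (simp only: limited_eq d_def[symmetric] L.scaleR scaleR_add_right)
  then have "cell_avg K (limited \<theta>1 \<theta>2 K U) = (1 / vol K) *\<^sub>R (limiter_part \<theta>1 \<theta>2 I + vol K *\<^sub>R d)"
    unfolding cell_avg_def by (simp add: integral_unique)
  also have "\<dots> = limiter_part \<theta>1 \<theta>2 (cell_avg K U) + d"
    using vol_pos[OF K] by (simp add: avg L.scaleR scaleR_add_right)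
  finally show ?thesis by (simp add: d_def)
qed

subsection \<open>The explicit stages\<close>

text \<open>Gives positive energy at interior nodes even in a cell whose lower energy is 0.\<close>

lemma cell_map_greater:
  assumes "lo K $ \<delta> < hi K $ \<delta>" "- 1 < t $ \<delta>"
  shows "lo K $ \<delta> < cell_map K t $ \<delta>"
proof -
  have "cell_map K t $ \<delta> = lo K $ \<delta> + width K \<delta> * (t $ \<delta> + 1) / 2"
    by (simp add: cell_map_nth width_def field_simps)
  moreover have "0 < width K \<delta> * (t $ \<delta> + 1)" using assms by (simp add: width_def)
  ultimately show ?thesis by simp
qed

lemma lgl_nodes_ends: "1 \<in> lgl_nodes M" "- 1 \<in> lgl_nodes M"
  by (auto simp: lgl_nodes_def)

lemma finite_face_ref_nodes: "finite (face_ref_nodes N \<delta> sd :: 'd::finite pt set)"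
proof -
  let ?F = "\<lambda>\<delta>'. if \<delta>' = \<delta> then {1, - 1} else lg_nodes N"
  have "face_ref_nodes N \<delta> sd \<subseteq> vec_lambda ` (\<Pi>\<^sub>E \<delta>'\<in>UNIV. ?F \<delta>')"
  proof
    fix t :: "'d pt" assume "t \<in> face_ref_nodes N \<delta> sd"
    then have "(\<lambda>\<delta>'. t $ \<delta>') \<in> (\<Pi>\<^sub>E \<delta>'\<in>UNIV. ?F \<delta>')"
      by (auto simp: face_ref_nodes_def split: side.splits)
    then have "vec_lambda (\<lambda>\<delta>'. t $ \<delta>') \<in> vec_lambda ` (\<Pi>\<^sub>E \<delta>'\<in>UNIV. ?F \<delta>')" by (rule imageI)
    then show "t \<in> vec_lambda ` (\<Pi>\<^sub>E \<delta>'\<in>UNIV. ?F \<delta>')" by simp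
  qed
  moreover have "finite (\<Pi>\<^sub>E \<delta>'\<in>(UNIV :: 'd option set). ?F \<delta>')"
    by (intro finite_PiE) (auto simp: finite_lg_nodes)
  ultimately show ?thesis by (meson finite_imageI finite_subset)
qed

lemma face_ref_nodes_nonempty:
  assumes "1 \<le> N"
  shows "face_ref_nodes N \<delta> Hi \<noteq> {}"
proof -
  obtain s where "s \<in> lg_nodes N" using lg_nodes_nonempty[OF assms] by auto
  then have "(\<chi> \<delta>'. if \<delta>' = \<delta> then 1 else s) \<in> face_ref_nodes N \<delta> Hi"
    by (simp add: face_ref_nodes_def)
  then show ?thesis by blast
qed

lemma face_ref_nodes_Lo:
  "bij_betw (\<lambda>t. subst_coord t \<delta> (- 1)) (face_ref_nodes N \<delta> Hi) (face_ref_nodes N \<delta> Lo)"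
  by (rule bij_betw_byWitness[where f' = "\<lambda>t. subst_coord t \<delta> 1"])
    (auto simp: vec_eq_iff face_ref_nodes_def subst_coord_nth)

text \<open>Both face integrals are indexed by the nodes of the upper face, so they can be merged
  node by node with the volume quadrature.\<close>

lemma face_quad_Lo: "face_quad N K \<delta> Lo g = (\<Sum>t\<in>face_ref_nodes N \<delta> Hi.
    (\<Prod>\<delta>'\<in>UNIV - {\<delta>}. width K \<delta>' * lg_weight N (t $ \<delta>')) *\<^sub>R g (cell_map K (subst_coord t \<delta> (- 1))))"
  unfolding face_quad_def sum.reindex_bij_betw[OF face_ref_nodes_Lo, symmetric]
proof (rule sum.cong[OF refl])
  fix t
  have "(\<Prod>\<delta>'\<in>UNIV - {\<delta>}. width K \<delta>' * lg_weight N (subst_coord t \<delta> (- 1) $ \<delta>')) =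
      (\<Prod>\<delta>'\<in>UNIV - {\<delta>}. width K \<delta>' * lg_weight N (t $ \<delta>'))"
    by (intro prod.cong refl) (auto simp: subst_coord_nth)
  then show "(\<Prod>\<delta>'\<in>UNIV - {\<delta>}. width K \<delta>' * lg_weight N (subst_coord t \<delta> (- 1) $ \<delta>')) *\<^sub>R
      g (cell_map K (subst_coord t \<delta> (- 1))) =
    (\<Prod>\<delta>'\<in>UNIV - {\<delta>}. width K \<delta>' * lg_weight N (t $ \<delta>')) *\<^sub>R g (cell_map K (subst_coord t \<delta> (- 1)))"
    by simp
qed

lemma subst_node_in_S_lgl:
  assumes "t \<in> face_ref_nodes N \<delta> sd" "s \<in> lgl_nodes (lgl_count Me Mx \<delta>)"
  shows "cell_map K (subst_coord t \<delta> s) \<in> S_lgl N Me Mx \<delta> K"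
  using assms by (auto simp: S_lgl_def face_ref_nodes_def subst_coord_nth intro!: imageI)

lemma S_lgl_S_all: "z \<in> S_lgl N Me Mx \<delta> K \<Longrightarrow> z \<in> S_all N Me Mx K"
  by (auto simp: S_all_def)

lemma subst_coord_same: "t $ \<delta> = s \<Longrightarrow> subst_coord t \<delta> s = t"
  by (simp add: vec_eq_iff subst_coord_nth)

text \<open>The interval ends are Lobatto nodes, so realizability on the point set covers the traces
  entering the numerical fluxes.\<close>

lemma face_node_in_S_all:
  assumes "t \<in> face_ref_nodes N \<delta> sd"
  shows "cell_map K t \<in> S_all N Me Mx K"
proof -
  have "t $ \<delta> \<in> lgl_nodes (lgl_count Me Mx \<delta>)"
    using assms by (cases sd) (auto simp: face_ref_nodes_def lgl_nodes_ends)
  from S_lgl_S_all[OF subst_node_in_S_lgl[OF assms this, of K]] show ?thesis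
    by (simp add: subst_coord_same)
qed

text \<open>One share \<open>1 / n\<close> of the cell average, written with the Lobatto rule in direction \<open>\<delta>\<close>, absorbs the
  two face integrals in that direction. Interior Lobatto nodes in the energy direction make the
  result strictly positive.\<close>

lemma directional_update_cone:
  fixes K :: "'d::finite cell" and U gHi gLo :: "'d pt \<Rightarrow> moments" and N Me Mx :: nat and n \<tau> :: real
  defines "nodes \<equiv> \<lambda>\<delta>. lgl_nodes (lgl_count Me Mx \<delta>)" and "lw \<equiv> \<lambda>\<delta>. lgl_weight (lgl_count Me Mx \<delta>)"
  assumes U: "tensor_poly k U" and K: "\<And>\<delta>. lo K $ \<delta> < hi K $ \<delta>" "0 \<le> lo K $ None"
    and N: "1 \<le> N" and M: "3 \<le> Me" "2 \<le> Mx" and n: "0 < n"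
    and lg: "\<And>\<delta>. rule_exact (lg_nodes N) (lg_weight N) K \<delta> U"
    and lgl: "rule_exact (nodes \<delta>) (lw \<delta>) K \<delta> U"
    and real: "\<And>z. z \<in> S_all N Me Mx K \<Longrightarrow> eul_realizable (U z)"
    and gHi: "\<And>t. t \<in> face_ref_nodes N \<delta> Hi \<Longrightarrow>
      (width K \<delta> * lw \<delta> 1 / n * (cell_map K t $ None)\<^sup>2) *\<^sub>R U (cell_map K t)
        - \<tau> *\<^sub>R gHi (cell_map K t) \<in> moment_cone"
    and gLo: "\<And>t. t \<in> face_ref_nodes N \<delta> Lo \<Longrightarrow>
      (width K \<delta> * lw \<delta> 1 / n * (cell_map K t $ None)\<^sup>2) *\<^sub>R U (cell_map K t)
        + \<tau> *\<^sub>R gLo (cell_map K t) \<in> moment_cone"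
  defines "X \<equiv> (1 / n) *\<^sub>R vol K *\<^sub>R cell_avg K U
    - \<tau> *\<^sub>R (face_quad N K \<delta> Hi gHi - face_quad N K \<delta> Lo gLo)"
  shows "X \<in> moment_cone" and "\<delta> = None \<Longrightarrow> 0 < fst X"
proof -
  obtain c where c: "\<And>z. U z = (\<Sum>\<alpha>\<in>{\<alpha>. \<forall>\<delta>. \<alpha> \<delta> \<le> k}. (\<Prod>\<delta>\<in>UNIV. (z $ \<delta>) ^ \<alpha> \<delta>) *\<^sub>R c \<alpha>)"
    using U by (auto simp: tensor_poly_def)
  interpret cell_poly K k U c by standard (fact c, fact K)
  let ?H = "face_ref_nodes N \<delta> Hi"
  define V where "V t = (\<Prod>\<delta>'\<in>UNIV - {\<delta>}. width K \<delta>' * lg_weight N (t $ \<delta>'))" for t :: "'d pt"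
  define z where "z t s = cell_map K (subst_coord t \<delta> s)" for t s
  define f where "f t s = (lw \<delta> s * (z t s $ None)\<^sup>2) *\<^sub>R U (z t s)" for t s
  \<comment> \<open>\<open>Y t\<close> collects everything on the \<open>\<delta>\<close>-line
    through the face node \<open>t\<close>; the transverse weight \<open>V t\<close> is common to
    the volume rule and both face rules.\<close>
  define Y where "Y t = (width K \<delta> / n) *\<^sub>R (\<Sum>s\<in>nodes \<delta>. f t s)
    - \<tau> *\<^sub>R gHi (z t 1) + \<tau> *\<^sub>R gLo (z t (- 1))" for t
  define R where "R t = (\<Sum>s\<in>nodes \<delta> - {1} - {- 1}. f t s)" for t
  have width: "0 < width K \<delta>'" for \<delta>' using K(1)[of \<delta>'] by (simp add: width_def)
  have M\<delta>: "2 \<le> lgl_count Me Mx \<delta>" using M by (simp add: lgl_count_def split: option.split)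
  have zt1: "z t 1 = cell_map K t" if "t \<in> ?H" for t
    using that by (simp add: z_def face_ref_nodes_def subst_coord_same)
  have V: "0 < V t" if "t \<in> ?H" for t
    unfolding V_def using that width by (intro prod_pos) (auto simp: face_ref_nodes_def lg_weight_pos)
  \<comment> \<open>The energy weight sits in the transverse product if \<open>\<delta>\<close> is
    spatial and in the Lobatto rule otherwise; either way it becomes the factor \<epsilon>^2 at the
    node.\<close>
  have wt: "(\<Prod>\<delta>'\<in>UNIV - {\<delta>}. width K \<delta>' * lg_weight N (t $ \<delta>') * line_weight \<delta>' (cell_map K t $ \<delta>')) *
      (lw \<delta> s * line_weight \<delta> (z t s $ \<delta>)) = V t * (lw \<delta> s * (z t s $ None)\<^sup>2)" for t s
  proof -
    have "(\<Prod>\<delta>'\<in>UNIV - {\<delta>}. line_weight \<delta>' (cell_map K t $ \<delta>')) * line_weight \<delta> (z t s $ \<delta>) =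
        line_weight \<delta> (z t s $ \<delta>) * (\<Prod>\<delta>'\<in>UNIV - {\<delta>}. line_weight \<delta>' (z t s $ \<delta>'))"
      by (subst mult.commute, intro arg_cong2[where f = "(*)"] prod.cong refl)
        (auto simp: z_def cell_map_nth subst_coord_nth)
    also have "\<dots> = (z t s $ None)\<^sup>2"
      unfolding prod_line_weight[symmetric] by (rule prod.remove[symmetric]) auto
    finally show ?thesis unfolding V_def prod.distrib[of _ "line_weight _"] by (simp add: prod.distrib mult_ac)
  qed
  have "vol K *\<^sub>R cell_avg K U = integral (cbox (lo K) (hi K)) (\<lambda>z. (z $ None)\<^sup>2 *\<^sub>R U z)"
    using vol_pos[OF K] by (simp add: cell_avg_def)
  also have "\<dots> = (\<Sum>t\<in>?H. V t *\<^sub>R width K \<delta> *\<^sub>R (\<Sum>s\<in>nodes \<delta>. f t s))"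
    unfolding integral_quadrature[OF lg lgl]
  proof (rule sum.cong[OF refl])
    fix t
    have "(\<Prod>\<delta>'\<in>UNIV - {\<delta>}. width K \<delta>' * lg_weight N (t $ \<delta>') * line_weight \<delta>' (cell_map K t $ \<delta>')) *\<^sub>R
        (lw \<delta> s * line_weight \<delta> (z t s $ \<delta>)) *\<^sub>R U (z t s) = V t *\<^sub>R f t s" for s
      using wt[of t s] by (simp add: f_def)
    then show "(\<Prod>\<delta>'\<in>UNIV - {\<delta>}. width K \<delta>' * lg_weight N (t $ \<delta>') * line_weight \<delta>' (cell_map K t $ \<delta>')) *\<^sub>R
      width K \<delta> *\<^sub>R (\<Sum>s\<in>nodes \<delta>. (lw \<delta> s * line_weight \<delta> (cell_map K (subst_coord t \<delta> s) $ \<delta>)) *\<^sub>R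
        U (cell_map K (subst_coord t \<delta> s))) = V t *\<^sub>R width K \<delta> *\<^sub>R (\<Sum>s\<in>nodes \<delta>. f t s)"
      unfolding z_def[symmetric] scaleR_left_commute[of _ "width K \<delta>"]
      by (simp only: scaleR_sum_right[of _ _ "nodes \<delta>"])
  qed
  finally have avg: "vol K *\<^sub>R cell_avg K U = (\<Sum>t\<in>?H. V t *\<^sub>R width K \<delta> *\<^sub>R (\<Sum>s\<in>nodes \<delta>. f t s))" .
  have fqHi: "face_quad N K \<delta> Hi gHi = (\<Sum>t\<in>?H. V t *\<^sub>R gHi (z t 1))"
    unfolding face_quad_def V_def by (intro sum.cong refl) (simp add: zt1)
  have fqLo: "face_quad N K \<delta> Lo gLo = (\<Sum>t\<in>?H. V t *\<^sub>R gLo (z t (- 1)))"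
    unfolding face_quad_Lo V_def z_def ..
  have XY: "X = (\<Sum>t\<in>?H. V t *\<^sub>R Y t)"
    unfolding X_def avg fqHi fqLo Y_def
    by (simp add: scaleR_sum_right sum_subtractf[symmetric] sum.distrib[symmetric] algebra_simps)
  \<comment> \<open>The two end nodes are split off the Lobatto sum. Their weights agree by
    \<open>lgl_weight_minus_1\<close>, so each face flux meets the same coefficient.\<close>
  have Y: "Y t = ((width K \<delta> * lw \<delta> 1 / n * (z t 1 $ None)\<^sup>2) *\<^sub>R U (z t 1) - \<tau> *\<^sub>R gHi (z t 1))
      + ((width K \<delta> * lw \<delta> 1 / n * (z t (- 1) $ None)\<^sup>2) *\<^sub>R U (z t (- 1)) + \<tau> *\<^sub>R gLo (z t (- 1)))
      + (width K \<delta> / n) *\<^sub>R R t" for t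
  proof -
    have fin: "finite (nodes \<delta>)" unfolding nodes_def by (rule finite_lgl_nodes[OF M\<delta>])
    have "(\<Sum>s\<in>nodes \<delta>. f t s) = f t 1 + (\<Sum>s\<in>nodes \<delta> - {1}. f t s)"
      using fin by (intro sum.remove) (auto simp: nodes_def lgl_nodes_ends)
    also have "(\<Sum>s\<in>nodes \<delta> - {1}. f t s) = f t (- 1) + R t"
      unfolding R_def using fin by (intro sum.remove) (auto simp: nodes_def lgl_nodes_ends)
    finally show ?thesis
      by (simp add: Y_def f_def lw_def lgl_weight_minus_1 scaleR_add_right algebra_simps)
  qed
  have face: "subst_coord t \<delta> (- 1) \<in> face_ref_nodes N \<delta> Lo" if "t \<in> ?H" for t
    using that by (auto simp: face_ref_nodes_def subst_coord_nth)
  have node: "eul_realizable (U (z t s))" if "t \<in> ?H" "s \<in> nodes \<delta>" for t s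
    using that unfolding z_def nodes_def by (intro real S_lgl_S_all[where \<delta> = \<delta>] subst_node_in_S_lgl)
  have f: "f t s \<in> moment_cone" if "t \<in> ?H" "s \<in> nodes \<delta>" for t s
    unfolding f_def using node[OF that]
    by (intro moment_cone_scaleR) (auto simp: eul_realizable_cone lw_def lgl_weight_nonneg)
  have R: "R t \<in> moment_cone" if "t \<in> ?H" for t
    unfolding R_def using f[OF that] by (intro moment_cone_sum) auto
  have ends: "((width K \<delta> * lw \<delta> 1 / n * (z t 1 $ None)\<^sup>2) *\<^sub>R U (z t 1) - \<tau> *\<^sub>R gHi (z t 1))
      + ((width K \<delta> * lw \<delta> 1 / n * (z t (- 1) $ None)\<^sup>2) *\<^sub>R U (z t (- 1)) + \<tau> *\<^sub>R gLo (z t (- 1)))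
    \<in> moment_cone" if "t \<in> ?H" for t
    using gHi[OF that] gLo[OF face[OF that]] unfolding zt1[OF that] z_def[of t "- 1"]
    by (rule moment_cone_add)
  have wn: "0 < width K \<delta> / n" using width n by simp
  have "Y t \<in> moment_cone" if "t \<in> ?H" for t
    unfolding Y using wn by (intro moment_cone_add ends moment_cone_scaleR R that) simp
  then show "X \<in> moment_cone"
    unfolding XY using V by (intro moment_cone_sum moment_cone_scaleR) (auto intro: less_imp_le)
  assume \<delta>: "\<delta> = None"
  obtain s0 where s0: "s0 \<in> lgl_nodes Me" "- 1 < s0" "s0 < 1" "0 < lgl_weight Me s0"
    by (rule lgl_interior_node[OF M(1)])
  have Rpos: "0 < fst (R t)" if t: "t \<in> ?H" for t
  proof -
    have s0': "s0 \<in> nodes \<delta> - {1} - {- 1}" using s0 by (auto simp: nodes_def lgl_count_def \<delta>)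
    have "lo K $ None < z t s0 $ None"
      unfolding z_def using s0(2) by (intro cell_map_greater K) (simp add: subst_coord_nth \<delta>)
    then have "0 < z t s0 $ None" using K(2) by linarith
    then have "0 < fst (f t s0)"
      using node[OF t, of s0] s0' s0(4)
      by (simp add: f_def eul_realizable_cone lw_def lgl_count_def \<delta>)
    also have "fst (f t s0) \<le> (\<Sum>s\<in>nodes \<delta> - {1} - {- 1}. fst (f t s))"
      using s0' M\<delta> moment_cone_fst[OF f[OF t]]
      by (intro member_le_sum) (auto simp: nodes_def finite_lgl_nodes)
    finally show ?thesis by (simp add: R_def fst_sum)
  qed
  have "0 < fst (Y t)" if t: "t \<in> ?H" for t
    using moment_cone_fst[OF ends[OF t]] mult_pos_pos[OF wn Rpos[OF t]] unfolding Y fst_add fst_scaleR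
    by (simp add: fst_diff)
  then show "0 < fst X"
    unfolding XY fst_sum fst_scaleR using V finite_face_ref_nodes[of N \<delta> Hi] face_ref_nodes_nonempty[OF N, of \<delta>]
    by (intro sum_pos) auto
qed

section \<open>Numerical fluxes at one face node\<close>

definition closed_at :: "'d::finite transport \<Rightarrow> 'd pt \<Rightarrow> moments \<Rightarrow> bool" where
  "closed_at P z V \<longleftrightarrow> eul_realizable V \<and> eul_closed (eul_cl P) (z $ None) (vel P (xpart z)) V"

lemma closed_at_eq:
  assumes "closed_at P z V"
  defines "f \<equiv> eul_cl P (z $ None) (vel P (xpart z)) V"
  shows "f \<in> distributions" "V = eul_U (z $ None) (vel P (xpart z)) f"
  using assms by (auto simp: closed_at_def eul_closed_def)

text \<open>After \<open>\<tau> * a\<close> copies of the inner trace are set aside, both traces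
  enter only through \<open>a *\<^sub>R V - F V\<close> at the upper face and
  \<open>a *\<^sub>R V + F V\<close> at the lower one. What remains of the inner trace has
  coefficient \<open>b - \<tau> * a\<close>, nonnegative by the time step bound.\<close>

lemma num_flux_x_cone:
  assumes m: "closed_at P z Um" and p: "closed_at P z Up"
    and e: "0 < z $ None" and v: "norm (vel P (xpart z)) < 1"
    and a: "1 \<le> a_dir P l" and b: "0 \<le> \<tau>" "\<tau> * a_dir P l \<le> b"
  shows "b *\<^sub>R Um - \<tau> *\<^sub>R num_flux_x P l z Um Up \<in> moment_cone"
    and "b *\<^sub>R Up + \<tau> *\<^sub>R num_flux_x P l z Um Up \<in> moment_cone"
proof -
  define a F where "a = a_dir P l"
    and "F V = eul_F (z $ None) (vel P (xpart z)) (eul_cl P (z $ None) (vel P (xpart z)) V) (comp_of P l)" for V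
  have F: "num_flux_x P l z Um Up = (1 / 2) *\<^sub>R (F Um + F Up - a *\<^sub>R (Up - Um))"
    by (simp add: num_flux_x_def Let_def F_def a_def)
  have minus: "a *\<^sub>R V - F V \<in> moment_cone" and plus: "a *\<^sub>R V + F V \<in> moment_cone"
    if "closed_at P z V" for V
    using eul_flux_cone[OF v e closed_at_eq(1)[OF that] a, of "- 1"]
      eul_flux_cone[OF v e closed_at_eq(1)[OF that] a, of 1]
    by (simp_all add: closed_at_eq(2)[OF that, symmetric] F_def a_def)
  have cone: "Um \<in> moment_cone" "Up \<in> moment_cone"
    using m p by (auto simp: closed_at_def eul_realizable_cone)
  have "b *\<^sub>R Um - \<tau> *\<^sub>R num_flux_x P l z Um Up =
      (b - \<tau> * a) *\<^sub>R Um + ((\<tau> / 2) *\<^sub>R (a *\<^sub>R Um - F Um) + (\<tau> / 2) *\<^sub>R (a *\<^sub>R Up - F Up))"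
    unfolding F by (rule prod_eqI) (simp_all add: field_simps vec_eq_iff)
  also have "\<dots> \<in> moment_cone"
    using b by (intro moment_cone_add moment_cone_scaleR minus m p cone) (auto simp: a_def)
  finally show "b *\<^sub>R Um - \<tau> *\<^sub>R num_flux_x P l z Um Up \<in> moment_cone" .
  have "b *\<^sub>R Up + \<tau> *\<^sub>R num_flux_x P l z Um Up =
      (b - \<tau> * a) *\<^sub>R Up + ((\<tau> / 2) *\<^sub>R (a *\<^sub>R Um + F Um) + (\<tau> / 2) *\<^sub>R (a *\<^sub>R Up + F Up))"
    unfolding F by (rule prod_eqI) (simp_all add: field_simps vec_eq_iff)
  also have "\<dots> \<in> moment_cone"
    using b by (intro moment_cone_add moment_cone_scaleR plus m p cone) (auto simp: a_def)
  finally show "b *\<^sub>R Up + \<tau> *\<^sub>R num_flux_x P l z Um Up \<in> moment_cone" .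
qed

text \<open>The splitting is that of the spatial flux, but the dissipation acts on
  \<open>eul_Utilde\<close>. The remainder therefore mixes \<open>V\<close> and its
  \<open>eul_Utilde\<close> moment, and \<open>eul_U_Utilde_cone\<close> puts it in the
  cone.\<close>

lemma num_flux_eps_cone:
  fixes P z
  defines "v \<equiv> vel P (xpart z)" and "a \<equiv> a_eps P (xpart z)"
  assumes m: "closed_at P z Um" and p: "closed_at P z Up"
    and e: "0 < z $ None" and v: "norm v < 1"
    and q: "\<And>w. \<bar>qfac (z $ None) v (ugrad P (xpart z)) w\<bar> \<le> a"
    and b: "0 \<le> b" "0 \<le> \<tau>" "\<tau> * a \<le> b * (lorentz v * (1 - norm v))"
  shows "b *\<^sub>R Um - \<tau> *\<^sub>R num_flux_eps P z Um Up \<in> moment_cone"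
    and "b *\<^sub>R Up + \<tau> *\<^sub>R num_flux_eps P z Um Up \<in> moment_cone"
proof -
  define cl F Ut where "cl = eul_cl P (z $ None) v"
    and "F V = eul_Feps (z $ None) v (ugrad P (xpart z)) (cl V)"
    and "Ut V = eul_Utilde (z $ None) v (cl V)" for V
  have F: "num_flux_eps P z Um Up = (1 / 2) *\<^sub>R (F Um + F Up - a *\<^sub>R (Ut Up - Ut Um))"
    by (simp add: num_flux_eps_def Let_def F_def Ut_def cl_def a_def v_def)
  have f: "cl V \<in> distributions" "V = eul_U (z $ None) v (cl V)" if "closed_at P z V" for V
    using closed_at_eq[OF that] by (simp_all add: cl_def v_def)
  have minus: "a *\<^sub>R Ut V - F V \<in> moment_cone" and plus: "a *\<^sub>R Ut V + F V \<in> moment_cone"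
    and vol: "b *\<^sub>R V - (\<tau> * a) *\<^sub>R Ut V \<in> moment_cone"
    if V: "closed_at P z V" for V
    using eul_eps_flux_cone[OF v e f(1)[OF V] q, of "- 1"] eul_eps_flux_cone[OF v e f(1)[OF V] q, of 1]
      eul_U_Utilde_cone[OF v e f(1)[OF V] b(1,3)]
    by (simp_all add: f(2)[OF V, symmetric] F_def Ut_def)
  have "b *\<^sub>R Um - \<tau> *\<^sub>R num_flux_eps P z Um Up = (b *\<^sub>R Um - (\<tau> * a) *\<^sub>R Ut Um)
      + ((\<tau> / 2) *\<^sub>R (a *\<^sub>R Ut Um - F Um) + (\<tau> / 2) *\<^sub>R (a *\<^sub>R Ut Up - F Up))"
    unfolding F by (rule prod_eqI) (simp_all add: field_simps vec_eq_iff)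
  also have "\<dots> \<in> moment_cone"
    using b by (intro moment_cone_add moment_cone_scaleR minus vol m p) auto
  finally show "b *\<^sub>R Um - \<tau> *\<^sub>R num_flux_eps P z Um Up \<in> moment_cone" .
  have "b *\<^sub>R Up + \<tau> *\<^sub>R num_flux_eps P z Um Up = (b *\<^sub>R Up - (\<tau> * a) *\<^sub>R Ut Up)
      + ((\<tau> / 2) *\<^sub>R (a *\<^sub>R Ut Um + F Um) + (\<tau> / 2) *\<^sub>R (a *\<^sub>R Ut Up + F Up))"
    unfolding F by (rule prod_eqI) (simp_all add: field_simps vec_eq_iff)
  also have "\<dots> \<in> moment_cone"
    using b by (intro moment_cone_add moment_cone_scaleR plus vol m p) auto
  finally show "b *\<^sub>R Up + \<tau> *\<^sub>R num_flux_eps P z Um Up \<in> moment_cone" .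
qed

section \<open>Mesh geometry\<close>

lemma mesh_cell:
  assumes "mesh \<Omega>e \<Omega>x \<T>" "K \<in> \<T>"
  shows "lo K $ \<delta> < hi K $ \<delta>" "0 \<le> lo K $ None"
  using assms by (auto simp: mesh_def)

text \<open>Face nodes may lie on the boundary of the domain. The projection to space is continuous,
  so it carries the closure of phase space into the closure of \<open>\<Omega>x\<close>, where
  velocity and wave speed bounds hold.\<close>

lemma mesh_closure:
  assumes "mesh \<Omega>e \<Omega>x \<T>" "K \<in> \<T>" "z \<in> cbox (lo K) (hi K)"
  shows "xpart z \<in> closure \<Omega>x"
proof -
  have "(\<lambda>K. cbox (lo K) (hi K)) ` \<T> division_of closure (phase_space \<Omega>e \<Omega>x)"
    using assms(1) by (simp add: mesh_def)
  from division_ofD(6)[OF this] assms(2,3) have z: "z \<in> closure (phase_space \<Omega>e \<Omega>x)"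
    by blast
  have "continuous_on (closure (phase_space \<Omega>e \<Omega>x)) xpart"
    unfolding xpart_def[abs_def] by (intro continuous_intros)
  then have "xpart ` closure (phase_space \<Omega>e \<Omega>x) \<subseteq> closure \<Omega>x"
    by (rule image_closure_subset) (auto simp: phase_space_def intro: closure_subset[THEN subsetD])
  with z show ?thesis by blast
qed

text \<open>Neighbours share a whole face, so switching the reference coordinate between 1 and -1
  gives the same physical point. The neighbour's trace is thus evaluated in the neighbour's own
  point set.\<close>

lemma neighbour_face_node:
  assumes "neighbour \<delta> sd K K'" "t \<in> face_ref_nodes N \<delta> sd"
  obtains sd' t' where "t' \<in> face_ref_nodes N \<delta> sd'" "cell_map K' t' = cell_map K t"
proof (cases sd)
  case Hi
  show thesis
  proof (rule that)
    show "subst_coord t \<delta> (- 1) \<in> face_ref_nodes N \<delta> Lo"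
      using assms(2) by (simp add: face_ref_nodes_def subst_coord_nth)
    show "cell_map K' (subst_coord t \<delta> (- 1)) = cell_map K t"
      using assms Hi by (auto simp: vec_eq_iff cell_map_nth subst_coord_nth neighbour_def adjacent_def
          face_ref_nodes_def width_def field_simps)
  qed
next
  case Lo
  show thesis
  proof (rule that)
    show "subst_coord t \<delta> 1 \<in> face_ref_nodes N \<delta> Hi"
      using assms(2) by (simp add: face_ref_nodes_def subst_coord_nth)
    show "cell_map K' (subst_coord t \<delta> 1) = cell_map K t"
      using assms Lo by (auto simp: vec_eq_iff cell_map_nth subst_coord_nth neighbour_def adjacent_def
          face_ref_nodes_def width_def field_simps)
  qed
qed

text \<open>Here \<open>\<tau>\<close> stands for \<open>ch i j * dt\<close>. The time step bounds
  are in product form, which stays meaningful when a coefficient or the energy wave speed vanishes.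
  \<open>CARD('d option)\<close> is the number d + 1 of equal shares.\<close>

lemma forward_euler_realizable:
  fixes \<T> :: "'d::finite cell set" and P :: "'d transport" and U :: "'d cell \<Rightarrow> 'd pt \<Rightarrow> moments"
    and \<tau> :: real
  assumes mesh: "mesh \<Omega>e \<Omega>x \<T>"
    and velocity: "\<And>x. x \<in> closure \<Omega>x \<Longrightarrow> norm (vel P x) < 1"
    and N: "1 \<le> N" and M: "3 \<le> Me" "2 \<le> Mx"
    and poly: "tensor_poly k (U K)"
    and real: "\<And>K z. K \<in> \<T> \<Longrightarrow> z \<in> S_all N Me Mx K \<Longrightarrow> eul_realizable (U K z)"
    and closed: "\<And>K z. K \<in> \<T> \<Longrightarrow> z \<in> S_all N Me Mx K \<Longrightarrow> 0 < z $ None \<Longrightarrow>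
      eul_closed (eul_cl P) (z $ None) (vel P (xpart z)) (U K z)"
    and bdry: "\<And>\<delta> sd z. \<not> (\<exists>K'\<in>\<T>. neighbour \<delta> sd K K') \<Longrightarrow>
      z \<in> cell_map K ` face_ref_nodes N \<delta> sd \<Longrightarrow> eul_realizable (B K \<delta> sd z)"
    and bdry_closed: "\<And>\<delta> sd z. \<not> (\<exists>K'\<in>\<T>. neighbour \<delta> sd K K') \<Longrightarrow>
      z \<in> cell_map K ` face_ref_nodes N \<delta> sd \<Longrightarrow> 0 < z $ None \<Longrightarrow>
      eul_closed (eul_cl P) (z $ None) (vel P (xpart z)) (B K \<delta> sd z)"
    and lg: "\<And>\<delta>. rule_exact (lg_nodes N) (lg_weight N) K \<delta> (U K)"
    and lgl: "\<And>\<delta>. rule_exact (lgl_nodes (lgl_count Me Mx \<delta>)) (lgl_weight (lgl_count Me Mx \<delta>)) K \<delta> (U K)"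
    and wave_eps: "\<And>x e w. x \<in> closure \<Omega>x \<Longrightarrow> 0 < e \<Longrightarrow>
      \<bar>qfac e (vel P x) (ugrad P x) w\<bar> \<le> a_eps P x"
    and wave_x: "\<And>l. 1 \<le> a_dir P l"
    and \<tau>: "0 \<le> \<tau>"
    and cfl_eps: "\<And>x. x \<in> cbox (xpart (lo K)) (xpart (hi K)) \<Longrightarrow> \<tau> * hi K $ None * a_eps P x \<le>
      width K None * lgl_weight Me 1 / real CARD('d option) * (lorentz (vel P x) * (1 - norm (vel P x)))"
    and cfl_x: "\<And>l. \<tau> * a_dir P l \<le> width K (Some l) * lgl_weight Mx 1 / real CARD('d option)"
    and K: "K \<in> \<T>"
  shows "eul_realizable (cell_avg K (U K) + \<tau> *\<^sub>R transport_op P N \<T> B U K)"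
proof -
  define n where "n = real CARD('d option)"
  have n: "0 < n" by (simp add: n_def)
  \<comment> \<open>One family indexed by \<open>'d option\<close> lets energy and space be summed
    as d + 1 directions of the same kind.\<close>
  define g where "g \<delta> sd z = (case \<delta> of
      None \<Rightarrow> (z $ None) ^ 3 *\<^sub>R num_flux_eps P z (trace_minus \<T> B U K None sd z) (trace_plus \<T> B U K None sd z)
    | Some l \<Rightarrow> (z $ None)\<^sup>2 *\<^sub>R num_flux_x P l z (trace_minus \<T> B U K (Some l) sd z) (trace_plus \<T> B U K (Some l) sd z))"
    for \<delta> sd z
  define I where "I \<delta> = face_quad N K \<delta> Hi (g \<delta> Hi) - face_quad N K \<delta> Lo (g \<delta> Lo)" for \<delta>
  define X where "X \<delta> = (1 / n) *\<^sub>R vol K *\<^sub>R cell_avg K (U K) - \<tau> *\<^sub>R I \<delta>" for \<delta>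
  note cell = mesh_cell[OF mesh K]
  have vol: "0 < vol K" by (rule vol_pos[OF cell])
  have width: "0 < width K \<delta>" for \<delta> using cell(1)[of \<delta>] by (simp add: width_def)
  obtain c where c: "\<And>z. U K z = (\<Sum>\<alpha>\<in>{\<alpha>. \<forall>\<delta>. \<alpha> \<delta> \<le> k}. (\<Prod>\<delta>\<in>UNIV. (z $ \<delta>) ^ \<alpha> \<delta>) *\<^sub>R c \<alpha>)"
    using poly by (auto simp: tensor_poly_def)
  interpret poly_K: cell_poly K k "U K" c by standard (fact c, fact cell(1))
  have in_cell: "cell_map K t \<in> cbox (lo K) (hi K)" if t: "t \<in> face_ref_nodes N \<delta> sd" for t \<delta> sd
  proof -
    have "- 1 \<le> t $ \<delta>' \<and> t $ \<delta>' \<le> 1" for \<delta>'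
      using t lg_nodes_bounds[of "t $ \<delta>'" N]
      by (cases "\<delta>' = \<delta>") (auto simp: face_ref_nodes_def less_imp_le split: side.splits)
    then show ?thesis using poly_K.cell_map_bounds[of t] by (simp add: mem_box_cart)
  qed
  have x_cell: "xpart (cell_map K t) \<in> cbox (xpart (lo K)) (xpart (hi K))"
    if "t \<in> face_ref_nodes N \<delta> sd" for t \<delta> sd
    using in_cell[OF that] by (simp add: mem_box_cart xpart_def)
  have x_closure: "xpart (cell_map K t) \<in> closure \<Omega>x" if "t \<in> face_ref_nodes N \<delta> sd" for t \<delta> sd
    by (rule mesh_closure[OF mesh K in_cell[OF that]])
  have inner: "closed_at P (cell_map K t) (U K (cell_map K t))"
    if "t \<in> face_ref_nodes N \<delta> sd" "0 < cell_map K t $ None" for t \<delta> sd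
    using real[OF K face_node_in_S_all[OF that(1)]] closed[OF K face_node_in_S_all[OF that(1)] that(2)]
    by (simp add: closed_at_def)
  have ext: "closed_at P (cell_map K t) (ext_trace \<T> B U K \<delta> sd (cell_map K t))"
    if t: "t \<in> face_ref_nodes N \<delta> sd" and pos: "0 < cell_map K t $ None" for t \<delta> sd
  proof (cases "\<exists>K'\<in>\<T>. neighbour \<delta> sd K K'")
    case True
    define K' where "K' = (SOME K'. K' \<in> \<T> \<and> neighbour \<delta> sd K K')"
    have K': "K' \<in> \<T>" "neighbour \<delta> sd K K'"
      using someI_ex[of "\<lambda>K'. K' \<in> \<T> \<and> neighbour \<delta> sd K K'"] True unfolding K'_def by blast+
    obtain sd' t' where t': "t' \<in> face_ref_nodes N \<delta> sd'" "cell_map K' t' = cell_map K t"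
      by (rule neighbour_face_node[OF K'(2) t])
    have "cell_map K t \<in> S_all N Me Mx K'"
      using face_node_in_S_all[OF t'(1), of K'] by (simp add: t'(2))
    with real[OF K'(1)] closed[OF K'(1) _ pos] True show ?thesis
      by (simp add: closed_at_def ext_trace_def K'_def[symmetric])
  next
    case False
    with bdry[OF False imageI[OF t]] bdry_closed[OF False imageI[OF t] pos] show ?thesis
      by (simp add: closed_at_def ext_trace_def)
  qed
  have pos_x: "0 < cell_map K t $ None" if "t \<in> face_ref_nodes N (Some l) sd" for t l sd
  proof -
    have "- 1 < t $ None" using that lg_nodes_bounds[of "t $ None" N] by (simp add: face_ref_nodes_def)
    from cell_map_greater[OF cell(1) this] cell(2) show ?thesis by linarith
  qed
  have X: "X \<delta> \<in> moment_cone \<and> (\<delta> = None \<longrightarrow> 0 < fst (X \<delta>))" for \<delta>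
  proof (cases \<delta>)
    case (Some l)
    define b where "b = width K \<delta> * lgl_weight (lgl_count Me Mx \<delta>) 1 / n"
    have b: "\<tau> * a_dir P l \<le> b" using cfl_x[of l] by (simp add: b_def n_def Some lgl_count_def)
    have Hi: "(b * (cell_map K t $ None)\<^sup>2) *\<^sub>R U K (cell_map K t) - \<tau> *\<^sub>R g \<delta> Hi (cell_map K t) \<in> moment_cone"
      if t: "t \<in> face_ref_nodes N \<delta> Hi" for t
    proof -
      define z where "z = cell_map K t"
      have z: "0 < z $ None" using pos_x t by (auto simp: Some z_def)
      have "b *\<^sub>R U K z - \<tau> *\<^sub>R num_flux_x P l z (U K z) (ext_trace \<T> B U K \<delta> Hi z) \<in> moment_cone"
        using num_flux_x_cone(1)[OF inner[OF t] ext[OF t] _ velocity[OF x_closure[OF t]] wave_x \<tau> b] z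
        by (simp add: z_def)
      from moment_cone_scaleR[OF _ this, of "(z $ None)\<^sup>2"] show ?thesis
        by (simp add: g_def Some trace_minus_def trace_plus_def z_def[symmetric] algebra_simps)
    qed
    have Lo: "(b * (cell_map K t $ None)\<^sup>2) *\<^sub>R U K (cell_map K t) + \<tau> *\<^sub>R g \<delta> Lo (cell_map K t) \<in> moment_cone"
      if t: "t \<in> face_ref_nodes N \<delta> Lo" for t
    proof -
      define z where "z = cell_map K t"
      have z: "0 < z $ None" using pos_x t by (auto simp: Some z_def)
      have "b *\<^sub>R U K z + \<tau> *\<^sub>R num_flux_x P l z (ext_trace \<T> B U K \<delta> Lo z) (U K z) \<in> moment_cone"
        using num_flux_x_cone(2)[OF ext[OF t] inner[OF t] _ velocity[OF x_closure[OF t]] wave_x \<tau> b] z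
        by (simp add: z_def)
      from moment_cone_scaleR[OF _ this, of "(z $ None)\<^sup>2"] show ?thesis
        by (simp add: g_def Some trace_minus_def trace_plus_def z_def[symmetric] algebra_simps)
    qed
    show ?thesis
      using directional_update_cone(1)[OF poly cell N M n lg lgl real[OF K] Hi[unfolded b_def] Lo[unfolded b_def]]
      by (simp add: X_def I_def Some b_def)
  next
    case None
    define b where "b = width K \<delta> * lgl_weight (lgl_count Me Mx \<delta>) 1 / n"
    have b: "0 \<le> b" using width[of \<delta>] n by (simp add: b_def lgl_weight_nonneg)
    \<comment> \<open>Of the factor \<epsilon>^3 in the energy flux, \<epsilon>^2 matches the volume
      weight and one \<epsilon> joins \<open>\<tau>\<close>. It is at most the upper energy of the
      cell, which is why that energy appears in the time step bound.\<close>
    have cfl: "\<tau> * z $ None * a_eps P (xpart z) \<le>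
        b * (lorentz (vel P (xpart z)) * (1 - norm (vel P (xpart z))))"
      if z: "z = cell_map K t" and t: "t \<in> face_ref_nodes N \<delta> sd" for z t sd
    proof -
      have "0 \<le> a_eps P (xpart z)"
        unfolding z by (rule order_trans[OF abs_ge_zero wave_eps[OF x_closure[OF t] zero_less_one]])
      moreover have "z $ None \<le> hi K $ None"
        using in_cell[OF t] by (simp add: z mem_box_cart)
      ultimately have "\<tau> * z $ None * a_eps P (xpart z) \<le> \<tau> * hi K $ None * a_eps P (xpart z)"
        using \<tau> by (intro mult_right_mono mult_left_mono)
      also have "\<dots> \<le> b * (lorentz (vel P (xpart z)) * (1 - norm (vel P (xpart z))))"
        using cfl_eps[OF x_cell[OF t]] by (simp add: b_def n_def z None lgl_count_def)
      finally show ?thesis .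
    qed
    have Hi: "(b * (cell_map K t $ None)\<^sup>2) *\<^sub>R U K (cell_map K t) - \<tau> *\<^sub>R g \<delta> Hi (cell_map K t) \<in> moment_cone"
      if t: "t \<in> face_ref_nodes N \<delta> Hi" for t
    proof -
      define z where "z = cell_map K t"
      have z: "0 < z $ None"
        using cell_map_greater[OF cell(1), of t None] cell(2) t by (auto simp: z_def None face_ref_nodes_def)
      have "b *\<^sub>R U K z - (\<tau> * z $ None) *\<^sub>R num_flux_eps P z (U K z) (ext_trace \<T> B U K \<delta> Hi z) \<in> moment_cone"
        using num_flux_eps_cone(1)[OF inner[OF t] ext[OF t] _ velocity[OF x_closure[OF t]]
            wave_eps[OF x_closure[OF t]] b _ cfl[OF refl t]] z \<tau>
        by (simp add: z_def)
      from moment_cone_scaleR[OF _ this, of "(z $ None)\<^sup>2"] show ?thesis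
        by (simp add: g_def None trace_minus_def trace_plus_def z_def[symmetric] algebra_simps
            power2_eq_square power3_eq_cube)
    qed
    have Lo: "(b * (cell_map K t $ None)\<^sup>2) *\<^sub>R U K (cell_map K t) + \<tau> *\<^sub>R g \<delta> Lo (cell_map K t) \<in> moment_cone"
      if t: "t \<in> face_ref_nodes N \<delta> Lo" for t
    \<comment> \<open>At zero energy both terms vanish through their powers of \<epsilon>. This case
      is separate because the closure is assumed exact at positive energies only.\<close>
    proof (cases "cell_map K t $ None = 0")
      case True
      then show ?thesis by (simp add: g_def None)
    next
      case False
      define z where "z = cell_map K t"
      have "lo K $ None \<le> z $ None" using in_cell[OF t] by (simp add: mem_box_cart z_def)
      with False cell(2) have z: "0 < z $ None" by (simp add: z_def)
      have "b *\<^sub>R U K z + (\<tau> * z $ None) *\<^sub>R num_flux_eps P z (ext_trace \<T> B U K \<delta> Lo z) (U K z) \<in> moment_cone"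
        using num_flux_eps_cone(2)[OF ext[OF t] inner[OF t] _ velocity[OF x_closure[OF t]]
            wave_eps[OF x_closure[OF t]] b _ cfl[OF refl t]] z \<tau>
        by (simp add: z_def)
      from moment_cone_scaleR[OF _ this, of "(z $ None)\<^sup>2"] show ?thesis
        by (simp add: g_def None trace_minus_def trace_plus_def z_def[symmetric] algebra_simps
            power2_eq_square power3_eq_cube)
    qed
    show ?thesis
      using directional_update_cone[OF poly cell N M n lg lgl real[OF K] Hi[unfolded b_def] Lo[unfolded b_def]]
      by (simp add: X_def I_def None b_def)
  qed
  have "g None sd = (\<lambda>z. (z $ None) ^ 3 *\<^sub>R num_flux_eps P z
      (trace_minus \<T> B U K None sd z) (trace_plus \<T> B U K None sd z))"
    and "g (Some l) sd = (\<lambda>z. (z $ None)\<^sup>2 *\<^sub>R num_flux_x P l z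
      (trace_minus \<T> B U K (Some l) sd z) (trace_plus \<T> B U K (Some l) sd z))" for sd l
    by (simp_all add: g_def fun_eq_iff)
  then have T: "transport_op P N \<T> B U K = - ((1 / vol K) *\<^sub>R (\<Sum>\<delta>\<in>UNIV. I \<delta>))"
    by (simp add: transport_op_def Let_def sum_UNIV_option I_def scaleR_add_right scaleR_sum_right)
  have "(\<Sum>\<delta>\<in>UNIV. X \<delta>) = vol K *\<^sub>R cell_avg K (U K) - \<tau> *\<^sub>R (\<Sum>\<delta>\<in>UNIV. I \<delta>)"
    using n unfolding X_def sum_subtractf scaleR_sum_right[symmetric] sum_constant_scaleR
    by (simp add: n_def)
  then have "cell_avg K (U K) + \<tau> *\<^sub>R transport_op P N \<T> B U K = (1 / vol K) *\<^sub>R (\<Sum>\<delta>\<in>UNIV. X \<delta>)"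
    using vol by (simp add: T scaleR_diff_right)
  moreover have "(\<Sum>\<delta>\<in>UNIV. X \<delta>) \<in> moment_cone" using X by (intro moment_cone_sum) blast
  moreover have "0 < fst (\<Sum>\<delta>\<in>UNIV. X \<delta>)"
    unfolding sum_UNIV_option fst_add fst_sum
    using X moment_cone_fst by (intro add_pos_nonneg sum_nonneg) auto
  ultimately show ?thesis
    using vol by (simp add: moment_cone_scaleR eul_realizable_cone)
qed

section \<open>Convex combinations and the induction over the stages\<close>

lemma eul_realizable_convex_sum:
  assumes "finite A" "\<And>j. j \<in> A \<Longrightarrow> 0 \<le> c j" "(\<Sum>j\<in>A. c j) = 1" "\<And>j. j \<in> A \<Longrightarrow> eul_realizable (V j)"
  shows "eul_realizable (\<Sum>j\<in>A. c j *\<^sub>R V j)"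
proof -
  have V: "V j \<in> moment_cone" "0 < fst (V j)" if "j \<in> A" for j
    using assms(4)[OF that] by (auto simp: eul_realizable_cone)
  have "(\<Sum>j\<in>A. c j *\<^sub>R V j) \<in> moment_cone"
    using assms(2) V by (intro moment_cone_sum moment_cone_scaleR) auto
  \<comment> \<open>Coefficients with sum 1 cannot all vanish; a single nonzero one carries strict
    positivity.\<close>
  moreover obtain i where i: "i \<in> A" "c i \<noteq> 0"
    using assms(3) by (metis sum.neutral zero_neq_one)
  have "0 < fst (\<Sum>j\<in>A. c j *\<^sub>R V j)"
    unfolding fst_sum fst_scaleR real_scaleR_def
    using i assms(2)[OF i(1)] V assms(1,2) by (intro sum_pos2[of A i]) (auto simp: less_le)
  ultimately show ?thesis by (simp add: eul_realizable_cone)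
qed

theorem theorem7:
  fixes \<Omega>e :: "real set" and \<Omega>x :: "(real ^ 'd::finite) set" and \<T> :: "'d cell set"
    and P :: "'d transport" and Q :: "'d cell \<Rightarrow> collision"
    and k N Me Mx s :: nat and dt :: real
    and c ch :: "nat \<Rightarrow> nat \<Rightarrow> real" and a :: "nat \<Rightarrow> real"
    and B :: "nat \<Rightarrow> 'd cell \<Rightarrow> 'd option \<Rightarrow> side \<Rightarrow> 'd pt \<Rightarrow> moments"
    and U0 Unext :: "'d cell \<Rightarrow> 'd pt \<Rightarrow> moments"
    and Upre Uh :: "nat \<Rightarrow> 'd cell \<Rightarrow> 'd pt \<Rightarrow> moments"
    and Mlim :: "nat \<Rightarrow> 'd cell \<Rightarrow> moments"
  assumes mesh: "mesh \<Omega>e \<Omega>x \<T>"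
    and axes: "inj (comp_of P)"
    and velocity: "\<And>x. x \<in> closure \<Omega>x \<Longrightarrow> norm (vel P x) < 1"
    and quadrature: "N \<ge> 1" "real Me \<ge> (real k + 5) / 2" "real Mx \<ge> (real k + 3) / 2"
    (* IMEX coefficients *)
    and stages: "s \<ge> 1" "dt > 0"
    and c_nonneg: "\<And>i j. 1 \<le> i \<Longrightarrow> i \<le> s \<Longrightarrow> j < i \<Longrightarrow> 0 \<le> c i j \<and> 0 \<le> ch i j"
    and c_sum: "\<And>i. 1 \<le> i \<Longrightarrow> i \<le> s \<Longrightarrow> (\<Sum>j<i. c i j) = 1"
    and a_nonneg: "\<And>i. 1 \<le> i \<Longrightarrow> i \<le> s \<Longrightarrow> 0 \<le> a i"
    (* collision solver *)
    and collision: "\<And>K. K \<in> \<T> \<Longrightarrow> norm (c_vel (Q K)) < 1 \<and> 0 < c_eps (Q K) \<and>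
        0 \<le> chi (Q K) \<and> chi (Q K) \<le> kappa (Q K) \<and> 0 \<le> J_eq (Q K)"
    and lambda: "\<And>K. K \<in> \<T> \<Longrightarrow> 0 < lam (Q K) \<and> lam (Q K) \<le> 1 / (1 + norm (c_vel (Q K)))"
    (* initial stage *)
    and init: "\<And>K. K \<in> \<T> \<Longrightarrow> Uh 0 K = U0 K"
    and init_poly: "\<And>K. K \<in> \<T> \<Longrightarrow> tensor_poly k (U0 K)"
    and init_realizable:
      "\<And>K z. K \<in> \<T> \<Longrightarrow> z \<in> S_all N Me Mx K \<Longrightarrow> eul_realizable (Uh 0 K z)"
    (* stages, before and after the limiter *)
    and stage_poly: "\<And>i K. 1 \<le> i \<Longrightarrow> i \<le> s \<Longrightarrow> K \<in> \<T> \<Longrightarrow> tensor_poly k (Upre i K)"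
    and stage_avg: "\<And>i K. 1 \<le> i \<Longrightarrow> i \<le> s \<Longrightarrow> K \<in> \<T> \<Longrightarrow>
        implicit_update (Q K) (a i * dt) (U_expl P N \<T> B c ch dt Uh i K) (Mlim i K)
          (cell_avg K (Upre i K))"
    and limiter: "\<And>i K. 1 \<le> i \<Longrightarrow> i \<le> s \<Longrightarrow> K \<in> \<T> \<Longrightarrow>
        eul_realizable (cell_avg K (Upre i K)) \<Longrightarrow>
        (\<exists>\<theta>1\<in>{0..1}. \<exists>\<theta>2\<in>{0..1}. Uh i K = limited \<theta>1 \<theta>2 K (Upre i K)) \<and>
        (\<forall>z\<in>S_all N Me Mx K. eul_realizable (Uh i K z))"
    and final: "\<And>K. K \<in> \<T> \<Longrightarrow> Unext K = Uh s K"
    (* exact closure *)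
    and closure_nodes: "\<And>j K z. j < s \<Longrightarrow> K \<in> \<T> \<Longrightarrow> z \<in> S_all N Me Mx K \<Longrightarrow> 0 < z $ None \<Longrightarrow>
        eul_closed (eul_cl P) (z $ None) (vel P (xpart z)) (Uh j K z)"
    and closure_boundary: "\<And>j K \<delta> sd z. j < s \<Longrightarrow> K \<in> \<T> \<Longrightarrow>
        \<not> (\<exists>K'\<in>\<T>. neighbour \<delta> sd K K') \<Longrightarrow>
        z \<in> cell_map K ` face_ref_nodes N \<delta> sd \<Longrightarrow> 0 < z $ None \<Longrightarrow>
        eul_closed (eul_cl P) (z $ None) (vel P (xpart z)) (B j K \<delta> sd z)"
    and closure_collision: "\<And>i K. 1 \<le> i \<Longrightarrow> i \<le> s \<Longrightarrow> K \<in> \<T> \<Longrightarrow>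
        collision_closed (Q K) (a i * dt) (U_expl P N \<T> B c ch dt Uh i K) (Mlim i K)"
    (* realizable boundary data *)
    and boundary_realizable: "\<And>j K \<delta> sd z. j < s \<Longrightarrow> K \<in> \<T> \<Longrightarrow>
        \<not> (\<exists>K'\<in>\<T>. neighbour \<delta> sd K K') \<Longrightarrow>
        z \<in> cell_map K ` face_ref_nodes N \<delta> sd \<Longrightarrow> eul_realizable (B j K \<delta> sd z)"
    (* exactness of the quadratures *)
    and lg_exact: "\<And>j K \<delta>. j < s \<Longrightarrow> K \<in> \<T> \<Longrightarrow>
        rule_exact (lg_nodes N) (lg_weight N) K \<delta> (Uh j K)"
    and lgl_exact: "\<And>j K \<delta>. j < s \<Longrightarrow> K \<in> \<T> \<Longrightarrow>
        rule_exact (lgl_nodes (lgl_count Me Mx \<delta>)) (lgl_weight (lgl_count Me Mx \<delta>)) K \<delta> (Uh j K)"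
    (* wave speeds and time step; vanishing denominators impose no restriction *)
    and wave_eps: "\<And>x e w. x \<in> closure \<Omega>x \<Longrightarrow> 0 < e \<Longrightarrow>
        \<bar>qfac e (vel P x) (ugrad P x) w\<bar> \<le> a_eps P x"
    and wave_x: "\<And>l. 1 \<le> a_dir P l"
    and cfl_eps: "\<And>i j K x. 1 \<le> i \<Longrightarrow> i \<le> s \<Longrightarrow> j < i \<Longrightarrow> 0 < ch i j \<Longrightarrow> K \<in> \<T> \<Longrightarrow>
        x \<in> cbox (xpart (lo K)) (xpart (hi K)) \<Longrightarrow> 0 < a_eps P x \<Longrightarrow>
        dt \<le> (1 / ch i j) * (lorentz (vel P x) * (1 - norm (vel P x)) *
          (lgl_weight Me 1 * width K None / ((real CARD('d) + 1) * hi K $ None * a_eps P x)))"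
    and cfl_x: "\<And>i j K l. 1 \<le> i \<Longrightarrow> i \<le> s \<Longrightarrow> j < i \<Longrightarrow> 0 < ch i j \<Longrightarrow> K \<in> \<T> \<Longrightarrow>
        dt \<le> (1 / ch i j) *
          (lgl_weight Mx 1 * width K (Some l) / ((real CARD('d) + 1) * a_dir P l))"
    and element: "K \<in> \<T>"
  shows "eul_realizable (cell_avg K (Unext K))"
proof -
  \<comment> \<open>Since k is nonnegative, \<open>(k + 5) / 2 > 2\<close> and
    \<open>(k + 3) / 2 > 1\<close>; rounding up gives the node counts needed for an interior energy
    node and two spatial end nodes.\<close>
  have "2 < real Me" "1 < real Mx" using quadrature(2,3) by (simp_all add: field_simps)
  then have M: "3 \<le> Me" "2 \<le> Mx" by simp_all
  note cell = mesh_cell[OF mesh]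
  have card: "real CARD('d option) = real CARD('d) + 1"
    by (simp add: card_UNIV_option)
  \<comment> \<open>A stage draws on all earlier ones, hence the strong induction. The average is
    claimed for \<open>0 < i\<close> only, since stage 0 is given through its point values;
    \<open>s \<ge> 1\<close> puts the last stage in this range.\<close>
  have stage: "\<forall>K\<in>\<T>. tensor_poly k (Uh i K) \<and> (\<forall>z\<in>S_all N Me Mx K. eul_realizable (Uh i K z)) \<and>
      (0 < i \<longrightarrow> eul_realizable (cell_avg K (Uh i K)))" if "i \<le> s" for i
    using that
  proof (induction i rule: less_induct)
    case (less i)
    show ?case
    proof (cases "i = 0")
      case True
      then show ?thesis using init init_poly init_realizable by auto
    next
      case False
      then have i: "1 \<le> i" "i \<le> s" using less.prems by auto
      show ?thesis
      proof
        fix K assume K: "K \<in> \<T>"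
        have fe: "eul_realizable (cell_avg K (Uh j K) + (ch i j * dt) *\<^sub>R transport_op P N \<T> (B j) (Uh j) K)"
          if j: "j < i" for j
        proof (rule forward_euler_realizable[OF mesh velocity quadrature(1) M])
          have js: "j < s" using j i by simp
          have IH: "tensor_poly k (Uh j K')" "z \<in> S_all N Me Mx K' \<Longrightarrow> eul_realizable (Uh j K' z)"
            if "K' \<in> \<T>" for K' z using less.IH[OF j] js that by auto
          show "tensor_poly k (Uh j K)" by (rule IH(1)[OF K])
          show "eul_realizable (Uh j K' z)" if "K' \<in> \<T>" "z \<in> S_all N Me Mx K'" for K' z
            by (rule IH(2)[OF that])
          show "eul_closed (eul_cl P) (z $ None) (vel P (xpart z)) (Uh j K' z)"
            if "K' \<in> \<T>" "z \<in> S_all N Me Mx K'" "0 < z $ None" for K' z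
            by (rule closure_nodes[OF js that])
          show "eul_realizable (B j K \<delta> sd z)" if "\<not> (\<exists>K'\<in>\<T>. neighbour \<delta> sd K K')"
            "z \<in> cell_map K ` face_ref_nodes N \<delta> sd" for \<delta> sd z
            by (rule boundary_realizable[OF js K that])
          show "eul_closed (eul_cl P) (z $ None) (vel P (xpart z)) (B j K \<delta> sd z)"
            if "\<not> (\<exists>K'\<in>\<T>. neighbour \<delta> sd K K')"
            "z \<in> cell_map K ` face_ref_nodes N \<delta> sd" "0 < z $ None" for \<delta> sd z
            by (rule closure_boundary[OF js K that])
          show "rule_exact (lg_nodes N) (lg_weight N) K \<delta> (Uh j K)" for \<delta>
            by (rule lg_exact[OF js K])
          show "rule_exact (lgl_nodes (lgl_count Me Mx \<delta>)) (lgl_weight (lgl_count Me Mx \<delta>)) K \<delta> (Uh j K)" for \<delta>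
            by (rule lgl_exact[OF js K])
          show "\<bar>qfac e (vel P x) (ugrad P x) w\<bar> \<le> a_eps P x" if "x \<in> closure \<Omega>x" "0 < e" for x e w
            by (rule wave_eps[OF that])
          show "1 \<le> a_dir P l" for l by (rule wave_x)
          have ch: "0 \<le> ch i j" using c_nonneg[OF i j] by simp
          then show "0 \<le> ch i j * dt" using stages(2) by simp
          show "K \<in> \<T>" by (rule K)
          have width: "0 < width K \<delta>" for \<delta> using cell(1)[OF K] by (simp add: width_def)
          show "ch i j * dt * hi K $ None * a_eps P x \<le> width K None * lgl_weight Me 1 / real CARD('d option) *
              (lorentz (vel P x) * (1 - norm (vel P x)))"
            if x: "x \<in> cbox (xpart (lo K)) (xpart (hi K))" for x
          proof -
            \<comment> \<open>The spatial point is completed by the lower energy of the cell to a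
              phase-space point of \<open>K\<close>, so that \<open>mesh_closure\<close>
              applies.\<close>
            define z :: "'d pt" where "z = (\<chi> \<delta>. case \<delta> of None \<Rightarrow> lo K $ None | Some l \<Rightarrow> x $ l)"
            have "z \<in> cbox (lo K) (hi K)"
              using x less_imp_le[OF cell(1)[OF K]]
              by (auto simp: mem_box_cart z_def xpart_def split: option.split)
            then have "xpart z \<in> closure \<Omega>x" by (rule mesh_closure[OF mesh K])
            moreover have "xpart z = x" by (simp add: z_def xpart_def vec_eq_iff)
            ultimately have x': "x \<in> closure \<Omega>x" by simp
            define D where "D = lorentz (vel P x) * (1 - norm (vel P x))"
            have D: "0 < D" using velocity[OF x'] lorentz_pos by (simp add: D_def)
            have rhs: "0 \<le> width K None * lgl_weight Me 1 / real CARD('d option) * D"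
              using width[of None] D by (simp add: lgl_weight_nonneg)
            have a: "0 \<le> a_eps P x"
              by (rule order_trans[OF abs_ge_zero wave_eps[OF x' zero_less_one]])
            have h: "0 < hi K $ None" using cell[OF K] by (metis le_less_trans)
            show ?thesis
            \<comment> \<open>The assumed bound divides by both quantities. If one of them vanishes,
              the left side of the product form is 0 while the right side is nonnegative.\<close>
            proof (cases "0 < ch i j \<and> 0 < a_eps P x")
              case True
              define q where "q = hi K $ None * a_eps P x"
              have q: "0 < q" using True h by (simp add: q_def)
              have "dt \<le> (1 / ch i j) * (D * (lgl_weight Me 1 * width K None / ((real CARD('d) + 1) * hi K $ None * a_eps P x)))"
                unfolding D_def using cfl_eps[OF i j _ K x] True by blast
              then have "ch i j * dt * q \<le> ch i j * ((1 / ch i j) * (D * (lgl_weight Me 1 * width K None / ((real CARD('d) + 1) * q)))) * q"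
                using True q by (intro mult_right_mono mult_left_mono) (auto simp: q_def mult.assoc)
              also have "\<dots> = width K None * lgl_weight Me 1 / real CARD('d option) * D"
                using True q by (simp add: card add.commute mult.commute mult.left_commute)
              finally show ?thesis by (simp add: q_def D_def mult.assoc)
            next
              case False
              then have zero: "ch i j * dt * hi K $ None * a_eps P x = 0" using ch a by auto
              show ?thesis unfolding zero using rhs by (simp only: D_def)
            qed
          qed
          show "ch i j * dt * a_dir P l \<le> width K (Some l) * lgl_weight Mx 1 / real CARD('d option)" for l
          proof (cases "0 < ch i j")
            case True
            define q where "q = a_dir P l"
            have q: "0 < q" using wave_x[of l] by (simp add: q_def)
            have "ch i j * dt * q \<le> ch i j * ((1 / ch i j) *
                (lgl_weight Mx 1 * width K (Some l) / ((real CARD('d) + 1) * q))) * q"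
              using cfl_x[OF i j True K, of l] True q
              by (intro mult_right_mono mult_left_mono) (auto simp: q_def)
            also have "\<dots> = width K (Some l) * lgl_weight Mx 1 / real CARD('d option)"
              using True q by (simp add: card add.commute mult.commute mult.left_commute)
            finally show ?thesis by (simp add: q_def)
          next
            case False
            then have "ch i j = 0" using ch by simp
            then show ?thesis using width[of "Some l"] by (simp add: lgl_weight_nonneg)
          qed
        qed
        have "eul_realizable (U_expl P N \<T> B c ch dt Uh i K)"
          unfolding U_expl_def using c_nonneg[OF i] c_sum[OF i]
          by (intro eul_realizable_convex_sum fe) auto
        then have pre: "eul_realizable (cell_avg K (Upre i K))"
          using collision[OF K] lambda[OF K] a_nonneg[OF i] stages(2)
          by (intro implicit_update_realizable[OF _ _ _ _ _ _ _ _ stage_avg[OF i K] closure_collision[OF i K]]) auto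
        obtain \<theta>1 \<theta>2 where lim: "Uh i K = limited \<theta>1 \<theta>2 K (Upre i K)"
          and nodes: "\<forall>z\<in>S_all N Me Mx K. eul_realizable (Uh i K z)"
          using limiter[OF i K pre] by blast
        show "tensor_poly k (Uh i K) \<and> (\<forall>z\<in>S_all N Me Mx K. eul_realizable (Uh i K z)) \<and>
            (0 < i \<longrightarrow> eul_realizable (cell_avg K (Uh i K)))"
          using nodes pre tensor_poly_limited[OF stage_poly[OF i K]]
            cell_avg_limited[OF stage_poly[OF i K] cell[OF K]]
          by (simp add: lim)
      qed
    qed
  qed
  from stage[of s] element stages(1) show ?thesis by (simp add: final)
qed

end
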